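(* Let $k_0,p\in\mathbb N$ and let $\mathcal{C}$ be a $(k_0,p)$-near-uniform graph class. Then the FO model checking problem on $\mathcal{C}$ is fixed-parameter tractable when parameterized by the formula size: there is an algorithm which, given $G\in\mathcal{C}$ and a first-order sentence $\phi$, decides whether $G\models\phi$ in time $f(|\phi|)\cdot|V(G)|^{\mathcal{O}(1)}$ for some computable function $f$.
   Context: All graphs are finite, simple and undirected. First-order logic of graphs (FO) has variables ranging over vertices, the predicates $x=y$ and $edge(x,y)$ (meaning $\{x,y\}\in E(G)$), possibly unary label predicates, Boolean connectives and quantifiers $\forall,\exists$ over vertices. For $v\in V(G)$, $N(v)=\{w\mid\{v,w\}\in E(G)\}$; $\mathop{\bigtriangleup}$ is symmetric difference. For $k\in\mathbb N$, the near-$k$-twin relation $\rho_k$ of $G$ is given by $(u,v)\in\rho_k$ iff $|N(u)\mathop{\bigtriangleup} N(v)|\le k$. A graph $G$ is $(k_0,p)$-near-uniform if there exists $k\le k_0$ such that $\rho_k$ is an equivalence relation on $V(G)$ with at most $p$ classes; a class is $(k_0,p)$-near-uniform if all its members are. *)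

theory Defs
  imports Main
begin

section \<open>Labelled graphs\<close>

text \<open>
  Finite simple undirected graphs over a finite set of unary label predicates: \<open>labels G ! i\<close> is the
  set of vertices carrying label \<open>i\<close>. Unlabelled graphs are those with \<open>labels G = []\<close>.
\<close>

record 'a graph =
  verts :: "'a set"
  edges :: "'a set set"
  labels :: "'a set list"

definition wf_graph :: "nat \<Rightarrow> 'a graph \<Rightarrow> bool" where
  "wf_graph l G \<longleftrightarrow>
     finite (verts G) \<and>
     (\<forall>e \<in> edges G. \<exists>u v. u \<in> verts G \<and> v \<in> verts G \<and> u \<noteq> v \<and> e = {u, v}) \<and>
     length (labels G) = l \<and> (\<forall>L \<in> set (labels G). L \<subseteq> verts G)"

definition nbh :: "'a graph \<Rightarrow> 'a \<Rightarrow> 'a set" where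
  "nbh G v = {w. {v, w} \<in> edges G}"

definition near_twin :: "'a graph \<Rightarrow> nat \<Rightarrow> ('a \<times> 'a) set" where
  "near_twin G k = {(u, v). u \<in> verts G \<and> v \<in> verts G \<and> card (sym_diff (nbh G u) (nbh G v)) \<le> k}"

definition near_uniform :: "nat \<Rightarrow> nat \<Rightarrow> 'a graph \<Rightarrow> bool" where
  "near_uniform k0 p G \<longleftrightarrow>
     (\<exists>k \<le> k0. equiv (verts G) (near_twin G k) \<and> card (verts G // near_twin G k) \<le> p)"

definition near_uniform_class :: "nat \<Rightarrow> nat \<Rightarrow> 'a graph set \<Rightarrow> bool" where
  "near_uniform_class k0 p C \<longleftrightarrow> (\<forall>G \<in> C. near_uniform k0 p G)"

section \<open>First-order logic of labelled graphs\<close>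

datatype fm =
    Equal nat nat
  | Edge nat nat
  | Label nat nat
  | Neg fm
  | Conj fm fm
  | Disj fm fm
  | Exists nat fm
  | Forall nat fm

primrec sat :: "'a graph \<Rightarrow> (nat \<Rightarrow> 'a) \<Rightarrow> fm \<Rightarrow> bool" where
  "sat G s (Equal x y) \<longleftrightarrow> s x = s y"
| "sat G s (Edge x y) \<longleftrightarrow> {s x, s y} \<in> edges G"
| "sat G s (Label i x) \<longleftrightarrow> s x \<in> labels G ! i"
| "sat G s (Neg \<phi>) \<longleftrightarrow> \<not> sat G s \<phi>"
| "sat G s (Conj \<phi> \<psi>) \<longleftrightarrow> sat G s \<phi> \<and> sat G s \<psi>"
| "sat G s (Disj \<phi> \<psi>) \<longleftrightarrow> sat G s \<phi> \<or> sat G s \<psi>"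
| "sat G s (Exists x \<phi>) \<longleftrightarrow> (\<exists>v \<in> verts G. sat G (s(x := v)) \<phi>)"
| "sat G s (Forall x \<phi>) \<longleftrightarrow> (\<forall>v \<in> verts G. sat G (s(x := v)) \<phi>)"

primrec fv :: "fm \<Rightarrow> nat set" where
  "fv (Equal x y) = {x, y}"
| "fv (Edge x y) = {x, y}"
| "fv (Label i x) = {x}"
| "fv (Neg \<phi>) = fv \<phi>"
| "fv (Conj \<phi> \<psi>) = fv \<phi> \<union> fv \<psi>"
| "fv (Disj \<phi> \<psi>) = fv \<phi> \<union> fv \<psi>"
| "fv (Exists x \<phi>) = fv \<phi> - {x}"
| "fv (Forall x \<phi>) = fv \<phi> - {x}"

primrec label_inds :: "fm \<Rightarrow> nat set" where
  "label_inds (Equal x y) = {}"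
| "label_inds (Edge x y) = {}"
| "label_inds (Label i x) = {i}"
| "label_inds (Neg \<phi>) = label_inds \<phi>"
| "label_inds (Conj \<phi> \<psi>) = label_inds \<phi> \<union> label_inds \<psi>"
| "label_inds (Disj \<phi> \<psi>) = label_inds \<phi> \<union> label_inds \<psi>"
| "label_inds (Exists x \<phi>) = label_inds \<phi>"
| "label_inds (Forall x \<phi>) = label_inds \<phi>"

definition sentence :: "nat \<Rightarrow> fm \<Rightarrow> bool" where
  "sentence l \<phi> \<longleftrightarrow> fv \<phi> = {} \<and> label_inds \<phi> \<subseteq> {..<l}"

text \<open>For sentences the choice of the assignment is irrelevant.\<close>

definition models :: "'a graph \<Rightarrow> fm \<Rightarrow> bool" where
  "models G \<phi> \<longleftrightarrow> (\<forall>s. sat G s \<phi>)"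

text \<open>
  The length of a formula as a word. A variable with index \<open>x\<close> is written in unary, with \<open>x + 1\<close>
  symbols: the input has to name its variables, and no machine can read arbitrarily long names in
  time bounded by the number of nodes of the formula alone. Any other numeral system changes the
  length by at most an exponential, and every sentence can be renamed so that its indices are below
  its number of symbols; so none of this matters for a parameter that enters a running time only
  through an arbitrary computable function.
\<close>

primrec fm_size :: "fm \<Rightarrow> nat" where
  "fm_size (Equal x y) = 1 + (x + 1) + (y + 1)"
| "fm_size (Edge x y) = 1 + (x + 1) + (y + 1)"
| "fm_size (Label i x) = 1 + (x + 1)"
| "fm_size (Neg \<phi>) = 1 + fm_size \<phi>"
| "fm_size (Conj \<phi> \<psi>) = 1 + fm_size \<phi> + fm_size \<psi>"
| "fm_size (Disj \<phi> \<psi>) = 1 + fm_size \<phi> + fm_size \<psi>"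
| "fm_size (Exists x \<phi>) = 1 + (x + 1) + fm_size \<phi>"
| "fm_size (Forall x \<phi>) = 1 + (x + 1) + fm_size \<phi>"

section \<open>Algorithms and their running time\<close>

text \<open>
  The machine model is the first-order call-by-value functional language on binary trees (pure LISP
  with the single atom \<open>Leaf\<close>), as in N. D. Jones, \<open>Computability and Complexity from a Programming
  Perspective\<close>. Every evaluation step has unit cost. The only operations on data are consing,
  taking a component and testing for \<open>Leaf\<close>; in particular there is no unit-cost comparison of
  trees, and so each step is a constant number of pointer operations on shared trees. The model is
  Turing complete and polynomially equivalent in time to multitape Turing machines.

  A program is a list of function bodies; \<open>Arg i\<close> is the \<open>i\<close>-th argument of the current call and
  \<open>Call f es\<close> calls the \<open>f\<close>-th function. The first function is the main one.
\<close>

datatype tree = Leaf | Node tree tree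

datatype expr =
    Arg nat
  | ELeaf
  | ENode expr expr
  | Fst expr
  | Snd expr
  | IfLeaf expr expr expr
  | Call nat "expr list"

type_synonym program = "expr list"

primrec tfst :: "tree \<Rightarrow> tree" where
  "tfst Leaf = Leaf"
| "tfst (Node a b) = a"

primrec tsnd :: "tree \<Rightarrow> tree" where
  "tsnd Leaf = Leaf"
| "tsnd (Node a b) = b"

text \<open>\<open>eval P vs e v t\<close>: with arguments \<open>vs\<close>, expression \<open>e\<close> evaluates to \<open>v\<close> in exactly \<open>t\<close> steps.\<close>

inductive eval :: "program \<Rightarrow> tree list \<Rightarrow> expr \<Rightarrow> tree \<Rightarrow> nat \<Rightarrow> bool"
  and evals :: "program \<Rightarrow> tree list \<Rightarrow> expr list \<Rightarrow> tree list \<Rightarrow> nat \<Rightarrow> bool"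
  for P :: program
where
  eval_Arg: "i < length vs \<Longrightarrow> eval P vs (Arg i) (vs ! i) 1"
| eval_ELeaf: "eval P vs ELeaf Leaf 1"
| eval_ENode: "eval P vs e1 v1 t1 \<Longrightarrow> eval P vs e2 v2 t2 \<Longrightarrow>
    eval P vs (ENode e1 e2) (Node v1 v2) (1 + t1 + t2)"
| eval_Fst: "eval P vs e v t \<Longrightarrow> eval P vs (Fst e) (tfst v) (1 + t)"
| eval_Snd: "eval P vs e v t \<Longrightarrow> eval P vs (Snd e) (tsnd v) (1 + t)"
| eval_IfLeaf: "eval P vs e Leaf t \<Longrightarrow> eval P vs e1 v1 t1 \<Longrightarrow>
    eval P vs (IfLeaf e e1 e2) v1 (1 + t + t1)"
| eval_IfNode: "eval P vs e (Node a b) t \<Longrightarrow> eval P vs e2 v2 t2 \<Longrightarrow>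
    eval P vs (IfLeaf e e1 e2) v2 (1 + t + t2)"
| eval_Call: "f < length P \<Longrightarrow> evals P vs es ws t1 \<Longrightarrow> eval P ws (P ! f) v t2 \<Longrightarrow>
    eval P vs (Call f es) v (1 + t1 + t2)"
| evals_Nil: "evals P vs [] [] 0"
| evals_Cons: "eval P vs e v t1 \<Longrightarrow> evals P vs es ws t2 \<Longrightarrow>
    evals P vs (e # es) (v # ws) (t1 + t2)"

inductive_cases eval_ArgE: "eval P vs (Arg i) v t"
inductive_cases eval_ELeafE: "eval P vs ELeaf v t"
inductive_cases eval_ENodeE: "eval P vs (ENode e1 e2) v t"
inductive_cases eval_FstE: "eval P vs (Fst e) v t"
inductive_cases eval_SndE: "eval P vs (Snd e) v t"
inductive_cases eval_IfLeafE: "eval P vs (IfLeaf e e1 e2) v t"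
inductive_cases eval_CallE: "eval P vs (Call f es) v t"
inductive_cases evals_NilE: "evals P vs [] ws t"
inductive_cases evals_ConsE: "evals P vs (e # es) ws t"

lemma eval_deterministic:
  "eval P vs e v t \<Longrightarrow> eval P vs e v' t' \<Longrightarrow> v = v' \<and> t = t'"
  "evals P vs es ws t \<Longrightarrow> evals P vs es ws' t' \<Longrightarrow> ws = ws' \<and> t = t'"
proof (induction arbitrary: v' t' and ws' t' rule: eval_evals.inducts)
  case (eval_Arg i vs)
  then show ?case by (auto elim: eval_ArgE)
next
  case (eval_ELeaf vs)
  then show ?case by (auto elim: eval_ELeafE)
next
  case (eval_ENode vs e1 v1 t1 e2 v2 t2)
  from eval_ENode.prems show ?case
    by (rule eval_ENodeE) (metis eval_ENode.IH plus_1_eq_Suc add.assoc)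
next
  case (eval_Fst vs e v t)
  from eval_Fst.prems show ?case
    by (rule eval_FstE) (metis eval_Fst.IH plus_1_eq_Suc add.assoc)
next
  case (eval_Snd vs e v t)
  from eval_Snd.prems show ?case
    by (rule eval_SndE) (metis eval_Snd.IH plus_1_eq_Suc add.assoc)
next
  case (eval_IfLeaf vs e t e1 v1 t1 e2)
  from eval_IfLeaf.prems show ?case
    by (rule eval_IfLeafE) (metis eval_IfLeaf.IH tree.distinct(1) plus_1_eq_Suc add.assoc)+
next
  case (eval_IfNode vs e a b t e2 v2 t2 e1)
  from eval_IfNode.prems show ?case
    by (rule eval_IfLeafE) (metis eval_IfNode.IH tree.distinct(1) plus_1_eq_Suc add.assoc)+
next
  case (eval_Call f vs es ws t1 v t2)
  from eval_Call.prems show ?case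
    by (rule eval_CallE) (metis eval_Call.IH plus_1_eq_Suc add.assoc)
next
  case (evals_Nil vs)
  then show ?case by (auto elim: evals_NilE)
next
  case (evals_Cons vs e v t1 es ws t2)
  from evals_Cons.prems show ?case
    by (rule evals_ConsE) (metis evals_Cons.IH plus_1_eq_Suc add.assoc)
qed

definition runs_in :: "program \<Rightarrow> tree list \<Rightarrow> tree \<Rightarrow> nat \<Rightarrow> bool" where
  "runs_in P vs v t \<longleftrightarrow> P \<noteq> [] \<and> eval P vs (hd P) v t"

section \<open>Encodings\<close>

fun enc_list :: "tree list \<Rightarrow> tree" where
  "enc_list [] = Leaf"
| "enc_list (v # vs) = Node v (enc_list vs)"

definition enc_bool :: "bool \<Rightarrow> tree" where
  "enc_bool b = (if b then Node Leaf Leaf else Leaf)"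

definition enc_nat :: "nat \<Rightarrow> tree" where
  "enc_nat n = enc_list (replicate n Leaf)"

primrec enc_fm :: "fm \<Rightarrow> tree" where
  "enc_fm (Equal x y) = enc_list [enc_nat 0, enc_nat x, enc_nat y]"
| "enc_fm (Edge x y) = enc_list [enc_nat 1, enc_nat x, enc_nat y]"
| "enc_fm (Label i x) = enc_list [enc_nat 2, enc_nat i, enc_nat x]"
| "enc_fm (Neg \<phi>) = enc_list [enc_nat 3, enc_fm \<phi>]"
| "enc_fm (Conj \<phi> \<psi>) = enc_list [enc_nat 4, enc_fm \<phi>, enc_fm \<psi>]"
| "enc_fm (Disj \<phi> \<psi>) = enc_list [enc_nat 5, enc_fm \<phi>, enc_fm \<psi>]"
| "enc_fm (Exists x \<phi>) = enc_list [enc_nat 6, enc_nat x, enc_fm \<phi>]"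
| "enc_fm (Forall x \<phi>) = enc_list [enc_nat 7, enc_nat x, enc_fm \<phi>]"

text \<open>
  The input graph is presented by the rows of its adjacency matrix with respect to an enumeration
  \<open>xs\<close> of its vertices, each row preceded by the label bits of the vertex.
\<close>

definition enumerates :: "'a list \<Rightarrow> 'a graph \<Rightarrow> bool" where
  "enumerates xs G \<longleftrightarrow> distinct xs \<and> set xs = verts G"

definition enc_graph :: "'a graph \<Rightarrow> 'a list \<Rightarrow> tree" where
  "enc_graph G xs =
     enc_list (map (\<lambda>v. Node (enc_list (map (\<lambda>L. enc_bool (v \<in> L)) (labels G)))
                             (enc_list (map (\<lambda>w. enc_bool ({v, w} \<in> edges G)) xs))) xs)"

definition computable :: "(nat \<Rightarrow> nat) \<Rightarrow> bool" where
  "computable f \<longleftrightarrow> (\<exists>P. \<forall>n. \<exists>t. runs_in P [enc_nat n] (enc_nat (f n)) t)"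

end

theory Submission
  imports Defs
begin

text \<open>
  Greedily choose pairwise not close vertices, two vertices being close if their neighbourhoods
  differ in at most \<open>k0\<close> vertices. In a near-uniform graph there are at most \<open>p\<close> such representatives
  and every vertex is close to one of them, so its neighbourhood is that of the representative up to
  at most \<open>k0\<close> exceptions. By double counting only a bounded number of vertices, the hubs, are
  exceptions of many vertices. Therefore, given the labels recording adjacency to the
  representatives and hubs, adjacency is decided by the labels up to a relation of bounded degree.

  In such a structure the truth of a formula depends only on the atomic type of a sufficiently
  large neighbourhood of the tuple of its free variables (Hanf's locality argument). With the
  neighbours of each vertex listed in a fixed order, a neighbourhood is a list whose length depends
  on the formula only, and its type is a list of bits. The algorithm evaluates the formula
  recursively and tests, at each quantifier, one vertex per type over the current tuple; the
  branching is bounded by the number of types, everything else takes polynomial time.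
\<close>

section \<open>Linking programs\<close>

text \<open>The threshold for which closeness is an equivalence depends on the graph and is not
  known to the program, which works with the upper bound \<open>k0\<close> throughout. Closeness for
  \<open>k0\<close> may fail to be transitive, so there are no classes to compute with; what
  survives is a packing bound.

  The running time is that of a concrete program. Its polynomial ingredients come from closure
  properties of polynomial time functions. The recursion on the formula, the loops over the tested
  vertices and the iterated enlargement of neighbourhoods are not polynomial, because the formula is
  part of the input; together with the entry point they form five functions written by hand and
  placed in front of the polynomial helpers. The dependence on the formula is a fixed stack of
  exponentials, but it is estimated by a tower whose height is the formula size plus a constant:
  such towers absorb all arithmetic, and only they have to be shown computable.\<close>

primrec shift :: "nat \<Rightarrow> expr \<Rightarrow> expr" where
  "shift k (Arg i) = Arg i"
| "shift k ELeaf = ELeaf"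
| "shift k (ENode a b) = ENode (shift k a) (shift k b)"
| "shift k (Fst a) = Fst (shift k a)"
| "shift k (Snd a) = Snd (shift k a)"
| "shift k (IfLeaf a b c) = IfLeaf (shift k a) (shift k b) (shift k c)"
| "shift k (Call f es) = Call (k + f) (map (shift k) es)"

lemma shift_0: "shift 0 e = e"
  by (induction e) (auto simp: map_idI)

text \<open>Relocation of code: a copy placed behind \<open>A\<close> with its calls renumbered by
  the length of \<open>A\<close> reaches its own bodies again, so even the exact step count is
  preserved.\<close>

lemma eval_shift:
  "eval P vs e v t \<Longrightarrow>
    eval (A @ map (shift (length A)) P @ B) vs (shift (length A) e) v t"
  "evals P vs es ws t \<Longrightarrow>
    evals (A @ map (shift (length A)) P @ B) vs (map (shift (length A)) es) ws t"
proof (induction rule: eval_evals.inducts)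
  case (eval_Call f vs es ws t1 v t2)
  then have "eval (A @ map (shift (length A)) P @ B) ws
      ((A @ map (shift (length A)) P @ B) ! (length A + f)) v t2"
    by (simp add: nth_append)
  moreover have "length A + f < length (A @ map (shift (length A)) P @ B)"
    using eval_Call by simp
  ultimately show ?case
    using eval_evals.eval_Call[OF _ eval_Call(3)] by (simp del: nth_append_length_plus)
qed (auto intro: eval_evals.intros[simplified])

text \<open>Upper bounds in place of exact step counts, so that branches of different cost share one
  bound and accumulated constants may be rounded up.\<close>

definition evl :: "program \<Rightarrow> tree list \<Rightarrow> expr \<Rightarrow> tree \<Rightarrow> nat \<Rightarrow> bool" where
  "evl P vs e v T \<longleftrightarrow> (\<exists>t\<le>T. eval P vs e v t)"

definition calls :: "program \<Rightarrow> nat \<Rightarrow> tree list \<Rightarrow> tree \<Rightarrow> nat \<Rightarrow> bool" where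
  "calls P i vs v T \<longleftrightarrow> i < length P \<and> evl P vs (P ! i) v T"

lemma evl_mono: "evl P vs e v T \<Longrightarrow> T \<le> T' \<Longrightarrow> evl P vs e v T'"
  unfolding evl_def by (meson le_trans)

lemma calls_mono: "calls P i vs v T \<Longrightarrow> T \<le> T' \<Longrightarrow> calls P i vs v T'"
  unfolding calls_def using evl_mono by blast

lemma evl_Arg: "i < length vs \<Longrightarrow> evl P vs (Arg i) (vs ! i) 1"
  unfolding evl_def using eval_Arg by blast

lemma evl_Arg0: "evl P (a # vs) (Arg 0) a 1"
  using evl_Arg[of 0 "a # vs"] by simp

lemma evl_Arg1: "evl P (a # b # vs) (Arg 1) b 1"
  using evl_Arg[of 1 "a # b # vs"] by simp

lemma evl_Arg2: "evl P (a # b # c # vs) (Arg 2) c 1"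
  using evl_Arg[of 2 "a # b # c # vs"] by simp

lemma evl_Arg3: "evl P (a # b # c # d # vs) (Arg 3) d 1"
  using evl_Arg[of 3 "a # b # c # d # vs"] by simp

lemma evl_Arg4: "evl P (a # b # c # d # e # vs) (Arg 4) e 1"
  using evl_Arg[of 4 "a # b # c # d # e # vs"] by simp

lemma evl_ELeaf: "evl P vs ELeaf Leaf 1"
  unfolding evl_def using eval_ELeaf by blast

lemma evl_ENode: "evl P vs a v1 t1 \<Longrightarrow> evl P vs b v2 t2 \<Longrightarrow>
    evl P vs (ENode a b) (Node v1 v2) (1 + t1 + t2)"
  unfolding evl_def by (meson add_mono_thms_linordered_semiring(1) eval_ENode order_refl)

lemma evl_Fst: "evl P vs e v t \<Longrightarrow> evl P vs (Fst e) (tfst v) (1 + t)"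
  unfolding evl_def by (meson add_mono_thms_linordered_semiring(1) eval_Fst order_refl)

lemma evl_Snd: "evl P vs e v t \<Longrightarrow> evl P vs (Snd e) (tsnd v) (1 + t)"
  unfolding evl_def by (meson add_mono_thms_linordered_semiring(1) eval_Snd order_refl)

lemma evl_Fst': "evl P vs e (Node a b) t \<Longrightarrow> evl P vs (Fst e) a (1 + t)"
  using evl_Fst[of P vs e "Node a b"] by simp

lemma evl_Snd': "evl P vs e (Node a b) t \<Longrightarrow> evl P vs (Snd e) b (1 + t)"
  using evl_Snd[of P vs e "Node a b"] by simp

text \<open>Each branch is assumed only under the outcome that selects it; a recursion in the other
  branch then needs no bound at the point where the test stops it.\<close>

lemma evl_If:
  assumes "evl P vs e w t" "w = Leaf \<Longrightarrow> evl P vs e1 v t'" "w \<noteq> Leaf \<Longrightarrow> evl P vs e2 v t'"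
  shows "evl P vs (IfLeaf e e1 e2) v (1 + t + t')"
proof -
  from assms(1) obtain k where k: "k \<le> t" "eval P vs e w k" unfolding evl_def by blast
  show ?thesis
  proof (cases w)
    case Leaf
    with assms(2) obtain k' where "k' \<le> t'" "eval P vs e1 v k'" unfolding evl_def by blast
    with k Leaf eval_IfLeaf[of P vs e k e1 v k' e2] show ?thesis
      unfolding evl_def by (intro exI[of _ "1 + k + k'"]) simp
  next
    case (Node a b)
    with assms(3) obtain k' where "k' \<le> t'" "eval P vs e2 v k'" unfolding evl_def by blast
    with k Node eval_IfNode[of P vs e a b k e2 v k' e1] show ?thesis
      unfolding evl_def by (intro exI[of _ "1 + k + k'"]) simp
  qed
qed

lemma evl_If_True: "evl P vs e Leaf t \<Longrightarrow> evl P vs e1 v t' \<Longrightarrow>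
    evl P vs (IfLeaf e e1 e2) v (1 + t + t')"
  by (rule evl_If) auto

lemma evl_If_False: "evl P vs e w t \<Longrightarrow> w \<noteq> Leaf \<Longrightarrow> evl P vs e2 v t' \<Longrightarrow>
    evl P vs (IfLeaf e e1 e2) v (1 + t + t')"
  by (rule evl_If) auto

lemma calls_link: "calls P i vs v T \<Longrightarrow>
    calls (A @ map (shift (length A)) P @ B) (length A + i) vs v T"
  unfolding calls_def evl_def by (auto simp: nth_append dest: eval_shift(1)[of _ _ _ _ _ A B])

lemma calls_append: "calls P i vs v T \<Longrightarrow> calls (P @ B) i vs v T"
  using calls_link[of P i vs v T "[]" B] by (simp add: shift_0 map_idI)

definition evls :: "program \<Rightarrow> tree list \<Rightarrow> expr list \<Rightarrow> tree list \<Rightarrow> nat \<Rightarrow> bool" where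
  "evls P vs es ws T \<longleftrightarrow> (\<exists>t\<le>T. evals P vs es ws t)"

lemma evls_Nil: "evls P vs [] [] 0"
  unfolding evls_def by (auto intro: evals_Nil)

lemma evls_Cons: "evl P vs e v t1 \<Longrightarrow> evls P vs es ws t2 \<Longrightarrow>
    evls P vs (e # es) (v # ws) (t1 + t2)"
  unfolding evl_def evls_def by (meson add_mono evals_Cons)

lemma evl_Call: "evls P vs es ws t1 \<Longrightarrow> calls P f ws v t2 \<Longrightarrow>
    evl P vs (Call f es) v (1 + t1 + t2)"
  unfolding evl_def evls_def calls_def
  by (meson add_mono_thms_linordered_semiring(1) eval_Call order_refl)

lemmas evl_rules = evl_Arg0 evl_Arg1 evl_Arg2 evl_Arg3 evl_Arg4 evl_ELeaf evl_ENode evl_Fst'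
  evl_Snd' evls_Nil evls_Cons

lemma nth_append_simps:
  "((a # xs) @ Q) ! 0 = a" "((a # b # xs) @ Q) ! 1 = b" "((a # b # c # xs) @ Q) ! 2 = c"
  "((a # b # c # d # xs) @ Q) ! 3 = d" "((a # b # c # d # e # xs) @ Q) ! 4 = e"
  by (simp_all add: numeral_2_eq_2 numeral_3_eq_3 numeral_eq_Suc)

text \<open>The pattern of the program verifications: the evaluation rules assemble
  \<open>T'\<close> as a schematic sum, and the last premise compares it with the announced
  bound.\<close>

lemma callsI: "i < length P \<Longrightarrow> P ! i = e \<Longrightarrow> evl P vs e v T' \<Longrightarrow> T' \<le> T \<Longrightarrow> calls P i vs v T"
  unfolding calls_def using evl_mono by blast

text \<open>A behaviour is a set of triples (argument, value, time bound) of a unary function.\<close>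

type_synonym behaviour = "(tree \<times> tree \<times> nat) set"

definition realizes :: "program \<Rightarrow> nat \<Rightarrow> behaviour \<Rightarrow> bool" where
  "realizes P i S \<longleftrightarrow> (\<forall>(a, b, T) \<in> S. calls P i [a] b T)"

text \<open>The block \<open>B\<close> is quantified after \<open>Q\<close> and \<open>off\<close>
  because its bodies contain calls to the positions \<open>off j\<close>. Only its length
  \<open>m\<close> has to be known when the library is laid out.\<close>

lemma link:
  assumes "\<forall>S \<in> set Ss. \<exists>P. realizes P 0 S"
  shows "\<exists>Q off. \<forall>B. length B = m \<longrightarrow>
    (\<forall>j < length Ss. realizes (B @ Q) (off j) (Ss ! j))"
  using assms
proof (induction Ss rule: rev_induct)
  case Nil
  then show ?case by simp
next
  case (snoc S Ss)
  then obtain Q off where IH: "\<And>B. length B = m \<Longrightarrow>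
      (\<forall>j < length Ss. realizes (B @ Q) (off j) (Ss ! j))" by auto
  from snoc.prems obtain P where P: "realizes P 0 S" by auto
  define Q' where "Q' = Q @ map (shift (m + length Q)) P"
  define off' where "off' = off(length Ss := m + length Q)"
  have "realizes (B @ Q') (off' j) ((Ss @ [S]) ! j)"
    if B: "length B = m" and j: "j < length (Ss @ [S])" for B j
  proof (cases "j = length Ss")
    case True
    from P have "realizes ((B @ Q) @ map (shift (length (B @ Q))) P @ []) (length (B @ Q) + 0) S"
      unfolding realizes_def using calls_link[of P 0 _ _ _ "B @ Q" "[]"] by blast
    with True B show ?thesis by (simp add: Q'_def off'_def)
  next
    case False
    with j have "j < length Ss" by simp
    with IH[OF B] have "realizes (B @ Q) (off j) (Ss ! j)" by blast
    then have "realizes ((B @ Q) @ map (shift (m + length Q)) P) (off j) (Ss ! j)"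
      unfolding realizes_def using calls_append by blast
    with False \<open>j < length Ss\<close> show ?thesis by (simp add: Q'_def off'_def nth_append)
  qed
  then show ?case by blast
qed

section \<open>Polynomial time on encoded data\<close>

text \<open>Injectivity within a type lets a comparison of trees decide equality of values.
  Different types share trees: \<open>False\<close>, \<open>0\<close>, \<open>[]\<close> and
  \<open>()\<close> are all \<open>Leaf\<close>, and a number is a list of units. Passing between
  such types costs nothing, which \<open>ptc_cast\<close> exploits.\<close>

class enc =
  fixes enc :: "'a \<Rightarrow> tree"
  assumes enc_inj: "enc x = enc y \<longleftrightarrow> x = y"

lemma enc_list_inj: "enc_list xs = enc_list ys \<longleftrightarrow> xs = ys"
proof (induction xs arbitrary: ys)
  case Nil
  then show ?case by (cases ys) auto
next
  case (Cons a xs)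
  then show ?case by (cases ys) auto
qed

instantiation tree :: enc
begin
definition enc_tree :: "tree \<Rightarrow> tree" where "enc_tree t = t"
instance by standard (simp add: enc_tree_def)
end

instantiation unit :: enc
begin
definition enc_unit :: "unit \<Rightarrow> tree" where "enc_unit t = Leaf"
instance by standard simp
end

instantiation bool :: enc
begin
definition enc_bool_def': "enc = enc_bool"
instance by standard (auto simp: enc_bool_def' enc_bool_def)
end

instantiation nat :: enc
begin
definition enc_nat_def': "enc = enc_nat"
instance by standard (auto simp: enc_nat_def' enc_nat_def enc_list_inj dest: arg_cong[of _ _ length])
end

instantiation list :: (enc) enc
begin
definition enc_list_def': "enc xs = enc_list (map enc xs)"
instance by standard (auto simp: enc_list_def' enc_list_inj enc_inj inj_def)
end

instantiation prod :: (enc, enc) enc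
begin
definition enc_prod_def: "enc z = Node (enc (fst z)) (enc (snd z))"
instance by standard (auto simp: enc_prod_def enc_inj prod_eq_iff)
end

lemma enc_Pair[simp]: "enc (a, b) = Node (enc a) (enc b)"
  by (simp add: enc_prod_def)

lemma enc_Nil[simp]: "enc ([] :: 'a :: enc list) = Leaf"
  by (simp add: enc_list_def')

lemma enc_Cons[simp]: "enc (x # xs) = Node (enc x) (enc xs)"
  by (simp add: enc_list_def')

lemma enc_False[simp]: "enc False = Leaf"
  by (simp add: enc_bool_def' enc_bool_def)

lemma enc_True[simp]: "enc True = Node Leaf Leaf"
  by (simp add: enc_bool_def' enc_bool_def)

lemma enc_0[simp]: "enc (0 :: nat) = Leaf"
  by (simp add: enc_nat_def' enc_nat_def)

lemma enc_Suc[simp]: "enc (Suc n) = Node Leaf (enc n)"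
  by (simp add: enc_nat_def' enc_nat_def)

lemma enc_unit[simp]: "enc () = Leaf"
  by (simp add: enc_unit_def)

lemma enc_tree[simp]: "enc (t :: tree) = t"
  by (simp add: enc_tree_def)

lemma enc_replicate: "enc (replicate n ()) = enc n"
  by (induction n) auto

section \<open>Sizes of encodings and polynomial bounds\<close>

abbreviation sz :: "'a :: enc \<Rightarrow> nat" where "sz x \<equiv> size (enc x)"

lemma sz_Pair: "sz (a, b) = Suc (sz a + sz b)"
  by simp

lemma sz_bool: "sz (b :: bool) \<le> 1"
  by (cases b) auto

lemma length_le_sz: "length xs \<le> sz xs"
  by (induction xs) auto

lemma sz_mem: "x \<in> set xs \<Longrightarrow> sz x \<le> sz xs"
  by (induction xs) auto

text \<open>The offset keeps the base at least 2 even for \<open>Leaf\<close>, whose size is 0, so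
  constants and factors are absorbed into the exponent.\<close>

definition pbd :: "('a :: enc \<Rightarrow> nat) \<Rightarrow> bool" where
  "pbd g \<longleftrightarrow> (\<exists>d. \<forall>x. g x \<le> (sz x + 2) ^ d)"

lemma pbd_mono: "pbd g \<Longrightarrow> (\<And>x. h x \<le> g x) \<Longrightarrow> pbd h"
  unfolding pbd_def by (meson le_trans)

lemma pbd_const: "pbd (\<lambda>x. c)"
proof -
  have "c \<le> (s + 2) ^ c" for s :: nat
    by (rule le_trans[OF less_imp_le[OF less_exp]]) (simp add: power_mono)
  then show ?thesis unfolding pbd_def by blast
qed

lemma pbd_sz: "pbd (\<lambda>x. sz x)"
  unfolding pbd_def by (rule exI[of _ 1]) simp

lemma pbd_mult: "pbd g \<Longrightarrow> pbd h \<Longrightarrow> pbd (\<lambda>x. g x * h x)"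
  unfolding pbd_def by (metis mult_le_mono power_add)

lemma pbd_add: assumes "pbd g" "pbd h" shows "pbd (\<lambda>x. g x + h x)"
proof -
  have "pbd (\<lambda>x. (g x + 1) + (h x + 1))" if "pbd (\<lambda>x. g x + 1)" "pbd (\<lambda>x. h x + 1)" for g h :: "'a \<Rightarrow> nat"
  proof (rule pbd_mono[OF pbd_mult[OF pbd_const[of 2] pbd_mult[OF that]]])
    fix x
    show "g x + 1 + (h x + 1) \<le> 2 * ((g x + 1) * (h x + 1))" by simp
  qed
  moreover have "pbd (\<lambda>x. g x + 1)" if "pbd g" for g :: "'a \<Rightarrow> nat"
  proof -
    from that obtain d where d: "\<forall>x. g x \<le> (sz x + 2) ^ d" unfolding pbd_def by blast
    have "g x + 1 \<le> (sz x + 2) ^ Suc d" for x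
    proof -
      have "1 \<le> (sz x + 2) ^ d" by simp
      with d[rule_format, of x] have "g x + 1 \<le> 2 * (sz x + 2) ^ d" by linarith
      also have "\<dots> \<le> (sz x + 2) ^ Suc d" by simp
      finally show ?thesis .
    qed
    then show ?thesis unfolding pbd_def by blast
  qed
  ultimately have "pbd (\<lambda>x. (g x + 1) + (h x + 1))" using assms by blast
  then show ?thesis by (rule pbd_mono) simp
qed

lemma pbd_power: "pbd g \<Longrightarrow> pbd (\<lambda>x. g x ^ d)"
  by (induction d) (auto intro: pbd_mult pbd_const)

lemma pbd_comp: assumes "pbd g" "pbd (\<lambda>x. sz (f x))" shows "pbd (\<lambda>x. g (f x))"
proof -
  from assms(1) obtain d where "\<forall>x. g x \<le> (sz x + 2) ^ d" unfolding pbd_def by blast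
  moreover have "pbd (\<lambda>x. (sz (f x) + 2) ^ d)"
    by (intro pbd_power pbd_add assms pbd_const)
  ultimately show ?thesis by (auto intro: pbd_mono)
qed

lemmas pbd_rules = pbd_const pbd_sz pbd_mult pbd_add pbd_power

section \<open>Polynomial time computable functions\<close>

definition behav :: "('a :: enc \<Rightarrow> 'b :: enc) \<Rightarrow> ('a \<Rightarrow> nat) \<Rightarrow> behaviour" where
  "behav f \<tau> = {(enc x, enc (f x), \<tau> x) | x. True}"

lemma realizes_behav: "realizes P i (behav f \<tau>) \<longleftrightarrow> (\<forall>x. calls P i [enc x] (enc (f x)) (\<tau> x))"
  unfolding realizes_def behav_def by auto

text \<open>The size of the value is bounded separately because the time does not control it: trees
  are shared, and consing a tree with itself doubles its size in constantly many steps. Composition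
  needs the size bound for intermediate values.\<close>

definition ptc :: "('a :: enc \<Rightarrow> 'b :: enc) \<Rightarrow> bool" where
  "ptc f \<longleftrightarrow> (\<exists>P \<tau>. pbd \<tau> \<and> realizes P 0 (behav f \<tau>)) \<and> pbd (\<lambda>x. sz (f x))"

lemma ptc_sz: "ptc f \<Longrightarrow> pbd (\<lambda>x. sz (f x))"
  unfolding ptc_def by blast

lemma ptc_time:
  assumes "ptc f" obtains P \<tau> where "pbd \<tau>" "realizes P 0 (behav f \<tau>)"
  using assms unfolding ptc_def by blast

lemma ptcI:
  assumes "pbd \<tau>" "pbd (\<lambda>x. sz (f x))" "\<And>x. calls P 0 [enc x] (enc (f x)) (\<tau> x)"
  shows "ptc f"
  using assms unfolding ptc_def realizes_behav by blast

lemma ptc_cast: "ptc f \<Longrightarrow> (\<And>x. enc (g x) = enc (f x)) \<Longrightarrow> ptc g"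
  unfolding ptc_def realizes_behav by simp

lemma link2:
  assumes "realizes P 0 S" "realizes P' 0 S'"
  shows "\<exists>Q i j. \<forall>B. length B = m \<longrightarrow> realizes (B @ Q) i S \<and> realizes (B @ Q) j S'"
proof -
  obtain Q off where "\<And>B. length B = m \<Longrightarrow>
    (\<forall>j < length [S, S']. realizes (B @ Q) (off j) ([S, S'] ! j))"
    using link[of "[S, S']" m] assms by auto
  then have "\<forall>B. length B = m \<longrightarrow> realizes (B @ Q) (off 0) S \<and> realizes (B @ Q) (off 1) S'"
    by (auto simp: less_Suc_eq all_conj_distrib)
  then show ?thesis by blast
qed

lemma link3:
  assumes "realizes P 0 S" "realizes P' 0 S'" "realizes P'' 0 S''"
  shows "\<exists>Q i j k. \<forall>B. length B = m \<longrightarrow>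
    realizes (B @ Q) i S \<and> realizes (B @ Q) j S' \<and> realizes (B @ Q) k S''"
proof -
  obtain Q off where "\<And>B. length B = m \<Longrightarrow>
    (\<forall>j < length [S, S', S'']. realizes (B @ Q) (off j) ([S, S', S''] ! j))"
    using link[of "[S, S', S'']" m] assms by auto
  then have "\<forall>B. length B = m \<longrightarrow>
    realizes (B @ Q) (off 0) S \<and> realizes (B @ Q) (off 1) S' \<and> realizes (B @ Q) (off 2) S''"
    by (auto simp: less_Suc_eq all_conj_distrib numeral_2_eq_2)
  then show ?thesis by blast
qed

lemma ptc_id: "ptc (\<lambda>x. x)"
  by (rule ptcI[of "\<lambda>_. 1" _ "[Arg 0]"])
    (auto simp: calls_def intro!: pbd_rules evl_Arg0[simplified])

primrec lit :: "tree \<Rightarrow> expr" where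
  "lit Leaf = ELeaf"
| "lit (Node a b) = ENode (lit a) (lit b)"

lemma evl_lit: "evl P vs (lit a) a (1 + 2 * size a)"
proof (induction a)
  case Leaf
  show ?case using evl_ELeaf by simp
next
  case (Node a b)
  from evl_ENode[OF Node.IH] show ?case by (simp add: evl_mono)
qed

lemma ptc_const: "ptc (\<lambda>x. c)"
  by (rule ptcI[of "\<lambda>_. 1 + 2 * size (enc c)" _ "[lit (enc c)]"])
    (auto simp: calls_def intro!: pbd_rules evl_lit[simplified])

lemma ptc_comp:
  assumes g: "ptc g" and f: "ptc f" shows "ptc (\<lambda>x. g (f x))"
proof -
  from g f obtain P \<tau> P' \<tau>' where P: "pbd \<tau>" "realizes P 0 (behav g \<tau>)"
    "pbd \<tau>'" "realizes P' 0 (behav f \<tau>')" by (metis ptc_time)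
  from link2[OF P(2,4), of 1] obtain Q i j where Q: "\<And>B. length B = 1 \<Longrightarrow>
    realizes (B @ Q) i (behav g \<tau>) \<and> realizes (B @ Q) j (behav f \<tau>')" by blast
  let ?B = "[Call i [Call j [Arg 0]]]"
  have r: "\<And>x. calls (?B @ Q) i [enc x] (enc (g x)) (\<tau> x)"
    "\<And>x. calls (?B @ Q) j [enc x] (enc (f x)) (\<tau>' x)"
    using Q[of ?B] by (auto simp: realizes_behav)
  show ?thesis
  proof (rule ptcI)
    show "pbd (\<lambda>x. 10 + \<tau>' x + \<tau> (f x))"
      by (intro pbd_rules pbd_comp[OF P(1)] P(3) ptc_sz f)
    show "pbd (\<lambda>x. sz (g (f x)))" using pbd_comp[OF ptc_sz[OF g] ptc_sz[OF f]] .
    show "calls (?B @ Q) 0 [enc x] (enc (g (f x))) (10 + \<tau>' x + \<tau> (f x))" for x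
      by (rule callsI, simp, rule nth_append_simps, (rule evl_rules evl_Call r)+, simp)
  qed
qed

lemma ptc_Pair:
  assumes g: "ptc g" and f: "ptc f" shows "ptc (\<lambda>x. (g x, f x))"
proof -
  from g f obtain P \<tau> P' \<tau>' where P: "pbd \<tau>" "realizes P 0 (behav g \<tau>)"
    "pbd \<tau>'" "realizes P' 0 (behav f \<tau>')" by (metis ptc_time)
  from link2[OF P(2,4), of 1] obtain Q i j where Q: "\<And>B. length B = 1 \<Longrightarrow>
    realizes (B @ Q) i (behav g \<tau>) \<and> realizes (B @ Q) j (behav f \<tau>')" by blast
  let ?B = "[ENode (Call i [Arg 0]) (Call j [Arg 0])]"
  have r: "\<And>x. calls (?B @ Q) i [enc x] (enc (g x)) (\<tau> x)"
    "\<And>x. calls (?B @ Q) j [enc x] (enc (f x)) (\<tau>' x)"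
    using Q[of ?B] by (auto simp: realizes_behav)
  show ?thesis
  proof (rule ptcI)
    show "pbd (\<lambda>x. 10 + \<tau>' x + \<tau> x)"
      by (intro pbd_rules P)
    show "pbd (\<lambda>x. sz (g x, f x))"
      unfolding sz_Pair Suc_eq_plus1 by (intro pbd_rules ptc_sz f g)
    show "calls (?B @ Q) 0 [enc x] (enc (g x, f x)) (10 + \<tau>' x + \<tau> x)" for x
      unfolding enc_Pair by (rule callsI, simp, rule nth_append_simps, (rule evl_rules evl_Call r)+, simp)
  qed
qed

lemma size_tfst: "size (tfst t) \<le> size t"
  by (cases t) auto

lemma size_tsnd: "size (tsnd t) \<le> size t"
  by (cases t) auto

lemma ptc_tfst_raw: "ptc tfst"
  by (rule ptcI[of "\<lambda>_. 2" _ "[Fst (Arg 0)]"])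
    (auto simp: calls_def size_tfst intro!: pbd_rules evl_mono[OF evl_Fst[OF evl_Arg0]] pbd_mono[OF pbd_sz])

lemma ptc_tsnd_raw: "ptc tsnd"
  by (rule ptcI[of "\<lambda>_. 2" _ "[Snd (Arg 0)]"])
    (auto simp: calls_def size_tsnd intro!: pbd_rules evl_mono[OF evl_Snd[OF evl_Arg0]] pbd_mono[OF pbd_sz])

lemma ptc_enc: "ptc f \<Longrightarrow> ptc (\<lambda>x. enc (f x))"
  by (erule ptc_cast) simp

lemma ptc_tfst: "ptc f \<Longrightarrow> (\<And>x. enc (g x) = tfst (enc (f x))) \<Longrightarrow> ptc g"
  by (rule ptc_cast[OF ptc_comp[OF ptc_tfst_raw ptc_enc]]) auto

lemma ptc_tsnd: "ptc f \<Longrightarrow> (\<And>x. enc (g x) = tsnd (enc (f x))) \<Longrightarrow> ptc g"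
  by (rule ptc_cast[OF ptc_comp[OF ptc_tsnd_raw ptc_enc]]) auto

lemma ptc_fst: "ptc f \<Longrightarrow> ptc (\<lambda>x. fst (f x))"
  by (erule ptc_tfst) (simp add: enc_prod_def)

lemma ptc_snd: "ptc f \<Longrightarrow> ptc (\<lambda>x. snd (f x))"
  by (erule ptc_tsnd) (simp add: enc_prod_def)

text \<open>The conventions \<open>tl [] = []\<close> and \<open>tsnd Leaf = Leaf\<close>
  agree.\<close>

lemma ptc_tl: "ptc f \<Longrightarrow> ptc (\<lambda>x. tl (f x))"
  by (erule ptc_tsnd) (metis enc_Cons enc_Nil list.collapse list.sel(2) tsnd.simps)

lemma ptc_Cons: "ptc f \<Longrightarrow> ptc g \<Longrightarrow> ptc (\<lambda>x. f x # g x)"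
  by (rule ptc_cast[OF ptc_Pair]) auto

lemma ptc_Suc: "ptc f \<Longrightarrow> ptc (\<lambda>x. Suc (f x))"
  by (rule ptc_cast[OF ptc_Pair[OF ptc_const[of "()"]]]) auto

lemma ptc_if_leaf:
  assumes c: "ptc c" and g: "ptc g" and f: "ptc f"
  shows "ptc (\<lambda>x. if enc (c x) = Leaf then g x else f x)"
proof -
  obtain P \<tau> where P1: "pbd \<tau>" "realizes P 0 (behav c \<tau>)" by (rule ptc_time[OF c])
  obtain P' \<tau>' where P2: "pbd \<tau>'" "realizes P' 0 (behav g \<tau>')" by (rule ptc_time[OF g])
  obtain P'' \<tau>'' where P3: "pbd \<tau>''" "realizes P'' 0 (behav f \<tau>'')" by (rule ptc_time[OF f])
  note P = P1 P2 P3
  from link3[OF P(2,4,6), of 1] obtain Q i j k where Q: "\<And>B. length B = 1 \<Longrightarrow>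
    realizes (B @ Q) i (behav c \<tau>) \<and> realizes (B @ Q) j (behav g \<tau>') \<and> realizes (B @ Q) k (behav f \<tau>'')"
    by blast
  let ?B = "[IfLeaf (Call i [Arg 0]) (Call j [Arg 0]) (Call k [Arg 0])]"
  have r: "\<And>x. calls (?B @ Q) i [enc x] (enc (c x)) (\<tau> x)"
    "\<And>x. calls (?B @ Q) j [enc x] (enc (g x)) (\<tau>' x)"
    "\<And>x. calls (?B @ Q) k [enc x] (enc (f x)) (\<tau>'' x)"
    using Q[of ?B] by (auto simp: realizes_behav)
  have r': "evl (?B @ Q) [enc x] (Call i [Arg 0]) (enc (c x)) (2 + \<tau> x)"
    "evl (?B @ Q) [enc x] (Call j [Arg 0]) (enc (g x)) (2 + \<tau>' x + \<tau>'' x)"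
    "evl (?B @ Q) [enc x] (Call k [Arg 0]) (enc (f x)) (2 + \<tau>' x + \<tau>'' x)" for x
    by (rule evl_mono, (rule evl_rules evl_Call r)+, simp)+
  show ?thesis
  proof (rule ptcI)
    show "pbd (\<lambda>x. 10 + \<tau> x + \<tau>' x + \<tau>'' x)"
      by (intro pbd_rules P)
    have "pbd (\<lambda>x. sz (g x) + sz (f x))" by (intro pbd_rules ptc_sz f g)
    then show "pbd (\<lambda>x. sz (if enc (c x) = Leaf then g x else f x))"
      by (rule pbd_mono) auto
    show "calls (?B @ Q) 0 [enc x] (enc (if enc (c x) = Leaf then g x else f x))
        (10 + \<tau> x + \<tau>' x + \<tau>'' x)" for x
    proof (rule callsI)
      show "evl (?B @ Q) [enc x] (?B ! 0) (enc (if enc (c x) = Leaf then g x else f x))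
          (1 + (2 + \<tau> x) + (2 + \<tau>' x + \<tau>'' x))"
        unfolding append_Cons nth_Cons_0
        by (rule evl_If[OF r'(1)[of x, unfolded append_Cons]])
          (use r'(2,3)[of x] in simp_all)
    qed simp_all
  qed
qed

text \<open>The branches are exchanged because \<open>Leaf\<close> encodes
  \<open>False\<close>.\<close>

lemma ptc_If: "ptc c \<Longrightarrow> ptc g \<Longrightarrow> ptc f \<Longrightarrow> ptc (\<lambda>x. if c x then g x else f x)"
  by (rule ptc_cast[OF ptc_if_leaf[of c f g]]) auto

lemma ptc_null: assumes "ptc f" shows "ptc (\<lambda>x. f x = [])"
proof (rule ptc_cast[OF ptc_if_leaf[OF assms ptc_const[of True] ptc_const[of False]]])
  show "enc (f x = []) = enc (if enc (f x) = Leaf then True else False)" for x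
    by (cases "f x") auto
qed

lemma ptc_not: "ptc f \<Longrightarrow> ptc (\<lambda>x. \<not> f x)"
  by (rule ptc_cast[OF ptc_If[OF _ ptc_const[of False] ptc_const[of True]], of f]) auto

lemma ptc_conj: "ptc f \<Longrightarrow> ptc g \<Longrightarrow> ptc (\<lambda>x. f x \<and> g x)"
  by (rule ptc_cast[OF ptc_If[OF _ _ ptc_const[of False]], of f g]) auto

lemma ptc_disj: "ptc f \<Longrightarrow> ptc g \<Longrightarrow> ptc (\<lambda>x. f x \<or> g x)"
  by (rule ptc_cast[OF ptc_If[OF _ ptc_const[of True]], of f g]) auto

text \<open>The iteration principle behind the list operations, a form of bounded recursion. Without
  the bound \<open>q\<close> on the intermediate values, which are the folds of suffixes, a
  polynomial step could square the size of the accumulator in each round.\<close>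

lemma ptc_foldr:
  assumes h: "ptc (\<lambda>z. h (fst z) (fst (snd z)) (snd (snd z)))" and l: "ptc l" and b: "ptc b"
    and q: "pbd q" "\<And>x us vs. l x = us @ vs \<Longrightarrow> sz (foldr (h x) vs (b x)) \<le> q x"
  shows "ptc (\<lambda>x. foldr (h x) (l x) (b x))"
proof -
  let ?h = "\<lambda>z. h (fst z) (fst (snd z)) (snd (snd z))"
  obtain P \<tau> where P1: "pbd \<tau>" "realizes P 0 (behav ?h \<tau>)" by (rule ptc_time[OF h])
  obtain P' \<tau>' where P2: "pbd \<tau>'" "realizes P' 0 (behav l \<tau>')" by (rule ptc_time[OF l])
  obtain P'' \<tau>'' where P3: "pbd \<tau>''" "realizes P'' 0 (behav b \<tau>'')" by (rule ptc_time[OF b])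
  note P = P1 P2 P3
  from link3[OF P(2,4,6), of 2] obtain Q i j k where Q: "\<And>B. length B = 2 \<Longrightarrow>
    realizes (B @ Q) i (behav ?h \<tau>) \<and> realizes (B @ Q) j (behav l \<tau>') \<and> realizes (B @ Q) k (behav b \<tau>'')"
    by blast
  let ?B = "[Call 1 [Call j [Arg 0], Arg 0],
    IfLeaf (Arg 0) (Call k [Arg 1])
      (Call i [ENode (Arg 1) (ENode (Fst (Arg 0)) (Call 1 [Snd (Arg 0), Arg 1]))])]"
  have r: "\<And>x. calls (?B @ Q) i [enc x] (enc (?h x)) (\<tau> x)"
    "\<And>x. calls (?B @ Q) j [enc x] (enc (l x)) (\<tau>' x)"
    "\<And>x. calls (?B @ Q) k [enc x] (enc (b x)) (\<tau>'' x)"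
    using Q[of ?B] by (auto simp: realizes_behav)
  from P(1) obtain d where d: "\<And>z. \<tau> z \<le> (sz z + 2) ^ d" unfolding pbd_def by blast
  \<comment> \<open>Bounds one application of \<open>h\<close>: its argument consists of
    \<open>x\<close>, an element of \<open>l x\<close> and an intermediate value, and the inner 2
    counts the two pairings.\<close>
  define H where "H x = (sz x + (sz (l x) + q x + 2) + 2) ^ d" for x
  have rec: "calls (?B @ Q) 1 [enc vs, enc x] (enc (foldr (h x) vs (b x)))
      (10 + \<tau>'' x + length vs * (20 + H x))" if "l x = us @ vs" for x us vs
    using that
  proof (induction vs arbitrary: us)
    case Nil
    show ?case
      unfolding enc_Nil foldr.simps id_apply
      by (rule callsI, simp, rule nth_append_simps, (rule evl_If_True evl_rules evl_Call r)+, simp)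
  next
    case (Cons a vs)
    let ?v = "foldr (h x) vs (b x)"
    have IH: "calls (?B @ Q) 1 [enc vs, enc x] (enc ?v) (10 + \<tau>'' x + length vs * (20 + H x))"
      using Cons.IH[of "us @ [a]"] Cons.prems by simp
    have hh: "calls (?B @ Q) i [Node (enc x) (Node (enc a) (enc ?v))] (enc (foldr (h x) (a # vs) (b x))) (H x)"
    proof (rule calls_mono)
      show "calls (?B @ Q) i [Node (enc x) (Node (enc a) (enc ?v))] (enc (foldr (h x) (a # vs) (b x)))
        (\<tau> (x, a, ?v))"
        using r(1)[of "(x, a, ?v)"] by simp
      have "sz a \<le> sz (l x)" using Cons.prems by (auto intro: sz_mem)
      moreover have "sz ?v \<le> q x" using q(2)[of x "us @ [a]" vs] Cons.prems by simp
      ultimately have "sz (x, a, ?v) + 2 \<le> sz x + (sz (l x) + q x + 2) + 2" by simp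
      then have "(sz (x, a, ?v) + 2) ^ d \<le> H x" unfolding H_def by (rule power_mono) simp
      then show "\<tau> (x, a, ?v) \<le> H x" using d[of "(x, a, ?v)"] by linarith
    qed
    show ?case
      unfolding enc_Cons
      by (rule callsI, simp, rule nth_append_simps, (rule evl_If_False evl_rules tree.distinct(2) evl_Call IH hh)+, simp)
  qed
  show ?thesis
  proof (rule ptcI)
    show "pbd (\<lambda>x. 20 + \<tau>' x + (10 + \<tau>'' x + sz (l x) * (20 + H x)))"
      unfolding H_def by (intro pbd_rules P ptc_sz l q)
    show "pbd (\<lambda>x. sz (foldr (h x) (l x) (b x)))"
      by (rule pbd_mono[OF q(1)]) (simp add: q(2))
    show "calls (?B @ Q) 0 [enc x] (enc (foldr (h x) (l x) (b x)))
      (20 + \<tau>' x + (10 + \<tau>'' x + sz (l x) * (20 + H x)))" for x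
    proof (rule calls_mono)
      show "calls (?B @ Q) 0 [enc x] (enc (foldr (h x) (l x) (b x)))
        (20 + \<tau>' x + (10 + \<tau>'' x + length (l x) * (20 + H x)))"
        by (rule callsI, simp, rule nth_append_simps, (rule evl_rules evl_Call r rec[of _ "[]"])+, simp_all)
    qed (use length_le_sz in auto)
  qed
qed

section \<open>List operations expressed by folds\<close>

lemma sz_append: "sz (xs @ ys) = sz xs + sz ys"
  by (induction xs) auto

lemma sz_concat: "sz (concat xss) \<le> sz xss"
  by (induction xss) (auto simp: sz_append)

lemma sz_list_le: "(\<And>a. a \<in> set xs \<Longrightarrow> sz a \<le> B) \<Longrightarrow> sz xs \<le> length xs * (B + 1)"
proof (induction xs)
  case (Cons a xs)
  then have "sz a \<le> B" "sz xs \<le> length xs * (B + 1)" by auto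
  then show ?case by simp
qed simp

lemma sz_nat: "sz (n :: nat) = n"
  by (induction n) auto

lemma ptc_append: assumes "ptc f" "ptc g" shows "ptc (\<lambda>x. f x @ g x)"
proof -
  have "ptc (\<lambda>x. foldr (\<lambda>a acc. a # acc) (f x) (g x))"
  proof (rule ptc_foldr)
    show "pbd (\<lambda>x. sz (f x) + sz (g x))" by (intro pbd_rules ptc_sz assms)
    have "foldr (\<lambda>a acc. a # acc) vs ys = vs @ ys" for vs ys :: "'b list"
      by (induction vs) auto
    then show "f x = us @ vs \<Longrightarrow> sz (foldr (\<lambda>a acc. a # acc) vs (g x)) \<le> sz (f x) + sz (g x)" for x us vs
      by (simp add: sz_append)
  qed (intro assms ptc_Cons ptc_fst ptc_snd ptc_id)+
  moreover have "foldr (\<lambda>a acc. a # acc) vs ys = vs @ ys" for vs ys :: "'b list"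
    by (induction vs) auto
  ultimately show ?thesis by simp
qed

lemma ptc_map: assumes f: "ptc (\<lambda>z. f (fst z) (snd z))" and l: "ptc l"
  shows "ptc (\<lambda>x. map (f x) (l x))"
proof -
  have eq: "foldr (\<lambda>a acc. f x a # acc) vs [] = map (f x) vs" for x vs
    by (induction vs) auto
  from ptc_sz[OF f] obtain d where d: "\<And>z. sz (f (fst z) (snd z)) \<le> (sz z + 2) ^ d"
    unfolding pbd_def by blast
  have "ptc (\<lambda>x. foldr (\<lambda>a acc. f x a # acc) (l x) [])"
  proof (rule ptc_foldr)
    show "pbd (\<lambda>x. sz (l x) * ((sz x + (sz (l x) + 1) + 2) ^ d + 1))"
      by (intro pbd_rules ptc_sz l)
    fix x us vs assume lx: "l x = us @ vs"
    have "sz (f x a) \<le> (sz x + (sz (l x) + 1) + 2) ^ d" if "a \<in> set vs" for a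
    proof -
      have "sz a \<le> sz (l x)" using that lx by (auto intro: sz_mem)
      then have "sz (x, a) + 2 \<le> sz x + (sz (l x) + 1) + 2" by simp
      then have "(sz (x, a) + 2) ^ d \<le> (sz x + (sz (l x) + 1) + 2) ^ d" by (rule power_mono) simp
      then show ?thesis using d[of "(x, a)"] by simp
    qed
    then have "sz (map (f x) vs) \<le> length (map (f x) vs) * ((sz x + (sz (l x) + 1) + 2) ^ d + 1)"
      by (intro sz_list_le) auto
    also have "\<dots> \<le> sz (l x) * ((sz x + (sz (l x) + 1) + 2) ^ d + 1)"
      using length_le_sz[of "l x"] lx by (intro mult_right_mono) auto
    finally show "sz (foldr (\<lambda>a acc. f x a # acc) vs []) \<le> sz (l x) * ((sz x + (sz (l x) + 1) + 2) ^ d + 1)"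
      by (simp only: eq)
  next
    show "ptc (\<lambda>z. f (fst z) (fst (snd z)) # snd (snd z))"
      by (intro ptc_Cons ptc_comp[OF f, of "\<lambda>z. (fst z, fst (snd z))", simplified]
        ptc_Pair ptc_fst ptc_snd ptc_id)
  qed (intro l ptc_const)+
  then show ?thesis by (simp only: eq)
qed

lemma ptc_comp2: "ptc (\<lambda>z. f (fst z) (snd z)) \<Longrightarrow> ptc g \<Longrightarrow> ptc h \<Longrightarrow> ptc (\<lambda>x. f (g x) (h x))"
  using ptc_comp[of "\<lambda>z. f (fst z) (snd z)" "\<lambda>x. (g x, h x)"] ptc_Pair[of g h] by simp

lemma ptc_comp3: "ptc (\<lambda>z. f (fst z) (fst (snd z)) (snd (snd z))) \<Longrightarrow> ptc g \<Longrightarrow> ptc h \<Longrightarrow> ptc k \<Longrightarrow>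
    ptc (\<lambda>x. f (g x) (h x) (k x))"
  using ptc_comp[of "\<lambda>z. f (fst z) (fst (snd z)) (snd (snd z))" "\<lambda>x. (g x, h x, k x)"]
    ptc_Pair[OF _ ptc_Pair[of h k], of g] by simp

lemma sz_filter: "sz (filter P xs) \<le> sz xs"
  by (induction xs) auto

lemma ptc_filter: assumes f: "ptc (\<lambda>z. f (fst z) (snd z))" and l: "ptc l"
  shows "ptc (\<lambda>x. filter (f x) (l x))"
proof -
  have eq: "foldr (\<lambda>a acc. if f x a then a # acc else acc) vs [] = filter (f x) vs" for x vs
    by (induction vs) auto
  have "ptc (\<lambda>x. foldr (\<lambda>a acc. if f x a then a # acc else acc) (l x) [])"
  proof (rule ptc_foldr)
    show "pbd (\<lambda>x. sz (l x))" by (intro ptc_sz l)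
    show "sz (foldr (\<lambda>a acc. if f x a then a # acc else acc) vs []) \<le> sz (l x)"
      if "l x = us @ vs" for x us vs
      unfolding eq using that sz_filter[of "f x" vs] by (simp add: sz_append)
  next
    show "ptc (\<lambda>z. if f (fst z) (fst (snd z)) then fst (snd z) # snd (snd z) else snd (snd z))"
      by (intro ptc_If ptc_Cons ptc_comp2[OF f] ptc_Pair ptc_fst ptc_snd ptc_id)
  qed (intro l ptc_const)+
  then show ?thesis by (simp only: eq)
qed

lemma ptc_bex: assumes f: "ptc (\<lambda>z. f (fst z) (snd z))" and l: "ptc l"
  shows "ptc (\<lambda>x. \<exists>a \<in> set (l x). f x a)"
  using ptc_not[OF ptc_null[OF ptc_filter[OF f l]]] by (simp add: filter_empty_conv)

text \<open>Overwriting every element by \<open>()\<close> turns a list into the unary encoding of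
  its length.\<close>

lemma ptc_length: assumes l: "ptc l" shows "ptc (\<lambda>x. length (l x))"
proof -
  have "ptc (\<lambda>x. map (\<lambda>a. ()) (l x))" by (intro ptc_map ptc_const l)
  moreover have "map (\<lambda>a. ()) xs = replicate (length xs) ()" for xs :: "'b list"
    by (induction xs) auto
  ultimately show ?thesis by (auto intro: ptc_cast simp: enc_replicate)
qed

lemma ptc_concat: assumes l: "ptc l" shows "ptc (\<lambda>x. concat (l x))"
proof -
  have "ptc (\<lambda>x. foldr (@) (l x) [])"
  proof (rule ptc_foldr)
    show "pbd (\<lambda>x. sz (l x))" by (intro ptc_sz l)
    show "sz (foldr (@) vs []) \<le> sz (l x)" if "l x = us @ vs" for x us vs
      using that sz_concat[of vs] by (simp add: sz_append concat_conv_foldr)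
  qed (intro l ptc_const ptc_append ptc_fst ptc_snd ptc_id)+
  then show ?thesis by (simp add: concat_conv_foldr)
qed

lemma sz_drop: "sz (drop n xs) \<le> sz xs"
proof (induction xs arbitrary: n)
  case (Cons a xs)
  then show ?case by (cases n) (auto simp: le_SucI trans_le_add2)
qed simp

text \<open>The unary number itself serves as the list to fold over; each of its units removes one
  head.\<close>

lemma ptc_drop: assumes n: "ptc n" and l: "ptc l" shows "ptc (\<lambda>x. drop (n x) (l x))"
proof -
  have eq: "foldr (\<lambda>_. tl) us xs = drop (length us) xs" for us :: "unit list" and xs :: "'b list"
    by (induction us) (auto simp: drop_Suc tl_drop)
  have "ptc (\<lambda>x. foldr (\<lambda>_. tl) (replicate (n x) ()) (l x))"
  proof (rule ptc_foldr)
    show "ptc (\<lambda>x. replicate (n x) ())" by (rule ptc_cast[OF n]) (simp add: enc_replicate)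
    show "pbd (\<lambda>x. sz (l x))" by (intro ptc_sz l)
    show "sz (foldr (\<lambda>_. tl) vs (l x)) \<le> sz (l x)" for x and vs :: "unit list"
      unfolding eq by (rule sz_drop)
  qed (intro l ptc_tl ptc_fst ptc_snd ptc_id)+
  then show ?thesis unfolding eq by simp
qed

text \<open>A total head function: \<open>ptc\<close> prescribes the value on every input, and the
  encoding of \<open>hd []\<close> is unknown.\<close>

definition hdd :: "'a \<Rightarrow> 'a list \<Rightarrow> 'a" where
  "hdd d xs = (case xs of [] \<Rightarrow> d | x # _ \<Rightarrow> x)"

lemma ptc_hdd: assumes "ptc d" "ptc l" shows "ptc (\<lambda>x. hdd (d x) (l x))"
proof (rule ptc_cast)
  show "ptc (\<lambda>x. if l x = [] then enc (d x) else tfst (enc (l x)))"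
    by (intro ptc_If ptc_null ptc_enc assms ptc_comp[OF ptc_tfst_raw])
  show "enc (hdd (d x) (l x)) = enc (if l x = [] then enc (d x) else tfst (enc (l x)))" for x
    by (auto simp: hdd_def split: list.split)
qed

text \<open>Gives neighbour lists a common length, so that expansions of two tuples correspond
  position by position. The length is a constant of the program, not an input.\<close>

primrec pad :: "nat \<Rightarrow> 'a \<Rightarrow> 'a list \<Rightarrow> 'a list" where
  "pad 0 d xs = []"
| "pad (Suc k) d xs = hdd d xs # pad k d (tl xs)"

lemma ptc_pad: "ptc d \<Longrightarrow> ptc l \<Longrightarrow> ptc (\<lambda>x. pad k (d x) (l x))"
proof (induction k arbitrary: l)
  case (Suc k)
  then show ?case unfolding pad.simps by (intro ptc_Cons ptc_hdd Suc.IH ptc_tl)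
qed (simp add: ptc_const)

lemma length_pad: "length (pad k d xs) = k"
  by (induction k arbitrary: xs) auto

lemma set_pad_subset: "set (pad k d xs) \<subseteq> insert d (set xs)"
proof (induction k arbitrary: xs)
  case (Suc k)
  from Suc[of "tl xs"] show ?case
    by (cases xs) (auto simp: hdd_def)
qed simp

lemma set_pad_superset: "length xs \<le> k \<Longrightarrow> set xs \<subseteq> set (pad k d xs)"
proof (induction k arbitrary: xs)
  case (Suc k)
  from Suc.prems Suc.IH[of "tl xs"] show ?case
    by (cases xs) (auto simp: hdd_def)
qed simp

text \<open>The machine has no comparison of trees, and the recursion descends in two trees at once,
  so the program is written directly. It stops where the shapes first differ, hence the time is
  linear in the first tree alone.\<close>

lemma ptc_eq_tree: "ptc (\<lambda>z :: tree \<times> tree. fst z = snd z)"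
proof -
  let ?T = "ENode ELeaf ELeaf"
  let ?P = "[Call 1 [Fst (Arg 0), Snd (Arg 0)],
    IfLeaf (Arg 0) (IfLeaf (Arg 1) ?T ELeaf) (IfLeaf (Arg 1) ELeaf
      (IfLeaf (Call 1 [Fst (Arg 0), Fst (Arg 1)]) ELeaf (Call 1 [Snd (Arg 0), Snd (Arg 1)])))] @ []"
  have rec: "calls ?P 1 [a, b] (enc (a = b)) (20 + 40 * size a)" for a b
  proof (induction a arbitrary: b)
    case Leaf
    show ?case
    proof (cases "b = Leaf")
      case True
      have e: "enc (Leaf = b) = Node Leaf Leaf" using True by simp
      show ?thesis unfolding e unfolding True
        by (rule callsI, simp, rule nth_append_simps, (rule evl_If_True evl_rules)+, simp)
    next
      case False
      have e: "enc (Leaf = b) = Leaf" using False by simp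
      show ?thesis unfolding e
        by (rule callsI, simp, rule nth_append_simps, rule evl_If_True, rule evl_rules,
          rule evl_If_False, rule evl_rules, rule False, (rule evl_rules)+, simp)
    qed
  next
    case (Node a1 a2)
    show ?case
    proof (cases b)
      case Leaf
      then have e: "enc (Node a1 a2 = b) = Leaf" by simp
      show ?thesis unfolding e unfolding Leaf
        by (rule callsI, simp, rule nth_append_simps, rule evl_If_False, rule evl_rules, simp,
          (rule evl_If_True evl_rules)+, simp)
    next
      case (Node b1 b2)
      show ?thesis
      proof (cases "a1 = b1")
        case True
        then have e: "enc (Node a1 a2 = b) = enc (a2 = b2)" and e2: "enc (a1 = b1) \<noteq> Leaf" using Node by simp_all
        show ?thesis unfolding e unfolding Node
          by (rule callsI, simp, rule nth_append_simps, (rule evl_If_False, rule evl_rules, simp)+,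
            rule evl_If_False, (rule evl_rules evl_Call Node.IH e2)+, simp)
      next
        case False
        then have e: "enc (Node a1 a2 = b) = Leaf" and e2: "enc (a1 = b1) = Leaf" using Node by simp_all
        show ?thesis unfolding e unfolding Node
          by (rule callsI, simp, rule nth_append_simps, (rule evl_If_False, rule evl_rules, simp)+,
            rule evl_If_True, (rule evl_rules evl_Call Node.IH(1)[of b1, unfolded e2])+, simp)
      qed
    qed
  qed
  show ?thesis
  proof (rule ptcI)
    show "pbd (\<lambda>z :: tree \<times> tree. 30 + (20 + 40 * sz z))" by (intro pbd_rules)
    show "pbd (\<lambda>z :: tree \<times> tree. sz (fst z = snd z))"
      by (rule pbd_mono[OF pbd_const[of 1]]) (rule sz_bool)
    show "calls ?P 0 [enc z] (enc (fst z = snd z)) (30 + (20 + 40 * sz z))" for z :: "tree \<times> tree"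
      unfolding enc_prod_def
      by (rule callsI, simp, rule nth_append_simps, (rule evl_rules evl_Call)+, unfold enc_tree, rule rec, simp)
  qed
qed

lemma ptc_eq: assumes "ptc f" "ptc g" shows "ptc (\<lambda>x. f x = g x)"
  using ptc_comp2[OF ptc_eq_tree ptc_enc[OF assms(1)] ptc_enc[OF assms(2)]] by (simp add: enc_inj)

text \<open>Greedy selection from the right end. For a reflexive and symmetric \<open>R\<close> it
  yields a maximal family of pairwise unrelated elements, for an equivalence one element of each
  class; the first gives representatives, the second one vertex per type.\<close>

definition thin :: "('a \<Rightarrow> 'a \<Rightarrow> bool) \<Rightarrow> 'a list \<Rightarrow> 'a list" where
  "thin R xs = foldr (\<lambda>a acc. if \<exists>b \<in> set acc. R b a then acc else a # acc) xs []"

lemma thin_simps[simp]: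
  "thin R [] = []"
  "thin R (a # xs) = (if \<exists>b \<in> set (thin R xs). R b a then thin R xs else a # thin R xs)"
  by (simp_all add: thin_def)

lemma sz_thin: "sz (thin R xs) \<le> sz xs"
  by (induction xs) auto

lemma set_thin: "set (thin R xs) \<subseteq> set xs"
  by (induction xs) auto

lemma distinct_thin: "distinct xs \<Longrightarrow> distinct (thin R xs)"
  using set_thin[of R] by (induction xs) auto

lemma thin_cover: "(\<And>a. a \<in> set xs \<Longrightarrow> R a a) \<Longrightarrow> a \<in> set xs \<Longrightarrow> \<exists>b \<in> set (thin R xs). R b a"
  by (induction xs) auto

lemma thin_apart: "(\<And>a b. R a b \<Longrightarrow> R b a) \<Longrightarrow> a \<in> set (thin R xs) \<Longrightarrow> b \<in> set (thin R xs) \<Longrightarrow> a \<noteq> b \<Longrightarrow> \<not> R a b"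
  by (induction xs) (auto split: if_splits)

lemma ptc_thin: assumes f: "ptc (\<lambda>z. f (fst z) (fst (snd z)) (snd (snd z)))" and l: "ptc l"
  shows "ptc (\<lambda>x. thin (f x) (l x))"
  unfolding thin_def
proof (rule ptc_foldr)
  show "pbd (\<lambda>x. sz (l x))" by (intro ptc_sz l)
  show "sz (foldr (\<lambda>a acc. if \<exists>b \<in> set acc. f x b a then acc else a # acc) vs []) \<le> sz (l x)"
    if "l x = us @ vs" for x us vs
    using sz_thin[of "f x" vs] that by (simp add: thin_def sz_append)
qed (intro l ptc_const ptc_If ptc_bex ptc_comp3[OF f] ptc_Cons ptc_fst ptc_snd ptc_id)+

text \<open>The first binding wins, so prepending a pair overwrites a variable. The default makes
  the function total.\<close>

definition lookup :: "'v \<Rightarrow> (nat \<times> 'v) list \<Rightarrow> nat \<Rightarrow> 'v" where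
  "lookup d env x = foldr (\<lambda>p acc. if fst p = x then snd p else acc) env d"

lemma lookup_simps[simp]:
  "lookup d [] x = d"
  "lookup d (p # env) x = (if fst p = x then snd p else lookup d env x)"
  by (simp_all add: lookup_def)

lemma lookup_mem: "x \<in> fst ` set env \<Longrightarrow> lookup d env x \<in> set (map snd env)"
  by (induction env) auto

lemma ptc_lookup: assumes e: "ptc e" and n: "ptc n" shows "ptc (\<lambda>x. lookup d (e x) (n x))"
  unfolding lookup_def
proof (rule ptc_foldr)
  show "pbd (\<lambda>x. sz (e x) + sz d)" by (intro pbd_rules ptc_sz e)
  have "sz (lookup d vs k) \<le> sz vs + sz d" for vs k
    by (induction vs) (auto simp: enc_prod_def)
  then show "sz (foldr (\<lambda>p acc. if fst p = n x then snd p else acc) vs d) \<le> sz (e x) + sz d"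
    if "e x = us @ vs" for x us vs
    unfolding lookup_def[symmetric] that sz_append by (meson le_trans trans_le_add2 add_mono order_refl le_add2)
qed (intro e ptc_const ptc_If ptc_eq ptc_fst ptc_snd ptc_id ptc_comp[OF n])+

text \<open>A fold from the right has no running index; instead every new head renumbers the part
  already built.\<close>

definition enum :: "'a list \<Rightarrow> (nat \<times> 'a) list" where
  "enum xs = foldr (\<lambda>a acc. (0, a) # map (\<lambda>p. (Suc (fst p), snd p)) acc) xs []"

lemma enum_eq: "enum xs = zip [0..<length xs] xs"
proof -
  have *: "map (\<lambda>p. (Suc (fst p), snd p)) (zip is xs) = zip (map Suc is) xs" for "is" :: "nat list" and xs :: "'a list"
    by (simp add: zip_map1 prod.case_eq_if)
  show ?thesis
  proof (induction xs)
    case (Cons a xs)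
    have "enum (a # xs) = (0, a) # map (\<lambda>p. (Suc (fst p), snd p)) (enum xs)" by (simp add: enum_def)
    also have "\<dots> = (0, a) # zip (map Suc [0..<length xs]) xs" by (simp only: Cons *)
    also have "\<dots> = zip [0..<length (a # xs)] (a # xs)"
      by (simp add: map_Suc_upt upt_conv_Cons del: upt_Suc)
    finally show ?case .
  qed (simp add: enum_def)
qed

lemma sz_enum: "sz (enum xs) \<le> sz xs * (sz xs + sz xs + 2)"
proof -
  have "sz (enum xs) \<le> length (enum xs) * ((sz xs + sz xs + 1) + 1)"
  proof (rule sz_list_le)
    fix p assume "p \<in> set (enum xs)"
    then obtain i a where p: "p = (i, a)" "i < length xs" "a \<in> set xs"
      unfolding enum_eq by (metis set_zip_leftD set_zip_rightD atLeastLessThan_iff set_upt surj_pair)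
    then show "sz p \<le> sz xs + sz xs + 1"
      using length_le_sz[of xs] sz_mem[of a xs] by (simp add: sz_nat)
  qed
  also have "\<dots> \<le> sz xs * (sz xs + sz xs + 2)"
    using length_le_sz[of xs] by (intro mult_mono) (auto simp: enum_eq)
  finally show ?thesis .
qed

lemma ptc_enum: assumes l: "ptc l" shows "ptc (\<lambda>x. enum (l x))"
  unfolding enum_def
proof (rule ptc_foldr)
  show "pbd (\<lambda>x. sz (l x) * (sz (l x) + sz (l x) + 2))" by (intro pbd_rules ptc_sz l)
  show "sz (foldr (\<lambda>a acc. (0, a) # map (\<lambda>p. (Suc (fst p), snd p)) acc) vs []) \<le> sz (l x) * (sz (l x) + sz (l x) + 2)"
    if "l x = us @ vs" for x us vs
  proof -
    have "sz (enum vs) \<le> sz vs * (sz vs + sz vs + 2)" by (rule sz_enum)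
    also have "\<dots> \<le> sz (l x) * (sz (l x) + sz (l x) + 2)"
      by (intro mult_mono) (auto simp: that sz_append)
    finally show ?thesis by (simp add: enum_def)
  qed
qed (intro l ptc_const ptc_Cons ptc_Pair ptc_map ptc_Suc ptc_fst ptc_snd ptc_id)+

lemmas ptc_rules = ptc_id ptc_fst ptc_snd ptc_Pair ptc_Cons ptc_append ptc_map ptc_filter ptc_bex
  ptc_If ptc_not ptc_conj ptc_disj ptc_eq ptc_null ptc_concat ptc_drop ptc_hdd ptc_pad ptc_thin
  ptc_lookup ptc_enum ptc_length

section \<open>Locality in structures of bounded degree\<close>

text \<open>Satisfaction over an arbitrary domain with an adjacency predicate and label bits. It is
  applied to coded vertices, whose adjacency is read from their rows.\<close>

primrec fsat :: "'v set \<Rightarrow> ('v \<Rightarrow> 'v \<Rightarrow> bool) \<Rightarrow> ('v \<Rightarrow> bool list) \<Rightarrow> (nat \<Rightarrow> 'v) \<Rightarrow> fm \<Rightarrow> bool" where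
  "fsat V A L s (Equal x y) \<longleftrightarrow> s x = s y"
| "fsat V A L s (Edge x y) \<longleftrightarrow> A (s x) (s y)"
| "fsat V A L s (Label i x) \<longleftrightarrow> L (s x) ! i"
| "fsat V A L s (Neg \<phi>) \<longleftrightarrow> \<not> fsat V A L s \<phi>"
| "fsat V A L s (Conj \<phi> \<psi>) \<longleftrightarrow> fsat V A L s \<phi> \<and> fsat V A L s \<psi>"
| "fsat V A L s (Disj \<phi> \<psi>) \<longleftrightarrow> fsat V A L s \<phi> \<or> fsat V A L s \<psi>"
| "fsat V A L s (Exists x \<phi>) \<longleftrightarrow> (\<exists>v \<in> V. fsat V A L (s(x := v)) \<phi>)"
| "fsat V A L s (Forall x \<phi>) \<longleftrightarrow> (\<forall>v \<in> V. fsat V A L (s(x := v)) \<phi>)"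

text \<open>
  The radius is defined on arbitrary trees so that the machine can use the encoded formula itself as
  the loop counter. All that matters is that a quantifier more than triples the radius: a vertex at
  distance more than \<open>2r + 1\<close> has no edge of the bounded degree structure to the \<open>r\<close>-balls around
  the old ones.
\<close>

primrec radius :: "tree \<Rightarrow> nat" where
  "radius Leaf = 0"
| "radius (Node a b) = 1 + 3 * radius a + 3 * radius b"

text \<open>Iterated \<open>r\<close> times it lists the \<open>r\<close>-balls around the entries,
  with repetitions. With neighbour lists of constant length, the place of every walk in the result
  depends only on its starting position and its choices, not on the vertices met.\<close>

definition expand :: "('v \<Rightarrow> 'v list) \<Rightarrow> 'v list \<Rightarrow> 'v list" where
  "expand nb M = concat (map (\<lambda>x. x # nb x) M)"

lemma expand_simps[simp]:
  "expand nb [] = []" "expand nb (x # M) = x # nb x @ expand nb M"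
  by (simp_all add: expand_def)

text \<open>The effect of expansion on the set of pairs standing at equal positions of two tuples.
  Such a set is easier to handle than two lists: it can be restricted, united and inverted.\<close>

definition pair_step :: "('v \<Rightarrow> 'v list) \<Rightarrow> ('v \<times> 'v) set \<Rightarrow> ('v \<times> 'v) set" where
  "pair_step nb Z = (\<Union>(x, y) \<in> Z. set (zip (x # nb x) (y # nb y)))"

text \<open>Records the full adjacency \<open>A\<close> within the tuple, not only the bounded
  degree relation.\<close>

definition atomic_type :: "('v \<Rightarrow> 'l) \<Rightarrow> ('v \<Rightarrow> 'v \<Rightarrow> bool) \<Rightarrow> 'v list \<Rightarrow> ('l \<times> bool list \<times> bool list) list" where
  "atomic_type lab A M = map (\<lambda>x. (lab x, map (\<lambda>y. x = y) M, map (A x) M)) M"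

definition partial_iso :: "('v \<Rightarrow> 'l) \<Rightarrow> ('v \<Rightarrow> 'v \<Rightarrow> bool) \<Rightarrow> ('v \<times> 'v) set \<Rightarrow> bool" where
  "partial_iso lab A Z \<longleftrightarrow> (\<forall>x y. (x, y) \<in> Z \<longrightarrow> lab x = lab y \<and>
     (\<forall>x' y'. (x', y') \<in> Z \<longrightarrow> (x = x' \<longleftrightarrow> y = y') \<and> (A x x' \<longleftrightarrow> A y y')))"

lemma partial_iso_mono: "partial_iso lab A Z \<Longrightarrow> Z' \<subseteq> Z \<Longrightarrow> partial_iso lab A Z'"
  unfolding partial_iso_def by fast

lemma partial_iso_converse: "partial_iso lab A (Z\<inverse>) \<longleftrightarrow> partial_iso lab A Z"
  unfolding partial_iso_def by auto

lemma partial_iso_Un: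
  assumes "partial_iso lab A Z" "partial_iso lab A Z'"
    and "\<And>x y x' y'. (x, y) \<in> Z \<Longrightarrow> (x', y') \<in> Z' \<Longrightarrow>
      x \<noteq> x' \<and> y \<noteq> y' \<and> (A x' x \<longleftrightarrow> A y' y) \<and> (A x x' \<longleftrightarrow> A y y')"
  shows "partial_iso lab A (Z \<union> Z')"
  unfolding partial_iso_def
proof (intro allI impI conjI)
  fix x y x' y' assume *: "(x, y) \<in> Z \<union> Z'"
  then show "lab x = lab y" using assms(1,2) unfolding partial_iso_def by blast
  assume "(x', y') \<in> Z \<union> Z'"
  with * have "(x = x' \<longleftrightarrow> y = y') \<and> (A x x' \<longleftrightarrow> A y y')"
    using assms(1,2)[unfolded partial_iso_def] assms(3)[of x y x' y'] assms(3)[of x' y' x y]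
    by (elim UnE) blast+
  then show "x = x' \<longleftrightarrow> y = y'" "A x x' \<longleftrightarrow> A y y'" by blast+
qed

lemma atomic_type_eq_iff:
  assumes "length M = length M'"
  shows "atomic_type lab A M = atomic_type lab A M' \<longleftrightarrow> partial_iso lab A (set (zip M M'))"
proof -
  have "atomic_type lab A M = atomic_type lab A M' \<longleftrightarrow>
      (\<forall>i<length M. lab (M ! i) = lab (M' ! i) \<and>
        (\<forall>j<length M. (M ! i = M ! j \<longleftrightarrow> M' ! i = M' ! j) \<and> (A (M ! i) (M ! j) \<longleftrightarrow> A (M' ! i) (M' ! j))))"
    using assms by (simp add: atomic_type_def list_eq_iff_nth_eq) blast
  moreover have "set (zip M M') = {(M ! i, M' ! i) | i. i < length M}"
    using assms by (simp add: set_zip)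
  ultimately show ?thesis by (simp add: partial_iso_def) blast
qed

text \<open>Here \<open>rel\<close> is the relation of bounded degree, while \<open>A\<close> may
  have large degree. The enriched label \<open>lab\<close> determines the label bits
  \<open>L\<close> that formulas see and, by \<open>default\<close>, the adjacency of unrelated
  vertices. The list \<open>nb u\<close> is padded with \<open>u\<close>, which is why
  \<open>nb_rel\<close> admits \<open>w = u\<close>.\<close>

locale local_structure =
  fixes V :: "'v set" and A :: "'v \<Rightarrow> 'v \<Rightarrow> bool" and L :: "'v \<Rightarrow> bool list"
    and lab :: "'v \<Rightarrow> 'l" and rel :: "'v \<Rightarrow> 'v \<Rightarrow> bool" and nb :: "'v \<Rightarrow> 'v list" and D :: nat
  assumes fin: "finite V"
    and A_sym: "u \<in> V \<Longrightarrow> w \<in> V \<Longrightarrow> A u w \<longleftrightarrow> A w u"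
    and rel_sym: "u \<in> V \<Longrightarrow> w \<in> V \<Longrightarrow> rel u w \<Longrightarrow> rel w u"
    and length_nb: "u \<in> V \<Longrightarrow> length (nb u) = D"
    and nb_V: "u \<in> V \<Longrightarrow> set (nb u) \<subseteq> V"
    and nb_rel: "u \<in> V \<Longrightarrow> w \<in> set (nb u) \<Longrightarrow> w = u \<or> rel u w"
    and rel_nb: "u \<in> V \<Longrightarrow> w \<in> V \<Longrightarrow> rel u w \<Longrightarrow> w \<in> set (nb u)"
    and lab_L: "u \<in> V \<Longrightarrow> w \<in> V \<Longrightarrow> lab u = lab w \<Longrightarrow> L u = L w"
    and default: "\<lbrakk>u \<in> V; w \<in> V; u' \<in> V; w' \<in> V; lab u = lab u'; lab w = lab w';
      \<not> rel u w; \<not> rel u' w'\<rbrakk> \<Longrightarrow> A u w \<longleftrightarrow> A u' w'"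
begin

abbreviation iso where "iso \<equiv> partial_iso lab A"
abbreviation pairs where "pairs r \<equiv> pair_step nb ^^ r"
abbreviation expands where "expands r \<equiv> expand nb ^^ r"

definition near where "near = {(x, y). x \<in> V \<and> y \<in> V \<and> (x = y \<or> rel x y)}"

section \<open>Iterated matchings and balls\<close>

lemma pair_step_V: "Z \<subseteq> V \<times> V \<Longrightarrow> pair_step nb Z \<subseteq> V \<times> V"
  using nb_V by (fastforce simp: pair_step_def dest: set_zip_leftD set_zip_rightD)

lemma pairs_V: "Z \<subseteq> V \<times> V \<Longrightarrow> pairs r Z \<subseteq> V \<times> V"
  by (induction r) (auto dest: pair_step_V)

lemma pair_step_Un: "pair_step nb (Z \<union> Z') = pair_step nb Z \<union> pair_step nb Z'"
  by (simp add: pair_step_def)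

lemma pairs_Un: "pairs r (Z \<union> Z') = pairs r Z \<union> pairs r Z'"
  by (induction r) (auto simp: pair_step_Un)

lemma pairs_mono: "Z \<subseteq> Z' \<Longrightarrow> pairs r Z \<subseteq> pairs r Z'"
  by (metis pairs_Un subset_Un_eq)

lemma pair_step_ext: "Z \<subseteq> pair_step nb Z"
  by (auto simp: pair_step_def)

lemma pairs_ext: "Z \<subseteq> pairs r Z"
  using pair_step_ext by (induction r) (auto)

lemma pairs_add: "pairs (m + n) Z = pairs m (pairs n Z)"
  by (simp add: funpow_add)

lemma pairs_le: "m \<le> n \<Longrightarrow> pairs m Z \<subseteq> pairs n Z"
  by (metis add.commute le_add_diff_inverse pairs_add pairs_ext)

lemma pair_step_converse: "pair_step nb (Z\<inverse>) = (pair_step nb Z)\<inverse>"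
  unfolding pair_step_def by (fastforce simp: set_zip)

lemma pairs_converse: "pairs r (Z\<inverse>) = (pairs r Z)\<inverse>"
  by (induction r) (auto simp: pair_step_converse)

lemma expand_V: "set M \<subseteq> V \<Longrightarrow> set (expand nb M) \<subseteq> V"
  using nb_V by (auto simp: expand_def)

lemma length_expand: "set M \<subseteq> V \<Longrightarrow> length (expand nb M) = length M * (D + 1)"
  by (induction M) (auto simp: length_nb)

lemma expands_V: "set M \<subseteq> V \<Longrightarrow> set (expands r M) \<subseteq> V"
  by (induction r) (auto dest: expand_V)

lemma length_expands: "set M \<subseteq> V \<Longrightarrow> length (expands r M) = length M * (D + 1) ^ r"
  by (induction r) (simp_all add: length_expand expands_V algebra_simps)

lemma zip_expand:
  "length M = length M' \<Longrightarrow> set M \<subseteq> V \<Longrightarrow> set M' \<subseteq> V \<Longrightarrow>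
    set (zip (expand nb M) (expand nb M')) = pair_step nb (set (zip M M'))"
proof (induction M M' rule: list_induct2)
  case (Cons x M y M')
  then have "length (nb x) = length (nb y)" by (simp add: length_nb)
  with Cons show ?case by (simp add: pair_step_def)
qed (simp add: pair_step_def)

lemma zip_expands:
  assumes "length M = length M'" "set M \<subseteq> V" "set M' \<subseteq> V"
  shows "set (zip (expands r M) (expands r M')) = pairs r (set (zip M M'))"
  using assms by (induction r) (simp_all add: zip_expand length_expands expands_V)

text \<open>Neighbour lists have equal length, so \<open>zip\<close> cuts nothing off and the left
  components exhaust the ball of radius 1.\<close>

lemma Domain_pair_step: assumes "Z \<subseteq> V \<times> V" shows "Domain (pair_step nb Z) = near `` Domain Z"
proof (intro set_eqI iffI)
  fix u assume "u \<in> Domain (pair_step nb Z)"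
  then obtain w x y where xy: "(x, y) \<in> Z" "(u, w) \<in> set (zip (x # nb x) (y # nb y))"
    by (auto simp: pair_step_def)
  then have "x \<in> V" "u = x \<or> u \<in> set (nb x)" using assms by (auto dest: set_zip_leftD)
  then have "(x, u) \<in> near" using nb_rel[of x u] nb_V[of x] by (auto simp: near_def)
  then show "u \<in> near `` Domain Z" using xy(1) by auto
next
  fix u assume "u \<in> near `` Domain Z"
  then obtain x y where xy: "(x, y) \<in> Z" "(x, u) \<in> near" by auto
  then have "u \<in> set (x # nb x)" using rel_nb by (auto simp: near_def)
  then obtain i where i: "i < length (x # nb x)" "u = (x # nb x) ! i" by (metis in_set_conv_nth)
  moreover have "length (y # nb y) = length (x # nb x)" using xy(1) assms length_nb by auto
  ultimately have "(u, (y # nb y) ! i) \<in> set (zip (x # nb x) (y # nb y))"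
    unfolding set_zip by force
  with xy(1) show "u \<in> Domain (pair_step nb Z)" by (auto simp: pair_step_def)
qed

lemma Domain_pairs: "Z \<subseteq> V \<times> V \<Longrightarrow> Domain (pairs r Z) = (near ^^ r) `` Domain Z"
  by (induction r) (auto simp: Domain_pair_step pairs_V relcomp_Image)

lemma Range_pairs: "Z \<subseteq> V \<times> V \<Longrightarrow> Range (pairs r Z) = (near ^^ r) `` Range Z"
  using Domain_pairs[of "Z\<inverse>" r] by (auto simp: pairs_converse)

lemma near_sym: "(x, y) \<in> near \<Longrightarrow> (y, x) \<in> near"
  using rel_sym by (auto simp: near_def)

lemma near_pow_sym: "(x, y) \<in> near ^^ r \<Longrightarrow> (y, x) \<in> near ^^ r"
proof (induction r arbitrary: x y)
  case (Suc r)
  then show ?case by (meson near_sym relpow_Suc_D2 relpow_Suc_I relpow_Suc_E)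
qed simp

text \<open>Otherwise two walks of length \<open>r\<close> and the step between their ends would
  join \<open>X\<close> to \<open>c\<close> in \<open>r + 1 + r\<close> steps.\<close>

lemma far_apart:
  assumes "x \<in> (near ^^ r) `` {c}" "x' \<in> (near ^^ r) `` X" "c \<notin> (near ^^ (2 * r + 1)) `` X"
  shows "(x', x) \<notin> near"
proof
  assume *: "(x', x) \<in> near"
  from assms(2) obtain a where a: "a \<in> X" "(a, x') \<in> near ^^ r" by auto
  from a(2) * have "(a, x) \<in> near ^^ Suc r" by auto
  moreover have "(x, c) \<in> near ^^ r" using assms(1) near_pow_sym by auto
  ultimately have "(a, c) \<in> near ^^ (Suc r + r)" unfolding relpow_add by auto
  then show False using a(1) assms(3) by (auto simp: mult_2)
qed

lemma type_eq_iff: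
  assumes "x \<in> V" "y \<in> V"
  shows "atomic_type lab A (expands r [x]) = atomic_type lab A (expands r [y]) \<longleftrightarrow> iso (pairs r {(x, y)})"
proof -
  have "length (expands r [x]) = length (expands r [y])" using assms by (simp add: length_expands)
  moreover have "set (zip (expands r [x]) (expands r [y])) = pairs r {(x, y)}"
    using assms zip_expands[of "[x]" "[y]" r] by simp
  ultimately show ?thesis by (simp only: atomic_type_eq_iff)
qed

text \<open>
  A far vertex is answered by counting: the partial isomorphism matches the vertices of a given type
  near the left tuple with those near the right tuple, so if some vertex of that type is far from
  the left tuple, then some vertex of that type is far from the right one.
\<close>

lemma extend_left:
  assumes Z: "Z \<subseteq> V \<times> V" and iso: "iso (pairs (3 * r + 1) Z)" and c: "c \<in> V"
  shows "\<exists>d \<in> V. iso (pairs r (insert (c, d) Z))"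
proof -
  \<comment> \<open>A vertex within distance \<open>2 * r + 1\<close> of the left tuple finds its
    partner in \<open>N\<close>. Growing \<open>N\<close> by \<open>r\<close> more steps gives
    exactly radius \<open>3 * r + 1\<close>, where the isomorphism is assumed; hence pairs in
    \<open>N\<close> agree up to radius \<open>r\<close>.\<close>
  define N where "N = pairs (2 * r + 1) Z"
  have NV: "N \<subseteq> V \<times> V" unfolding N_def by (rule pairs_V[OF Z])
  have "3 * r + 1 = r + (2 * r + 1)" by simp
  then have "pairs (3 * r + 1) Z = pairs r N"
    unfolding N_def by (metis pairs_add)
  with iso have isoN: "iso (pairs r N)" by (simp only:)
  show ?thesis
  proof (cases "c \<in> Domain N")
    case True
    then obtain d where d: "(c, d) \<in> N" by auto
    have "insert (c, d) Z \<subseteq> N" using d pairs_ext[of Z "2 * r + 1"] unfolding N_def by blast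
    from partial_iso_mono[OF isoN pairs_mono[OF this]] show ?thesis using d NV by blast
  next
    case False
    define T where "T = {x \<in> V. atomic_type lab A (expands r [x]) = atomic_type lab A (expands r [c])}"
    have T: "x \<in> T \<longleftrightarrow> y \<in> T" if "(x, y) \<in> N" for x y
    proof -
      have V: "x \<in> V" "y \<in> V" using that NV by auto
      have "iso (pairs r {(x, y)})"
        by (rule partial_iso_mono[OF isoN pairs_mono]) (use that in simp)
      then show ?thesis unfolding type_eq_iff[OF V, symmetric] using V by (auto simp: T_def)
    qed
    have isoN': "iso N" using partial_iso_mono[OF isoN pairs_ext] .
    \<comment> \<open>By \<open>T\<close> the matching \<open>N\<close> respects membership in
      \<open>T\<close>, so its restriction is a bijection between the parts of \<open>T\<close>
      lying near the two tuples.\<close>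
    define M where "M = N \<inter> T \<times> T"
    have M: "fst ` M = Domain N \<inter> T" "snd ` M = Range N \<inter> T"
      using T by (force simp: M_def)+
    have "y = y' \<longleftrightarrow> x = x'" if "(x, y) \<in> N" "(x', y') \<in> N" for x y x' y'
      using isoN' that unfolding partial_iso_def by blast
    then have "inj_on fst M" "inj_on snd M"
      unfolding M_def by (auto simp: inj_on_def)
    then have "card (Domain N \<inter> T) = card (Range N \<inter> T)"
      unfolding M[symmetric] by (simp add: card_image)
    moreover have "finite T" "c \<in> T" using fin c by (auto simp: T_def)
    moreover have "Domain N \<inter> T \<subset> T" using False \<open>c \<in> T\<close> by auto
    ultimately have "card (Range N \<inter> T) < card T" by (metis psubset_card_mono)
    then have "Range N \<inter> T \<noteq> T" by auto
    then obtain d where d: "d \<in> T" "d \<notin> Range N" by auto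
    then have dV: "d \<in> V" and iso_cd: "iso (pairs r {(c, d)})"
      using type_eq_iff[of d c r] type_eq_iff[of c d r] c by (auto simp: T_def)
    have rZ: "iso (pairs r Z)"
      by (rule partial_iso_mono[OF iso pairs_le]) simp
    \<comment> \<open>On either side the new ball and the old ones are disjoint and joined by no
      \<open>rel\<close> edge. By \<open>default\<close> the adjacency between them is a function of
      the labels, which both matchings preserve.\<close>
    have cross: "x \<noteq> x'" "y \<noteq> y'" "A x' x \<longleftrightarrow> A y' y" "A x x' \<longleftrightarrow> A y y'"
      if xy: "(x, y) \<in> pairs r {(c, d)}" "(x', y') \<in> pairs r Z" for x y x' y'
    proof -
      have cd: "{(c, d)} \<subseteq> V \<times> V" using c dV by simp
      have V: "x \<in> V" "y \<in> V" "x' \<in> V" "y' \<in> V" using pairs_V[OF cd, of r] pairs_V[OF Z, of r] xy by auto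
      have "x \<in> (near ^^ r) `` {c}" using Domain_pairs[OF cd, of r] xy(1) by auto
      moreover have "x' \<in> (near ^^ r) `` Domain Z" using Domain_pairs[OF Z, of r] xy(2) by blast
      moreover have "c \<notin> (near ^^ (2 * r + 1)) `` Domain Z"
        using False unfolding N_def Domain_pairs[OF Z] .
      ultimately have "(x', x) \<notin> near" by (rule far_apart)
      moreover have "y \<in> (near ^^ r) `` {d}" using Range_pairs[OF cd, of r] xy(1) by auto
      moreover have "y' \<in> (near ^^ r) `` Range Z" using Range_pairs[OF Z, of r] xy(2) by blast
      moreover have "d \<notin> (near ^^ (2 * r + 1)) `` Range Z"
        using d(2) unfolding N_def Range_pairs[OF Z] .
      ultimately have far: "(x', x) \<notin> near" "(y', y) \<notin> near" using far_apart by blast+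
      then show "x \<noteq> x'" "y \<noteq> y'" using V by (auto simp: near_def)
      have "lab x = lab y" using iso_cd xy(1) unfolding partial_iso_def by fast
      moreover have "lab x' = lab y'" using rZ xy(2) unfolding partial_iso_def by fast
      ultimately show "A x' x \<longleftrightarrow> A y' y"
        using default[of x' x y' y] V far by (auto simp: near_def)
      then show "A x x' \<longleftrightarrow> A y y'" using A_sym V by blast
    qed
    have "iso (pairs r {(c, d)} \<union> pairs r Z)"
      using iso_cd rZ cross by (intro partial_iso_Un) auto
    then have "iso (pairs r (insert (c, d) Z))"
      using pairs_Un[of r "{(c, d)}" Z] by simp
    with dV show ?thesis by blast
  qed
qed

lemma extend_right:
  assumes Z: "Z \<subseteq> V \<times> V" and iso: "iso (pairs (3 * r + 1) Z)" and d: "d \<in> V"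
  shows "\<exists>c \<in> V. iso (pairs r (insert (c, d) Z))"
proof -
  have "iso (pairs (3 * r + 1) (Z\<inverse>))" using iso by (simp only: pairs_converse partial_iso_converse)
  with Z d obtain c where "c \<in> V" "iso (pairs r (insert (d, c) (Z\<inverse>)))"
    using extend_left[of "Z\<inverse>" r d] by auto
  moreover have "insert (d, c) (Z\<inverse>) = (insert (c, d) Z)\<inverse>" by auto
  ultimately show ?thesis by (metis pairs_converse partial_iso_converse)
qed

text \<open>An Ehrenfeucht-Fraisse argument: \<open>extend_left\<close> and
  \<open>extend_right\<close> answer a quantifier on either side while the radius shrinks from at
  least \<open>3 * r + 1\<close> to \<open>r\<close>. Since \<open>Z\<close> only has to contain the
  values of the free variables, pairs of overwritten variables may stay in it.\<close>

theorem iso_fsat: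
  assumes "Z \<subseteq> V \<times> V" "iso (pairs (radius (enc_fm \<phi>)) Z)" "\<And>x. x \<in> fv \<phi> \<Longrightarrow> (s x, s' x) \<in> Z"
  shows "fsat V A L s \<phi> \<longleftrightarrow> fsat V A L s' \<phi>"
  using assms
proof (induction \<phi> arbitrary: s s' Z)
  case (Equal x y)
  then have "iso Z" using partial_iso_mono[OF _ pairs_ext] by blast
  with Equal(3) show ?case unfolding partial_iso_def by (auto 0 3)
next
  case (Edge x y)
  then have "iso Z" using partial_iso_mono[OF _ pairs_ext] by blast
  with Edge(3) show ?case unfolding partial_iso_def by (auto 0 3)
next
  case (Label i x)
  then have "iso Z" using partial_iso_mono[OF _ pairs_ext] by blast
  moreover have mem: "(s x, s' x) \<in> Z" using Label.prems(3) by simp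
  ultimately have "lab (s x) = lab (s' x)" unfolding partial_iso_def by blast
  moreover have "s x \<in> V" "s' x \<in> V" using mem Label.prems(1) by auto
  ultimately have "L (s x) = L (s' x)" using lab_L by blast
  then show ?case by simp
next
  case (Neg \<phi>)
  have "iso (pairs (radius (enc_fm \<phi>)) Z)"
    by (rule partial_iso_mono[OF Neg.prems(2) pairs_le]) simp
  with Neg show ?case by simp
next
  case (Conj \<phi> \<psi>)
  have iso: "iso (pairs (radius (enc_fm \<phi>)) Z)" "iso (pairs (radius (enc_fm \<psi>)) Z)"
    by (rule partial_iso_mono[OF Conj.prems(2) pairs_le], simp)+
  have "fsat V A L s \<phi> \<longleftrightarrow> fsat V A L s' \<phi>" "fsat V A L s \<psi> \<longleftrightarrow> fsat V A L s' \<psi>"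
    by (rule Conj.IH[OF Conj.prems(1)], use Conj.prems(3) iso in simp_all)+
  then show ?case by simp
next
  case (Disj \<phi> \<psi>)
  have iso: "iso (pairs (radius (enc_fm \<phi>)) Z)" "iso (pairs (radius (enc_fm \<psi>)) Z)"
    by (rule partial_iso_mono[OF Disj.prems(2) pairs_le], simp)+
  have "fsat V A L s \<phi> \<longleftrightarrow> fsat V A L s' \<phi>" "fsat V A L s \<psi> \<longleftrightarrow> fsat V A L s' \<psi>"
    by (rule Disj.IH[OF Disj.prems(1)], use Disj.prems(3) iso in simp_all)+
  then show ?case by simp
next
  case (Exists x \<phi>)
  let ?r = "radius (enc_fm \<phi>)"
  have iso: "iso (pairs (3 * ?r + 1) Z)"
    by (rule partial_iso_mono[OF Exists.prems(2) pairs_le]) simp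
  have *: "fsat V A L (s(x := c)) \<phi> \<longleftrightarrow> fsat V A L (s'(x := d)) \<phi>"
    if "c \<in> V" "d \<in> V" "iso (pairs ?r (insert (c, d) Z))" for c d
    using Exists.prems that by (intro Exists.IH[of "insert (c, d) Z"]) auto
  show ?case
    unfolding fsat.simps
    using extend_left[OF Exists.prems(1) iso] extend_right[OF Exists.prems(1) iso] * by metis
next
  case (Forall x \<phi>)
  let ?r = "radius (enc_fm \<phi>)"
  have iso: "iso (pairs (3 * ?r + 1) Z)"
    by (rule partial_iso_mono[OF Forall.prems(2) pairs_le]) simp
  have *: "fsat V A L (s(x := c)) \<phi> \<longleftrightarrow> fsat V A L (s'(x := d)) \<phi>"
    if "c \<in> V" "d \<in> V" "iso (pairs ?r (insert (c, d) Z))" for c d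
    using Forall.prems that by (intro Forall.IH[of "insert (c, d) Z"]) auto
  show ?case
    unfolding fsat.simps
    using extend_left[OF Forall.prems(1) iso] extend_right[OF Forall.prems(1) iso] * by metis
qed

text \<open>Vertices of equal type over the current tuple are interchangeable as values of the next
  variable. The tuple is matched with itself, so the values of the other free variables form
  diagonal pairs.\<close>

lemma type_fsat:
  assumes "set M \<subseteq> V" "v \<in> V" "w \<in> V"
    and "atomic_type lab A (expands (radius (enc_fm \<phi>)) (v # M)) =
      atomic_type lab A (expands (radius (enc_fm \<phi>)) (w # M))"
    and "\<And>y. y \<in> fv \<phi> - {x} \<Longrightarrow> s y \<in> set M"
  shows "fsat V A L (s(x := v)) \<phi> \<longleftrightarrow> fsat V A L (s(x := w)) \<phi>"
proof (rule iso_fsat)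
  let ?Z = "set (zip (v # M) (w # M))"
  show "?Z \<subseteq> V \<times> V" using assms(1-3) by (auto dest: set_zip_leftD set_zip_rightD)
  show "iso (pairs (radius (enc_fm \<phi>)) ?Z)"
    using assms(1-4) by (simp only: zip_expands[symmetric] list.set insert_subset length_Cons
        atomic_type_eq_iff length_expands simp_thms)
  show "((s(x := v)) y, (s(x := w)) y) \<in> ?Z" if "y \<in> fv \<phi>" for y
    using that assms(5)[of y] by (auto simp: zip_same_conv_map)
qed

end

section \<open>The bounded degree structure of a near-uniform graph\<close>

text \<open>A vertex is represented by its index together with its label bits and its adjacency row.\<close>

type_synonym vx = "nat \<times> bool list \<times> bool list"

definition adj :: "vx \<Rightarrow> vx \<Rightarrow> bool" where
  "adj u v = hdd False (drop (fst v) (snd (snd u)))"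

definition close :: "nat \<Rightarrow> vx list \<Rightarrow> vx \<Rightarrow> vx \<Rightarrow> bool" where
  "close k vs u v \<longleftrightarrow> length (filter (\<lambda>w. adj u w \<noteq> adj v w) vs) \<le> k"

definition reps :: "nat \<Rightarrow> vx list \<Rightarrow> vx list" where
  "reps k vs = thin (close k vs) vs"

text \<open>
  A hub is an exception of unboundedly many vertices. There are few hubs, so that adjacency to them
  can be recorded in labels; what remains after dropping them has bounded degree.
\<close>

definition exc :: "nat \<Rightarrow> vx list \<Rightarrow> vx \<Rightarrow> vx \<Rightarrow> bool" where
  "exc k vs u w \<longleftrightarrow> (\<exists>c \<in> set (reps k vs). close k vs c u \<and> adj c w \<noteq> adj u w)"

definition hub :: "nat \<Rightarrow> nat \<Rightarrow> vx list \<Rightarrow> vx \<Rightarrow> bool" where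
  "hub k p vs w \<longleftrightarrow> \<not> length (filter (\<lambda>u. exc k vs u w) vs) \<le> 4 * k * p"

definition lnk :: "nat \<Rightarrow> nat \<Rightarrow> vx list \<Rightarrow> vx \<Rightarrow> vx \<Rightarrow> bool" where
  "lnk k p vs u w \<longleftrightarrow> exc k vs u w \<and> \<not> hub k p vs w \<or> exc k vs w u \<and> \<not> hub k p vs u"

text \<open>The length is the degree bound: \<open>u\<close> has at most \<open>k\<close> exceptions
  for each of at most \<open>p\<close> representatives, and unless it is a hub it is an exception of
  at most \<open>4 * k * p\<close> vertices.\<close>

definition nbs :: "nat \<Rightarrow> nat \<Rightarrow> vx list \<Rightarrow> vx \<Rightarrow> vx list" where
  "nbs k p vs u = pad (5 * k * p) u (filter (lnk k p vs u) vs)"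

definition anchors :: "nat \<Rightarrow> nat \<Rightarrow> vx list \<Rightarrow> vx list" where
  "anchors k p vs = reps k vs @ filter (hub k p vs) vs"

text \<open>Equality with the anchors singles out each hub, closeness lets vertices with equal
  labels use the same representative, and adjacency to the anchors supplies the default value. All
  lists have the same length, so equality of labels means equality of the blocks.\<close>

definition bits :: "nat \<Rightarrow> nat \<Rightarrow> vx list \<Rightarrow> vx \<Rightarrow> bool list" where
  "bits k p vs u = fst (snd u) @ map (adj u) (anchors k p vs) @ map (\<lambda>c. c = u) (anchors k p vs) @
     map (\<lambda>c. close k vs c u) (anchors k p vs)"

section \<open>Polynomial time of the construction\<close>

lemma ptc_length_le: "ptc f \<Longrightarrow> ptc (\<lambda>x. length (f x) \<le> k)"
  using ptc_null[OF ptc_drop[OF ptc_const[of k]], of f] by simp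

lemma ptc_adj:
  assumes f: "ptc f" and g: "ptc g"
  shows "ptc (\<lambda>x. adj (f x) (g x))"
  unfolding adj_def by (intro ptc_rules ptc_const f g)

lemma ptc_close:
  assumes vs: "ptc vs" and f: "ptc f" and g: "ptc g"
  shows "ptc (\<lambda>x. close k (vs x) (f x) (g x))"
  unfolding close_def
  by (intro ptc_length_le ptc_filter ptc_not ptc_eq ptc_adj ptc_fst ptc_snd ptc_id ptc_comp[OF f] ptc_comp[OF g] vs f g)

lemma ptc_reps:
  assumes vs: "ptc vs"
  shows "ptc (\<lambda>x. reps k (vs x))"
  unfolding reps_def by (intro ptc_thin ptc_close ptc_fst ptc_snd ptc_id ptc_comp[OF vs] vs)

lemma ptc_exc:
  assumes vs: "ptc vs" and f: "ptc f" and g: "ptc g"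
  shows "ptc (\<lambda>x. exc k (vs x) (f x) (g x))"
  unfolding exc_def
  by (intro ptc_bex ptc_reps ptc_conj ptc_not ptc_eq ptc_adj ptc_close ptc_fst ptc_snd ptc_id
      ptc_comp[OF f] ptc_comp[OF g] ptc_comp[OF vs] vs f g)

lemma ptc_hub:
  assumes vs: "ptc vs" and f: "ptc f"
  shows "ptc (\<lambda>x. hub k p (vs x) (f x))"
  unfolding hub_def
  by (intro ptc_length_le ptc_filter ptc_not ptc_exc ptc_fst ptc_snd ptc_id ptc_comp[OF f] ptc_comp[OF vs] vs f)

lemma ptc_lnk:
  assumes vs: "ptc vs" and f: "ptc f" and g: "ptc g"
  shows "ptc (\<lambda>x. lnk k p (vs x) (f x) (g x))"
  unfolding lnk_def by (intro ptc_disj ptc_conj ptc_not ptc_exc ptc_hub vs f g)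

lemma ptc_nbs:
  assumes vs: "ptc vs" and f: "ptc f"
  shows "ptc (\<lambda>x. nbs k p (vs x) (f x))"
  unfolding nbs_def
  by (intro ptc_pad ptc_filter ptc_lnk ptc_fst ptc_snd ptc_id ptc_comp[OF f] ptc_comp[OF vs] vs f)

lemma ptc_anchors:
  assumes vs: "ptc vs"
  shows "ptc (\<lambda>x. anchors k p (vs x))"
  unfolding anchors_def
  by (intro ptc_append ptc_reps ptc_filter ptc_hub ptc_fst ptc_snd ptc_id ptc_comp[OF vs] vs)

lemma ptc_bits:
  assumes vs: "ptc vs" and f: "ptc f"
  shows "ptc (\<lambda>x. bits k p (vs x) (f x))"
  unfolding bits_def
  by (intro ptc_append ptc_map ptc_adj ptc_eq ptc_close ptc_anchors ptc_fst ptc_snd ptc_id ptc_comp[OF f] ptc_comp[OF vs] vs f)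

text \<open>
  If one vertex of \<open>M\<close> is an exception of more than \<open>4k\<close> vertices, then, as the members of \<open>M\<close> are
  pairwise alike, all of them are exceptions of more than half of these vertices, while each of
  these vertices has at most \<open>k\<close> exceptions.
\<close>

lemma few_heavy:
  assumes fin: "finite U" "finite M"
    and k: "\<And>u. u \<in> U \<Longrightarrow> card {b \<in> M. E u b} \<le> k"
    and alike: "\<And>b b'. b \<in> M \<Longrightarrow> b' \<in> M \<Longrightarrow> card {u \<in> U. E u b \<and> \<not> E u b'} \<le> 2 * k"
    and b0: "b0 \<in> M" "card {u \<in> U. E u b0} > 4 * k"
  shows "card M \<le> 2 * k"
proof -
  define B where "B = {u \<in> U. E u b0}"
  have finB: "finite B" using fin by (simp add: B_def)
  have ge: "card B \<le> 2 * k + card {u \<in> B. E u b}" if "b \<in> M" for b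
  proof -
    have "B = {u \<in> U. E u b0 \<and> \<not> E u b} \<union> {u \<in> B. E u b}" by (auto simp: B_def)
    then have "card B \<le> card {u \<in> U. E u b0 \<and> \<not> E u b} + card {u \<in> B. E u b}"
      by (metis card_Un_le)
    with alike[OF b0(1) that] show ?thesis by linarith
  qed
  have "card M * card B = (\<Sum>b\<in>M. card B)" by simp
  also have "\<dots> \<le> (\<Sum>b\<in>M. 2 * k + card {u \<in> B. E u b})" by (rule sum_mono) (rule ge)
  also have "\<dots> = card M * (2 * k) + (\<Sum>b\<in>M. \<Sum>u\<in>{u \<in> B. E u b}. 1)"
    by (simp add: sum.distrib)
  also have "(\<Sum>b\<in>M. \<Sum>u\<in>{u \<in> B. E u b}. 1) = (\<Sum>u\<in>B. \<Sum>b\<in>{b \<in> M. E u b}. (1::nat))"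
    by (rule sum.swap_restrict[OF fin(2) finB])
  also have "\<dots> \<le> (\<Sum>u\<in>B. k)" using k by (intro sum_mono) (simp add: B_def)
  finally have le: "card M * card B \<le> card M * (2 * k) + card B * k" by simp
  have B4: "4 * k < card B" using b0(2) by (simp add: B_def)
  \<comment> \<open>As \<open>4 * k < card B\<close>, the summand \<open>card M * (2 * k)\<close> is
    at most half of the left hand side of \<open>le\<close> and can be absorbed there.\<close>
  have "card M * (4 * k) \<le> card M * card B" using B4 by (intro mult_left_mono) auto
  moreover have "card M * (4 * k) = 2 * (card M * (2 * k))" by simp
  ultimately have "card M * card B \<le> 2 * (card B * k)" using le by linarith
  then have "card M * card B \<le> (2 * k) * card B" by (simp add: mult_ac)
  moreover have "0 < card B" using B4 by linarith
  ultimately show ?thesis using mult_le_cancel2 by blast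
qed

text \<open>Near-uniformity enters through \<open>packing\<close> alone: at most \<open>p\<close>
  vertices can be pairwise not close.\<close>

locale coded_graph =
  fixes k p l :: nat and vs :: "vx list"
  assumes dist: "distinct vs"
    and adj_sym: "u \<in> set vs \<Longrightarrow> w \<in> set vs \<Longrightarrow> adj u w \<longleftrightarrow> adj w u"
    and length_labels: "u \<in> set vs \<Longrightarrow> length (fst (snd u)) = l"
    and packing: "S \<subseteq> set vs \<Longrightarrow> (\<And>u w. u \<in> S \<Longrightarrow> w \<in> S \<Longrightarrow> u \<noteq> w \<Longrightarrow>
      card {x \<in> set vs. adj u x \<noteq> adj w x} > k) \<Longrightarrow> card S \<le> p"
begin

abbreviation "V \<equiv> set vs"

lemma length_filter_card: "length (filter P vs) = card {x \<in> V. P x}"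
  using dist by (simp add: distinct_length_filter Int_def conj_commute)

lemma close_iff: "close k vs u v \<longleftrightarrow> card {w \<in> V. adj u w \<noteq> adj v w} \<le> k"
  unfolding close_def length_filter_card ..

lemma close_sym: "close k vs u v \<Longrightarrow> close k vs v u"
  unfolding close_iff by (simp add: eq_commute)

lemma reps_V: "set (reps k vs) \<subseteq> V"
  unfolding reps_def by (rule set_thin)

lemma reps_cover: "u \<in> V \<Longrightarrow> \<exists>c \<in> set (reps k vs). close k vs c u"
  unfolding reps_def by (rule thin_cover) (auto simp: close_iff)

lemma length_reps: "length (reps k vs) \<le> p"
proof -
  have "card (set (reps k vs)) \<le> p"
  proof (rule packing[OF reps_V])
    fix u w assume "u \<in> set (reps k vs)" "w \<in> set (reps k vs)" "u \<noteq> w"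
    then have "\<not> close k vs u w"
      unfolding reps_def using thin_apart[of "close k vs" u vs w] close_sym by blast
    then show "card {x \<in> V. adj u x \<noteq> adj w x} > k" by (simp add: close_iff)
  qed
  moreover have "distinct (reps k vs)" using distinct_thin[OF dist] by (simp add: reps_def)
  ultimately show ?thesis by (simp add: distinct_card)
qed

lemma card_reps: "card (set (reps k vs)) \<le> p"
  using length_reps card_length le_trans by blast

lemma card_UN_reps:
  assumes "\<And>c. c \<in> set (reps k vs) \<Longrightarrow> card (F c) \<le> m"
  shows "card (\<Union>c \<in> set (reps k vs). F c) \<le> p * m"
proof -
  have "card (\<Union>c \<in> set (reps k vs). F c) \<le> (\<Sum>c \<in> set (reps k vs). card (F c))"
    by (rule card_UN_le) simp
  also have "\<dots> \<le> card (set (reps k vs)) * m"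
    using sum_bounded_above[of "set (reps k vs)" "\<lambda>c. card (F c)" m] assms by simp
  also have "\<dots> \<le> p * m" using card_reps by simp
  finally show ?thesis .
qed

section \<open>Bounding the number of hubs\<close>

definition heavy where
  "heavy c w \<longleftrightarrow> card {u \<in> V. close k vs c u \<and> adj c w \<noteq> adj u w} > 4 * k"

lemma hub_heavy:
  assumes "hub k p vs w" shows "\<exists>c \<in> set (reps k vs). heavy c w"
proof (rule ccontr)
  assume "\<not> ?thesis"
  \<comment> \<open>Pigeonhole: the threshold \<open>4 * k * p\<close> of a hub is chosen so that
    one of the at most \<open>p\<close> representatives accounts for more than the
    \<open>4 * k\<close> exceptions that \<open>few_heavy\<close> requires.\<close>
  then have "card (\<Union>c \<in> set (reps k vs). {u \<in> V. close k vs c u \<and> adj c w \<noteq> adj u w}) \<le> p * (4 * k)"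
    by (intro card_UN_reps) (auto simp: heavy_def not_less)
  moreover have "(\<Union>c \<in> set (reps k vs). {u \<in> V. close k vs c u \<and> adj c w \<noteq> adj u w}) = {u \<in> V. exc k vs u w}"
    by (auto simp: exc_def)
  ultimately show False using assms by (simp add: hub_def length_filter_card algebra_simps)
qed

text \<open>The representative \<open>c'\<close> and the bit \<open>b\<close> make
  \<open>few_heavy\<close> applicable: vertices close to \<open>c'\<close> have similar
  neighbourhoods, and their common adjacency \<open>b\<close> to \<open>c\<close> turns similar
  neighbourhoods into similar behaviour as exceptions. One heavy vertex then bounds the whole set
  \<open>M\<close>, heavy or not.\<close>

lemma card_heavy:
  assumes c: "c \<in> set (reps k vs)" and c': "c' \<in> set (reps k vs)"
  shows "card {w \<in> V. close k vs c' w \<and> adj c w = b \<and> heavy c w} \<le> 2 * k"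
proof (cases "\<exists>w0 \<in> V. close k vs c' w0 \<and> adj c w0 = b \<and> heavy c w0")
  case True
  then obtain w0 where w0: "w0 \<in> V" "close k vs c' w0" "adj c w0 = b" "heavy c w0" by blast
  define M where "M = {w \<in> V. close k vs c' w \<and> adj c w = b}"
  define U where "U = {u \<in> V. close k vs c u}"
  have "card M \<le> 2 * k"
  proof (rule few_heavy[where E = "\<lambda>u w. adj c w \<noteq> adj u w" and U = U and ?b0.0 = w0])
    show "finite U" "finite M" "w0 \<in> M" using w0 by (auto simp: U_def M_def)
    show "card {u \<in> U. adj c w0 \<noteq> adj u w0} > 4 * k"
      using w0(4) by (simp add: heavy_def U_def conj_assoc)
    show "card {w \<in> M. adj c w \<noteq> adj u w} \<le> k" if "u \<in> U" for u
    proof -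
      have "card {w \<in> M. adj c w \<noteq> adj u w} \<le> card {w \<in> V. adj c w \<noteq> adj u w}"
        by (rule card_mono) (auto simp: M_def)
      with that show ?thesis by (simp add: U_def close_iff)
    qed
    show "card {u \<in> U. adj c w \<noteq> adj u w \<and> \<not> adj c w' \<noteq> adj u w'} \<le> 2 * k"
      if w: "w \<in> M" "w' \<in> M" for w w'
    proof -
      \<comment> \<open>If \<open>w\<close> is an exception of \<open>u\<close> and
        \<open>w'\<close> is not, then \<open>u\<close> is adjacent to exactly one of them, because
        \<open>c\<close> treats both alike. So \<open>w\<close> or \<open>w'\<close> disagrees with
        \<open>c'\<close> about \<open>u\<close>, and each does so for at most \<open>k\<close>
        vertices.\<close>
      have "{u \<in> U. adj c w \<noteq> adj u w \<and> \<not> adj c w' \<noteq> adj u w'} \<subseteq>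
          {u \<in> V. adj c' u \<noteq> adj w u} \<union> {u \<in> V. adj c' u \<noteq> adj w' u}"
      proof
        fix u assume "u \<in> {u \<in> U. adj c w \<noteq> adj u w \<and> \<not> adj c w' \<noteq> adj u w'}"
        then have u: "u \<in> V" "adj c w \<noteq> adj u w" "adj c w' = adj u w'" by (auto simp: U_def)
        have "w \<in> V" "w' \<in> V" using w by (simp_all add: M_def)
        then have "adj u w = adj w u" "adj u w' = adj w' u" using adj_sym u(1) by blast+
        moreover have "adj c w = b" "adj c w' = b" using w by (simp_all add: M_def)
        ultimately have "adj w u \<noteq> adj w' u" using u by simp
        then show "u \<in> {u \<in> V. adj c' u \<noteq> adj w u} \<union> {u \<in> V. adj c' u \<noteq> adj w' u}"
          using u(1) by auto
      qed
      then have "card {u \<in> U. adj c w \<noteq> adj u w \<and> \<not> adj c w' \<noteq> adj u w'} \<le>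
          card ({u \<in> V. adj c' u \<noteq> adj w u} \<union> {u \<in> V. adj c' u \<noteq> adj w' u})"
        by (rule card_mono[rotated]) simp
      also have "\<dots> \<le> card {u \<in> V. adj c' u \<noteq> adj w u} + card {u \<in> V. adj c' u \<noteq> adj w' u}"
        by (rule card_Un_le)
      also have "\<dots> \<le> k + k" using w by (intro add_mono) (simp_all add: M_def close_iff)
      finally show ?thesis by simp
    qed
  qed
  moreover have "card {w \<in> V. close k vs c' w \<and> adj c w = b \<and> heavy c w} \<le> card M"
    by (rule card_mono) (auto simp: M_def)
  ultimately show ?thesis by simp
next
  case False
  then have "{w \<in> V. close k vs c' w \<and> adj c w = b \<and> heavy c w} = {}" by blast
  then show ?thesis by (simp only: card.empty le0)
qed

text \<open>There are at most \<open>p * p\<close> pairs of representatives, and for each pair both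
  values of the bit contribute at most \<open>2 * k\<close>.\<close>

lemma card_hubs: "card {w \<in> V. hub k p vs w} \<le> p * (p * (4 * k))"
proof -
  let ?H = "\<lambda>c c' b. {w \<in> V. close k vs c' w \<and> adj c w = b \<and> heavy c w}"
  have "{w \<in> V. hub k p vs w} \<subseteq>
      (\<Union>c \<in> set (reps k vs). \<Union>c' \<in> set (reps k vs). ?H c c' True \<union> ?H c c' False)"
    using hub_heavy reps_cover by fastforce
  then have "card {w \<in> V. hub k p vs w} \<le>
      card (\<Union>c \<in> set (reps k vs). \<Union>c' \<in> set (reps k vs). ?H c c' True \<union> ?H c c' False)"
    by (rule card_mono[rotated]) auto
  also have "\<dots> \<le> p * (p * (4 * k))"
  proof (intro card_UN_reps)
    fix c c' assume "c \<in> set (reps k vs)" "c' \<in> set (reps k vs)"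
    then have "card (?H c c' True) \<le> 2 * k" "card (?H c c' False) \<le> 2 * k" by (rule card_heavy)+
    then show "card (?H c c' True \<union> ?H c c' False) \<le> 4 * k"
      using card_Un_le[of "?H c c' True" "?H c c' False"] by linarith
  qed
  finally show ?thesis .
qed

lemma length_anchors: "length (anchors k p vs) \<le> p + p * (p * (4 * k))"
  using length_reps card_hubs by (simp add: anchors_def length_filter_card)

section \<open>Bounded degree, and adjacency decided by labels\<close>

lemma length_links:
  assumes u: "u \<in> V" shows "length (filter (lnk k p vs u) vs) \<le> 5 * k * p"
proof -
  have "{w \<in> V. exc k vs u w} \<subseteq> (\<Union>c \<in> set (reps k vs). {w \<in> V. close k vs c u \<and> adj c w \<noteq> adj u w})"
    by (auto simp: exc_def)
  then have "card {w \<in> V. exc k vs u w} \<le> card (\<Union>c \<in> set (reps k vs). {w \<in> V. close k vs c u \<and> adj c w \<noteq> adj u w})"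
    by (rule card_mono[rotated]) auto
  also have "\<dots> \<le> p * k"
  proof (rule card_UN_reps)
    show "card {w \<in> V. close k vs c u \<and> adj c w \<noteq> adj u w} \<le> k" for c
      by (cases "close k vs c u") (simp_all add: close_iff)
  qed
  finally have 1: "card {w \<in> V. exc k vs u w} \<le> p * k" .
  have 2: "card {w \<in> V. exc k vs w u \<and> \<not> hub k p vs u} \<le> 4 * k * p"
    by (cases "hub k p vs u") (simp_all add: hub_def length_filter_card)
  have "length (filter (lnk k p vs u) vs) \<le> card ({w \<in> V. exc k vs u w} \<union> {w \<in> V. exc k vs w u \<and> \<not> hub k p vs u})"
    unfolding length_filter_card by (rule card_mono) (auto simp: lnk_def)
  also have "\<dots> \<le> p * k + 4 * k * p" using card_Un_le 1 2 add_mono le_trans by blast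
  finally show ?thesis by simp
qed

lemma length_bits: "u \<in> V \<Longrightarrow> length (bits k p vs u) = l + 3 * length (anchors k p vs)"
  by (simp add: bits_def length_labels)

lemma bitsD:
  assumes "u \<in> V" "w \<in> V" "bits k p vs u = bits k p vs w"
  shows "fst (snd u) = fst (snd w)"
    and "c \<in> set (anchors k p vs) \<Longrightarrow> adj u c = adj w c \<and> (c = u \<longleftrightarrow> c = w) \<and> (close k vs c u \<longleftrightarrow> close k vs c w)"
  using assms by (auto simp: bits_def length_labels)

sublocale local_structure V adj "\<lambda>u. fst (snd u)" "bits k p vs" "lnk k p vs" "nbs k p vs" "5 * k * p"
proof
  fix u w assume u: "u \<in> V" and w: "w \<in> V"
  show "adj u w = adj w u" using adj_sym u w .
  show "lnk k p vs u w \<Longrightarrow> lnk k p vs w u" by (auto simp: lnk_def)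
  show "lnk k p vs u w \<Longrightarrow> w \<in> set (nbs k p vs u)"
    using set_pad_superset[OF length_links[OF u], of u] w by (auto simp: nbs_def)
  show "bits k p vs u = bits k p vs w \<Longrightarrow> fst (snd u) = fst (snd w)" using bitsD(1) u w .
next
  fix u w assume u: "u \<in> V"
  show "length (nbs k p vs u) = 5 * k * p" by (simp add: nbs_def length_pad)
  show "set (nbs k p vs u) \<subseteq> V" using set_pad_subset[of _ u] u by (fastforce simp: nbs_def)
  show "w \<in> set (nbs k p vs u) \<Longrightarrow> w = u \<or> lnk k p vs u w"
    using set_pad_subset[of _ u] by (fastforce simp: nbs_def)
next
  fix u w u' w'
  assume V: "u \<in> V" "w \<in> V" "u' \<in> V" "w' \<in> V" and b: "bits k p vs u = bits k p vs u'" "bits k p vs w = bits k p vs w'"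
    and l: "\<not> lnk k p vs u w" "\<not> lnk k p vs u' w'"
  note bu = bitsD(2)[OF V(1,3) b(1)] and bw = bitsD(2)[OF V(2,4) b(2)]
  have anchor: "w \<in> set (anchors k p vs)" if "w \<in> V" "hub k p vs w" for w
    using that by (simp add: anchors_def)
  \<comment> \<open>A hub is an anchor, and equality with anchors is part of the label; so no other
    vertex has the label of a hub.\<close>
  have hub: "w = w'" if "hub k p vs w \<or> hub k p vs w'"
    using that bw anchor V by blast
  show "adj u w = adj u' w'"
  proof (cases "hub k p vs w")
    case True
    then show ?thesis using hub bu anchor V by blast
  next
    case False
    \<comment> \<open>Neither \<open>w\<close> nor \<open>w'\<close> is a hub, so for these pairs
      unlinked means not exceptional. A representative \<open>c\<close> close to \<open>u\<close> is
      also close to \<open>u'\<close>, and its adjacency to \<open>w\<close> and \<open>w'\<close>,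
      which is the same by their labels, decides both sides.\<close>
    then have "\<not> exc k vs u w" "\<not> exc k vs u' w'" using l hub by (auto simp: lnk_def)
    moreover obtain c where c: "c \<in> set (reps k vs)" "close k vs c u" using reps_cover V by blast
    then have cc: "c \<in> set (anchors k p vs)" "c \<in> V" using reps_V by (auto simp: anchors_def)
    moreover have "close k vs c u'" using bu cc(1) c(2) by blast
    ultimately have "adj c w = adj u w" "adj c w' = adj u' w'" using c by (auto simp: exc_def)
    moreover have "adj c w = adj c w'" using bw[OF cc(1)] adj_sym[OF cc(2)] V by blast
    ultimately show ?thesis by simp
  qed
qed simp

end

section \<open>Candidates\<close>

text \<open>The type from \<open>atomic_type\<close> with its triples flattened to bit lists, which
  are easy to count and compare. Nothing is lost, since the blocks have fixed lengths.\<close>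

definition atp :: "nat \<Rightarrow> nat \<Rightarrow> vx list \<Rightarrow> vx list \<Rightarrow> bool list list" where
  "atp k p vs M = map (\<lambda>x. bits k p vs x @ map (\<lambda>y. x = y) M @ map (adj x) M) M"

definition grow :: "nat \<Rightarrow> nat \<Rightarrow> vx list \<Rightarrow> (vx \<times> vx list) list \<Rightarrow> (vx \<times> vx list) list" where
  "grow k p vs X = map (\<lambda>q. (fst q, expand (nbs k p vs) (snd q))) X"

definition seed :: "vx list \<Rightarrow> (nat \<times> vx) list \<Rightarrow> (vx \<times> vx list) list" where
  "seed vs env = map (\<lambda>v. (v, v # map snd env)) vs"

definition pick :: "nat \<Rightarrow> nat \<Rightarrow> vx list \<Rightarrow> (vx \<times> vx list) list \<Rightarrow> vx list" where
  "pick k p vs X = map fst (thin (\<lambda>a b. snd a = snd b) (map (\<lambda>q. (fst q, atp k p vs (snd q))) X))"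

text \<open>The parts \<open>seed\<close>, \<open>grow\<close> and \<open>pick\<close> are
  polynomial helpers each, but the \<open>r\<close>-fold iteration produces tuples exponentially
  long in \<open>r\<close>. It is therefore left to the program, which passes the whole list of
  tagged tuples through its loop.\<close>

definition cands :: "nat \<Rightarrow> nat \<Rightarrow> vx list \<Rightarrow> nat \<Rightarrow> (nat \<times> vx) list \<Rightarrow> vx list" where
  "cands k p vs r env = pick k p vs ((grow k p vs ^^ r) (seed vs env))"

section \<open>Polynomial time of the single steps\<close>

lemma ptc_atp:
  assumes vs: "ptc vs" and f: "ptc f"
  shows "ptc (\<lambda>x. atp k p (vs x) (f x))"
  unfolding atp_def
  by (intro ptc_append ptc_map ptc_adj ptc_eq ptc_bits ptc_fst ptc_snd ptc_id ptc_comp[OF f] ptc_comp[OF vs] vs f)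

lemma ptc_grow:
  assumes vs: "ptc vs" and f: "ptc f"
  shows "ptc (\<lambda>x. grow k p (vs x) (f x))"
  unfolding grow_def expand_def
  by (intro ptc_map ptc_Pair ptc_concat ptc_Cons ptc_nbs ptc_fst ptc_snd ptc_id ptc_comp[OF f] ptc_comp[OF vs] vs f)

lemma ptc_seed:
  assumes vs: "ptc vs" and f: "ptc f"
  shows "ptc (\<lambda>x. seed (vs x) (f x))"
  unfolding seed_def
  by (intro ptc_map ptc_Pair ptc_Cons ptc_fst ptc_snd ptc_id ptc_comp[OF f] ptc_comp[OF vs] vs f)

lemma ptc_pick:
  assumes vs: "ptc vs" and f: "ptc f"
  shows "ptc (\<lambda>x. pick k p (vs x) (f x))"
  unfolding pick_def
  by (intro ptc_map ptc_Pair ptc_thin ptc_eq ptc_atp ptc_fst ptc_snd ptc_id ptc_comp[OF f] ptc_comp[OF vs] vs f)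

lemma distinct_thin_key: "distinct (map g (thin (\<lambda>a b. g a = g b) xs))"
  by (induction xs) force+

lemma grow_pow: "(grow k p vs ^^ r) X = map (\<lambda>q. (fst q, (expand (nbs k p vs) ^^ r) (snd q))) X"
  by (induction r) (simp_all add: grow_def)

lemma cands_alt: "cands k p vs r env = map fst (thin (\<lambda>a b. snd a = snd b)
    (map (\<lambda>v. (v, atp k p vs ((expand (nbs k p vs) ^^ r) (v # map snd env)))) vs))"
  by (simp add: cands_def pick_def seed_def grow_pow comp_def)

section \<open>One vertex per type\<close>

context coded_graph
begin

lemma nth_eq:
  "length M = length M' \<Longrightarrow> map f M = map g M' \<longleftrightarrow> (\<forall>i < length M. f (M ! i) = g (M' ! i))"
  by (simp add: list_eq_iff_nth_eq)

lemma atp_eq_iff: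
  assumes M: "set M \<subseteq> V" "set M' \<subseteq> V" "length M = length M'"
  shows "atp k p vs M = atp k p vs M' \<longleftrightarrow> atomic_type (bits k p vs) adj M = atomic_type (bits k p vs) adj M'"
proof -
  have "bits k p vs (M ! i) @ map (\<lambda>y. M ! i = y) M @ map (adj (M ! i)) M =
      bits k p vs (M' ! i) @ map (\<lambda>y. M' ! i = y) M' @ map (adj (M' ! i)) M' \<longleftrightarrow>
    bits k p vs (M ! i) = bits k p vs (M' ! i) \<and> map (\<lambda>y. M ! i = y) M = map (\<lambda>y. M' ! i = y) M' \<and>
      map (adj (M ! i)) M = map (adj (M' ! i)) M'" if "i < length M" for i
  proof -
    have "M ! i \<in> V" "M' ! i \<in> V"
      using subsetD[OF M(1) nth_mem[of i M]] subsetD[OF M(2) nth_mem[of i M']] that M(3) by simp_all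
    then have "length (bits k p vs (M ! i)) = length (bits k p vs (M' ! i))"
      by (simp only: length_bits)
    then show ?thesis using M(3) by (simp only: append_eq_append_conv length_map simp_thms)
  qed
  note key = this
  have 1: "atp k p vs M = atp k p vs M' \<longleftrightarrow> (\<forall>i < length M.
      bits k p vs (M ! i) @ map (\<lambda>y. M ! i = y) M @ map (adj (M ! i)) M =
      bits k p vs (M' ! i) @ map (\<lambda>y. M' ! i = y) M' @ map (adj (M' ! i)) M')"
    unfolding atp_def by (rule nth_eq[OF M(3)])
  have 2: "atomic_type (bits k p vs) adj M = atomic_type (bits k p vs) adj M' \<longleftrightarrow> (\<forall>i < length M.
      (bits k p vs (M ! i), map (\<lambda>y. M ! i = y) M, map (adj (M ! i)) M) =
      (bits k p vs (M' ! i), map (\<lambda>y. M' ! i = y) M', map (adj (M' ! i)) M'))"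
    unfolding atomic_type_def by (rule nth_eq[OF M(3)])
  show ?thesis
    unfolding 1 2 Pair_inject using key by blast
qed

lemma cands_V: "set (cands k p vs r env) \<subseteq> V"
  unfolding cands_alt set_map
  using image_mono[OF set_thin, of fst "\<lambda>a b. snd a = snd b"
      "map (\<lambda>v. (v, atp k p vs (expands r (v # map snd env)))) vs"]
  by (simp add: image_image)

text \<open>Thinning keeps a vertex with the same type as \<open>v\<close>, and
  \<open>type_fsat\<close> makes it an equivalent choice.\<close>

lemma cands_cover:
  assumes env: "set (map snd env) \<subseteq> V" and v: "v \<in> V" and fv: "\<And>y. y \<in> fv \<phi> - {x} \<Longrightarrow> s y \<in> set (map snd env)"
  shows "\<exists>w \<in> set (cands k p vs (radius (enc_fm \<phi>)) env).
    fsat V adj (\<lambda>u. fst (snd u)) (s(x := v)) \<phi> \<longleftrightarrow> fsat V adj (\<lambda>u. fst (snd u)) (s(x := w)) \<phi>"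
proof -
  let ?r = "radius (enc_fm \<phi>)"
  let ?t = "\<lambda>v. atp k p vs (expands ?r (v # map snd env))"
  let ?X = "map (\<lambda>v. (v, ?t v)) vs"
  have "\<exists>b \<in> set (thin (\<lambda>a b. snd a = snd b) ?X). snd b = snd (v, ?t v)"
    by (rule thin_cover) (use v in auto)
  then obtain b where b: "b \<in> set (thin (\<lambda>a b. snd a = snd b) ?X)" "snd b = ?t v" by auto
  moreover have "b \<in> set ?X" by (rule subsetD[OF set_thin b(1)])
  ultimately have w: "fst b \<in> V" "?t (fst b) = ?t v" by auto
  have "fst b \<in> set (cands k p vs ?r env)" using b(1) by (simp add: cands_alt)
  moreover have "fsat V adj (\<lambda>u. fst (snd u)) (s(x := v)) \<phi> \<longleftrightarrow> fsat V adj (\<lambda>u. fst (snd u)) (s(x := fst b)) \<phi>"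
  proof (rule type_fsat[OF env v w(1) _ fv])
    have V: "set (expands ?r (v # map snd env)) \<subseteq> V" "set (expands ?r (fst b # map snd env)) \<subseteq> V"
      using env v w(1) by (intro expands_V; simp)+
    have len: "length (expands ?r (v # map snd env)) = length (expands ?r (fst b # map snd env))"
      using env v w(1) by (simp add: length_expands)
    show "atomic_type (bits k p vs) adj (expands ?r (v # map snd env)) =
        atomic_type (bits k p vs) adj (expands ?r (fst b # map snd env))"
      using atp_eq_iff[OF V len] w(2) by simp
  qed
  ultimately show ?thesis by blast
qed

text \<open>Distinct candidates have distinct types. A type consists of one row for each of the
  \<open>m'\<close> entries of the expanded tuple, and a row has \<open>B\<close> bits: the enriched
  label, an equality pattern and an adjacency pattern. The number of vertices does not
  enter.\<close>

lemma length_cands: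
  assumes env: "set (map snd env) \<subseteq> V" and m: "(length env + 1) * (5 * k * p + 1) ^ r \<le> m"
  shows "length (cands k p vs r env) \<le> 2 ^ ((l + 3 * (p + p * (p * (4 * k))) + 2 * m) * m)"
proof -
  let ?t = "\<lambda>v. atp k p vs (expands r (v # map snd env))"
  let ?Y = "thin (\<lambda>a b. snd a = snd b) (map (\<lambda>v. (v, ?t v)) vs)"
  define m' where "m' = (length env + 1) * (5 * k * p + 1) ^ r"
  define B where "B = l + 3 * length (anchors k p vs) + 2 * m'"
  define C where "C = {bs :: bool list. set bs \<subseteq> UNIV \<and> length bs = B}"
  have cardC: "finite C" "card C = 2 ^ B"
    unfolding C_def by (intro finite_lists_length_eq, simp, subst card_lists_length_eq, simp, simp)
  have len: "length (cands k p vs r env) = card (set (map snd ?Y))"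
    using distinct_card[OF distinct_thin_key[of snd "map (\<lambda>v. (v, ?t v)) vs"]] by (simp add: cands_alt)
  have "set (map snd ?Y) \<subseteq> snd ` set (map (\<lambda>v. (v, ?t v)) vs)"
    by (subst set_map) (rule image_mono[OF set_thin])
  also have "\<dots> \<subseteq> {ts. set ts \<subseteq> C \<and> length ts = m'}"
  proof -
    have "set (?t v) \<subseteq> C \<and> length (?t v) = m'" if "v \<in> V" for v
    proof -
      have V: "set (v # map snd env) \<subseteq> V" using that env by simp
      have "length (expands r (v # map snd env)) = m'" using length_expands[OF V, of r] by (simp add: m'_def)
      moreover have "length (bits k p vs x) = l + 3 * length (anchors k p vs)"
        if "x \<in> set (expands r (v # map snd env))" for x
        using that expands_V[OF V] by (intro length_bits) blast
      ultimately show ?thesis by (auto simp: atp_def C_def B_def)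
    qed
    then show ?thesis by (simp add: image_image image_subset_iff del: split_paired_All)
  qed
  finally have "card (set (map snd ?Y)) \<le> card {ts. set ts \<subseteq> C \<and> length ts = m'}"
    by (rule card_mono[OF finite_lists_length_eq[OF cardC(1)]])
  also have "\<dots> = 2 ^ (B * m')" using cardC by (simp add: card_lists_length_eq power_mult)
  also have "\<dots> \<le> 2 ^ ((l + 3 * (p + p * (p * (4 * k))) + 2 * m) * m)"
    using m length_anchors unfolding B_def by (intro power_increasing mult_mono add_mono) (auto simp: m'_def)
  finally show ?thesis unfolding len .
qed

end

section \<open>Towers of exponentials\<close>

primrec tow :: "nat \<Rightarrow> nat" where
  "tow 0 = 1"
| "tow (Suc n) = 2 ^ tow n"

lemma tow_mono: "m \<le> n \<Longrightarrow> tow m \<le> tow n"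
proof (induction n)
  case (Suc n)
  have "tow n \<le> tow (Suc n)" unfolding tow.simps by (rule less_imp_le[OF less_exp])
  with Suc show ?case using le_trans by (cases "m = Suc n") (auto simp del: tow.simps)
qed simp

lemma le_tow: "n \<le> tow n"
proof (induction n)
  case (Suc n)
  have "Suc (tow n) \<le> 2 ^ tow n" by (rule Suc_leI[OF less_exp])
  with Suc show ?case unfolding tow.simps by linarith
qed simp

text \<open>On unary numbers function 3 doubles, function 2 exponentiates by repeated doubling,
  function 1 builds the tower by repeated exponentiation, and the main body first adds
  \<open>c\<close>.\<close>

lemma computable_tow: "computable (\<lambda>n. tow (n + c))"
proof -
  let ?arg = "((\<lambda>e. ENode ELeaf e) ^^ c) (Arg 0)"
  let ?one = "ENode ELeaf ELeaf"
  let ?P = "[Call 1 [?arg],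
    IfLeaf (Arg 0) ?one (Call 2 [Call 1 [Snd (Arg 0)]]),
    IfLeaf (Arg 0) ?one (Call 3 [Call 2 [Snd (Arg 0)]]),
    IfLeaf (Arg 0) ELeaf (ENode ELeaf (ENode ELeaf (Call 3 [Snd (Arg 0)])))] @ []"
  have dbl: "\<exists>T. calls ?P 3 [enc n] (enc (n + n)) T" for n :: nat
  proof (induction n)
    case 0
    show ?case unfolding add_0 enc_0
      by (rule exI, rule callsI, simp, rule nth_append_simps, (rule evl_If_True evl_rules)+, rule order_refl)
  next
    case (Suc n)
    then obtain T where IH: "calls ?P 3 [enc n] (enc (n + n)) T" by blast
    show ?case unfolding add_Suc add_Suc_right enc_Suc
      by (rule exI, rule callsI, simp, rule nth_append_simps,
        (rule evl_If_False evl_rules evl_Call IH tree.distinct(2))+, rule order_refl)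
  qed
  have exp: "\<exists>T. calls ?P 2 [enc n] (enc ((2::nat) ^ n)) T" for n :: nat
  proof (induction n)
    case 0
    have e: "enc ((2::nat) ^ 0) = Node Leaf Leaf" by simp
    show ?case unfolding e enc_0
      by (rule exI, rule callsI, simp, rule nth_append_simps, (rule evl_If_True evl_rules)+, rule order_refl)
  next
    case (Suc n)
    then obtain T where IH: "calls ?P 2 [enc n] (enc ((2::nat) ^ n)) T" by blast
    obtain T' where d: "calls ?P 3 [enc ((2::nat) ^ n)] (enc ((2::nat) ^ n + 2 ^ n)) T'" using dbl by blast
    show ?case unfolding power_Suc mult_2 enc_Suc
      by (rule exI, rule callsI, simp, rule nth_append_simps,
        (rule evl_If_False evl_rules evl_Call IH d tree.distinct(2))+, rule order_refl)
  qed
  have tow: "\<exists>T. calls ?P 1 [enc n] (enc (tow n)) T" for n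
  proof (induction n)
    case 0
    have e: "enc (tow 0) = Node Leaf Leaf" by simp
    show ?case unfolding e enc_0
      by (rule exI, rule callsI, simp, rule nth_append_simps, (rule evl_If_True evl_rules)+, rule order_refl)
  next
    case (Suc n)
    then obtain T where IH: "calls ?P 1 [enc n] (enc (tow n)) T" by blast
    obtain T' where d: "calls ?P 2 [enc (tow n)] (enc ((2::nat) ^ tow n)) T'" using exp by blast
    show ?case unfolding tow.simps enc_Suc
      by (rule exI, rule callsI, simp, rule nth_append_simps,
        (rule evl_If_False evl_rules evl_Call IH d tree.distinct(2))+, rule order_refl)
  qed
  have arg: "\<exists>T. evl ?P [enc n] (((\<lambda>e. ENode ELeaf e) ^^ j) (Arg 0)) (enc (n + j)) T" for n j :: nat
  proof (induction j)
    case 0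
    show ?case by (simp only: funpow_0 add_0_right) (rule exI, rule evl_Arg0)
  next
    case (Suc j)
    then obtain T where IH: "evl ?P [enc n] (((\<lambda>e. ENode ELeaf e) ^^ j) (Arg 0)) (enc (n + j)) T" by blast
    show ?case unfolding funpow.simps comp_apply add_Suc_right enc_Suc
      by (rule exI, rule evl_ENode, rule evl_ELeaf, rule IH)
  qed
  have "\<exists>T. calls ?P 0 [enc n] (enc (tow (n + c))) T" for n
  proof -
    obtain T where T: "evl ?P [enc n] ?arg (enc (n + c)) T" using arg by blast
    obtain T' where T': "calls ?P 1 [enc (n + c)] (enc (tow (n + c))) T'" using tow by blast
    show ?thesis
      by (rule exI, rule callsI, simp, rule nth_append_simps, (rule evl_Call T T' evls_Cons evls_Nil)+, rule order_refl)
  qed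
  then have "\<forall>n. \<exists>t. runs_in ?P [enc_nat n] (enc_nat (tow (n + c))) t"
    unfolding runs_in_def calls_def evl_def enc_nat_def'[symmetric] by fastforce
  then show ?thesis unfolding computable_def by blast
qed

text \<open>Shifting the argument by a constant absorbs sums, products and powers, so no explicit
  parameter function has to be programmed.\<close>

definition tower_bounded :: "(nat \<Rightarrow> nat) \<Rightarrow> bool" where
  "tower_bounded g \<longleftrightarrow> (\<exists>c. \<forall>s. g s \<le> tow (s + c))"

lemma tb_mono: "tower_bounded g \<Longrightarrow> (\<And>s. h s \<le> g s) \<Longrightarrow> tower_bounded h"
  unfolding tower_bounded_def by (meson le_trans)

lemma tb_id: "tower_bounded (\<lambda>s. s)"
  unfolding tower_bounded_def using le_tow by (metis add_0_right)

lemma tb_const: "tower_bounded (\<lambda>s. k)"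
  unfolding tower_bounded_def by (meson le_tow le_add2 le_trans)

lemma tb_exp2: "tower_bounded g \<Longrightarrow> tower_bounded (\<lambda>s. 2 ^ g s)"
  unfolding tower_bounded_def
proof (elim exE)
  fix c assume "\<forall>s. g s \<le> tow (s + c)"
  then have "2 ^ g s \<le> tow (s + Suc c)" for s by (simp add: power_increasing)
  then show "\<exists>c. \<forall>s. 2 ^ g s \<le> tow (s + c)" by blast
qed

lemma tb_add: assumes "tower_bounded g" "tower_bounded h" shows "tower_bounded (\<lambda>s. g s + h s)"
proof -
  from assms obtain a b where ab: "\<And>s. g s \<le> tow (s + a)" "\<And>s. h s \<le> tow (s + b)"
    unfolding tower_bounded_def by blast
  have "g s + h s \<le> tow (s + Suc (max a b))" for s
  proof -
    have "tow (s + a) \<le> tow (s + max a b)" "tow (s + b) \<le> tow (s + max a b)" by (simp_all add: tow_mono)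
    then have "g s + h s \<le> 2 * tow (s + max a b)" using ab[of s] by linarith
    also have "2 * n \<le> 2 ^ n" for n :: nat
    proof (cases n)
      case (Suc m)
      have "Suc m \<le> 2 ^ m" by (rule Suc_leI[OF less_exp])
      then show ?thesis unfolding Suc power_Suc by (rule mult_le_mono2)
    qed simp
    finally show ?thesis by simp
  qed
  then show ?thesis unfolding tower_bounded_def by blast
qed

lemma le_exp2: "n \<le> (2::nat) ^ n"
  by (rule less_imp_le[OF less_exp])

lemma tb_mult: assumes "tower_bounded g" "tower_bounded h" shows "tower_bounded (\<lambda>s. g s * h s)"
proof (rule tb_mono[OF tb_exp2[OF tb_add[OF assms]]])
  show "g s * h s \<le> 2 ^ (g s + h s)" for s
    unfolding power_add by (intro mult_mono le_exp2) auto
qed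

lemma tb_power: assumes "tower_bounded g" "tower_bounded h" shows "tower_bounded (\<lambda>s. g s ^ h s)"
proof (rule tb_mono[OF tb_exp2[OF tb_mult[OF assms]]])
  show "g s ^ h s \<le> 2 ^ (g s * h s)" for s
    unfolding power_mult by (intro power_mono le_exp2) auto
qed

lemmas tb_rules = tb_id tb_const tb_add tb_mult tb_power

text \<open>For \<open>1 \<le> N\<close> the powers of \<open>N\<close> increase with the exponent,
  so summands of different degrees can be combined.\<close>

definition fpt_bounded :: "(nat \<Rightarrow> nat \<Rightarrow> nat) \<Rightarrow> bool" where
  "fpt_bounded g \<longleftrightarrow> (\<exists>h c. tower_bounded h \<and> (\<forall>s N. 1 \<le> N \<longrightarrow> g s N \<le> h s * N ^ c))"

lemma fpt_tb: "tower_bounded h \<Longrightarrow> fpt_bounded (\<lambda>s N. h s)"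
  unfolding fpt_bounded_def by (intro exI[of _ h] exI[of _ 0]) simp

lemma fpt_N: "fpt_bounded (\<lambda>s N. N)"
  unfolding fpt_bounded_def by (intro exI[of _ "\<lambda>_. 1"] exI[of _ 1]) (simp add: tb_const)

lemma fpt_mult: assumes "fpt_bounded g" "fpt_bounded h" shows "fpt_bounded (\<lambda>s N. g s N * h s N)"
proof -
  from assms obtain a b c d where ab: "tower_bounded a" "tower_bounded b"
    and g: "\<And>s N. 1 \<le> N \<Longrightarrow> g s N \<le> a s * N ^ c" and h: "\<And>s N. 1 \<le> N \<Longrightarrow> h s N \<le> b s * N ^ d"
    unfolding fpt_bounded_def by blast
  have "g s N * h s N \<le> (a s * b s) * N ^ (c + d)" if "1 \<le> N" for s N
    using mult_mono[OF g[OF that] h[OF that]] by (simp add: power_add mult_ac)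
  then show ?thesis unfolding fpt_bounded_def using tb_mult[OF ab] by blast
qed

lemma fpt_add: assumes "fpt_bounded g" "fpt_bounded h" shows "fpt_bounded (\<lambda>s N. g s N + h s N)"
proof -
  from assms obtain a b c d where ab: "tower_bounded a" "tower_bounded b"
    and g: "\<And>s N. 1 \<le> N \<Longrightarrow> g s N \<le> a s * N ^ c" and h: "\<And>s N. 1 \<le> N \<Longrightarrow> h s N \<le> b s * N ^ d"
    unfolding fpt_bounded_def by blast
  have "g s N + h s N \<le> (a s + b s) * N ^ (c + d)" if N: "1 \<le> N" for s N
  proof -
    have "a s * N ^ c \<le> a s * N ^ (c + d)" "b s * N ^ d \<le> b s * N ^ (c + d)"
      using N by (intro mult_left_mono power_increasing; simp)+
    then show ?thesis unfolding add_mult_distrib using g[OF N, of s] h[OF N, of s] by linarith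
  qed
  then show ?thesis unfolding fpt_bounded_def using tb_add[OF ab] by blast
qed

lemma fpt_power: "fpt_bounded g \<Longrightarrow> fpt_bounded (\<lambda>s N. g s N ^ d)"
  by (induction d) (auto intro: fpt_mult fpt_tb tb_const)

lemmas fpt_rules = fpt_N fpt_mult fpt_add fpt_power

section \<open>The model checking program\<close>

text \<open>The function the program computes: ordinary evaluation, except that quantifiers range
  over the candidates. It separates the running time (\<open>call_ev\<close>) from correctness
  (\<open>evf_fsat\<close>).\<close>

primrec evf :: "nat \<Rightarrow> nat \<Rightarrow> vx list \<Rightarrow> fm \<Rightarrow> (nat \<times> vx) list \<Rightarrow> bool" where
  "evf k p vs (Equal x y) env \<longleftrightarrow> lookup (0, [], []) env x = lookup (0, [], []) env y"
| "evf k p vs (Edge x y) env \<longleftrightarrow> adj (lookup (0, [], []) env x) (lookup (0, [], []) env y)"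
| "evf k p vs (Label i x) env \<longleftrightarrow> hdd False (drop i (fst (snd (lookup (0, [], []) env x))))"
| "evf k p vs (Neg \<phi>) env \<longleftrightarrow> \<not> evf k p vs \<phi> env"
| "evf k p vs (Conj \<phi> \<psi>) env \<longleftrightarrow> evf k p vs \<phi> env \<and> evf k p vs \<psi> env"
| "evf k p vs (Disj \<phi> \<psi>) env \<longleftrightarrow> evf k p vs \<phi> env \<or> evf k p vs \<psi> env"
| "evf k p vs (Exists x \<phi>) env \<longleftrightarrow>
     (\<exists>v \<in> set (cands k p vs (radius (enc_fm \<phi>)) env). evf k p vs \<phi> ((x, v) # env))"
| "evf k p vs (Forall x \<phi>) env \<longleftrightarrow>
     (\<forall>v \<in> set (cands k p vs (radius (enc_fm \<phi>)) env). evf k p vs \<phi> ((x, v) # env))"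

type_synonym atom = "(nat \<times> vx) list \<times> nat \<times> nat"

definition eq_atom :: "atom \<Rightarrow> bool" where
  "eq_atom z \<longleftrightarrow> lookup (0, [], []) (fst z) (fst (snd z)) = lookup (0, [], []) (fst z) (snd (snd z))"

definition edge_atom :: "atom \<Rightarrow> bool" where
  "edge_atom z \<longleftrightarrow> adj (lookup (0, [], []) (fst z) (fst (snd z))) (lookup (0, [], []) (fst z) (snd (snd z)))"

definition label_atom :: "atom \<Rightarrow> bool" where
  "label_atom z \<longleftrightarrow> hdd False (drop (fst (snd z)) (fst (snd (lookup (0, [], []) (fst z) (snd (snd z))))))"

lemma ptc_atoms: "ptc eq_atom" "ptc edge_atom" "ptc label_atom"
proof -
  have "ptc (\<lambda>z. eq_atom z)" unfolding eq_atom_def by (intro ptc_rules)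
  moreover have "ptc (\<lambda>z. edge_atom z)" unfolding edge_atom_def by (intro ptc_adj ptc_rules)
  moreover have "ptc (\<lambda>z. label_atom z)" unfolding label_atom_def by (intro ptc_rules ptc_const)
  ultimately show "ptc eq_atom" "ptc edge_atom" "ptc label_atom" by simp_all
qed

text \<open>
  In the bodies below, argument 0 is the list of coded vertices. \<open>off 0, \<dots>, off 6\<close> are the positions
  of the polynomial time helper functions.
\<close>

abbreviation "Tru \<equiv> ENode ELeaf ELeaf"
abbreviation "sub1 \<equiv> Fst (Snd (Arg 1))"
abbreviation "sub2 \<equiv> Fst (Snd (Snd (Arg 1)))"

definition cand_expr :: "(nat \<Rightarrow> nat) \<Rightarrow> expr" where
  "cand_expr off = Call (off 6) [ENode (Arg 0) (Call 4 [Arg 0, sub2, Call (off 5) [ENode (Arg 0) (Arg 2)]])]"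

definition main_body :: "(nat \<Rightarrow> nat) \<Rightarrow> expr" where
  "main_body off = Call 1 [Call (off 0) [Arg 0], Arg 1, ELeaf]"

text \<open>Constructor tags are unary numbers, so the dispatch strips one \<open>Snd\<close> per
  test.\<close>

definition ev_body :: "(nat \<Rightarrow> nat) \<Rightarrow> expr" where
  "ev_body off =
    IfLeaf (Fst (Arg 1)) (Call (off 1) [ENode (Arg 2) (ENode sub1 sub2)])
    (IfLeaf (Snd (Fst (Arg 1))) (Call (off 2) [ENode (Arg 2) (ENode sub1 sub2)])
    (IfLeaf (Snd (Snd (Fst (Arg 1)))) (Call (off 3) [ENode (Arg 2) (ENode sub1 sub2)])
    (IfLeaf (Snd (Snd (Snd (Fst (Arg 1))))) (IfLeaf (Call 1 [Arg 0, sub1, Arg 2]) Tru ELeaf)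
    (IfLeaf (Snd (Snd (Snd (Snd (Fst (Arg 1))))))
      (IfLeaf (Call 1 [Arg 0, sub1, Arg 2]) ELeaf (Call 1 [Arg 0, sub2, Arg 2]))
    (IfLeaf (Snd (Snd (Snd (Snd (Snd (Fst (Arg 1)))))))
      (IfLeaf (Call 1 [Arg 0, sub1, Arg 2]) (Call 1 [Arg 0, sub2, Arg 2]) Tru)
    (IfLeaf (Snd (Snd (Snd (Snd (Snd (Snd (Fst (Arg 1))))))))
      (Call 2 [Arg 0, sub2, sub1, Arg 2, cand_expr off])
      (Call 3 [Arg 0, sub2, sub1, Arg 2, cand_expr off])))))))"

definition any_body :: expr where
  "any_body = IfLeaf (Arg 4) ELeaf
    (IfLeaf (Call 1 [Arg 0, Arg 1, ENode (ENode (Arg 2) (Fst (Arg 4))) (Arg 3)])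
      (Call 2 [Arg 0, Arg 1, Arg 2, Arg 3, Snd (Arg 4)]) Tru)"

definition all_body :: expr where
  "all_body = IfLeaf (Arg 4) Tru
    (IfLeaf (Call 1 [Arg 0, Arg 1, ENode (ENode (Arg 2) (Fst (Arg 4))) (Arg 3)])
      ELeaf (Call 3 [Arg 0, Arg 1, Arg 2, Arg 3, Snd (Arg 4)]))"

abbreviation "rec4 t e \<equiv> Call 4 [Arg 0, t (Arg 1), e]"

text \<open>Three nested calls on each component and one \<open>grow\<close> follow the recursion
  equation of \<open>radius\<close>; with the encoded formula as counter no number has to be
  computed.\<close>

definition expand_body :: "(nat \<Rightarrow> nat) \<Rightarrow> expr" where
  "expand_body off = IfLeaf (Arg 1) (Arg 2) (Call (off 4) [ENode (Arg 0)
    (rec4 Snd (rec4 Snd (rec4 Snd (rec4 Fst (rec4 Fst (rec4 Fst (Arg 2)))))))])"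

locale fpt_program =
  fixes k p d :: nat and off :: "nat \<Rightarrow> nat" and Q P :: program
  assumes P_eq: "P = [main_body off, ev_body off, any_body, all_body, expand_body off] @ Q"
    and helpers: "realizes P (off 0) (behav (enum :: (bool list \<times> bool list) list \<Rightarrow> _) (\<lambda>z. (sz z + 2) ^ d))"
      "realizes P (off 1) (behav eq_atom (\<lambda>z. (sz z + 2) ^ d))"
      "realizes P (off 2) (behav edge_atom (\<lambda>z. (sz z + 2) ^ d))"
      "realizes P (off 3) (behav label_atom (\<lambda>z. (sz z + 2) ^ d))"
      "realizes P (off 4) (behav (\<lambda>z. grow k p (fst z) (snd z)) (\<lambda>z. (sz z + 2) ^ d))"
      "realizes P (off 5) (behav (\<lambda>z. seed (fst z) (snd z)) (\<lambda>z. (sz z + 2) ^ d))"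
      "realizes P (off 6) (behav (\<lambda>z. pick k p (fst z) (snd z)) (\<lambda>z. (sz z + 2) ^ d))"
begin

section \<open>Values and costs of the program functions\<close>

lemma P_nth: "0 < length P" "1 < length P" "2 < length P" "3 < length P" "4 < length P"
  "P ! 0 = main_body off" "P ! 1 = ev_body off" "P ! 2 = any_body" "P ! 3 = all_body" "P ! 4 = expand_body off"
  unfolding P_eq nth_append_simps by simp_all

lemma call_enum: "calls P (off 0) [enc g] (enc (enum g)) ((sz g + 2) ^ d)" for g :: "(bool list \<times> bool list) list"
  using helpers(1) unfolding realizes_behav by blast

lemma call_atoms:
  "calls P (off 1) [Node (enc env) (Node (enc x) (enc y))] (enc (evf k p vs (Equal x y) env)) ((sz (env, x, y) + 2) ^ d)"
  "calls P (off 2) [Node (enc env) (Node (enc x) (enc y))] (enc (evf k p vs (Edge x y) env)) ((sz (env, x, y) + 2) ^ d)"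
  "calls P (off 3) [Node (enc env) (Node (enc x) (enc y))] (enc (evf k p vs (Label x y) env)) ((sz (env, x, y) + 2) ^ d)"
  using helpers(2-4) unfolding realizes_behav
  by (auto simp: eq_atom_def edge_atom_def label_atom_def dest!: spec[of _ env] spec[of _ x] spec[of _ y])

lemma call_sets:
  "calls P (off 4) [Node (enc vs) (enc X)] (enc (grow k p vs X)) ((sz (vs, X) + 2) ^ d)"
  "calls P (off 5) [Node (enc vs) (enc env)] (enc (seed vs env)) ((sz (vs, env) + 2) ^ d)"
  "calls P (off 6) [Node (enc vs) (enc X)] (enc (pick k p vs X)) ((sz (vs, X) + 2) ^ d)"
  using helpers(5)[unfolded realizes_behav, rule_format, of "(vs, X)"]
    helpers(6)[unfolded realizes_behav, rule_format, of "(vs, env)"]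
    helpers(7)[unfolded realizes_behav, rule_format, of "(vs, X)"] by simp_all

lemma evl_If_Node: "evl P vs e (Node a b) t \<Longrightarrow> evl P vs e2 v t' \<Longrightarrow>
    evl P vs (IfLeaf e e1 e2) v (1 + t + t')"
  by (rule evl_If_False[OF _ tree.distinct(2)])

text \<open>The number \<open>j\<close> of steps already performed is part of the induction, as the
  six recursive calls continue from increasingly grown lists. \<open>B\<close> bounds every single
  step up to the total \<open>R\<close>.\<close>

lemma call_expand:
  assumes B: "\<And>i. i < R \<Longrightarrow> (sz (vs, (grow k p vs ^^ i) X) + 2) ^ d \<le> B"
  shows "j + radius t \<le> R \<Longrightarrow> calls P 4 [enc vs, t, enc ((grow k p vs ^^ j) X)]
    (enc ((grow k p vs ^^ (j + radius t)) X)) (10 + radius t * (B + 200))"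
proof (induction t arbitrary: j)
  case Leaf
  show ?case unfolding radius.simps add_0_right
    by (rule callsI[OF P_nth(5,10)], unfold expand_body_def, (rule evl_If_True evl_rules)+, simp)
next
  case (Node a b)
  let ?g = "\<lambda>j. (grow k p vs ^^ j) X" and ?a = "radius a" and ?b = "radius b"
  have "j + ?a \<le> R" "(j + ?a) + ?a \<le> R" "(j + ?a + ?a) + ?a \<le> R" "(j + ?a + ?a + ?a) + ?b \<le> R"
     "(j + ?a + ?a + ?a + ?b) + ?b \<le> R" "(j + ?a + ?a + ?a + ?b + ?b) + ?b \<le> R"
    and less: "j + ?a + ?a + ?a + ?b + ?b + ?b < R"
    using Node.prems by simp_all
  note IH = Node.IH(1)[OF this(1)] Node.IH(1)[OF this(2)] Node.IH(1)[OF this(3)]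
    Node.IH(2)[OF this(4)] Node.IH(2)[OF this(5)] Node.IH(2)[OF this(6)]
  have e: "j + radius (Node a b) = Suc (j + ?a + ?a + ?a + ?b + ?b + ?b)" by simp
  have g: "calls P (off 4) [Node (enc vs) (enc (?g (j + ?a + ?a + ?a + ?b + ?b + ?b)))]
      (enc (?g (j + radius (Node a b)))) B"
    unfolding e funpow.simps comp_apply by (rule calls_mono[OF call_sets(1) B[OF less]])
  show ?case
    by (rule callsI[OF P_nth(5,10)], unfold expand_body_def,
      rule evl_If_Node, rule evl_rules, (rule evl_rules evl_Call IH g)+, simp add: algebra_simps)
qed

lemma call_cands:
  assumes B: "\<And>i. i \<le> R \<Longrightarrow> (sz (vs, (grow k p vs ^^ i) (seed vs env)) + 2) ^ d \<le> B"
    "(sz (vs, env) + 2) ^ d \<le> B" and r: "radius t \<le> R"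
  shows "evl P [enc vs, Node tag (Node x (Node t u)), enc env] (cand_expr off)
    (enc (cands k p vs (radius t) env)) (100 + 2 * B + R * (B + 200))"
proof (rule evl_mono)
  have 1: "calls P 4 [enc vs, t, enc (seed vs env)] (enc ((grow k p vs ^^ radius t) (seed vs env))) (10 + R * (B + 200))"
    by (rule calls_mono[OF call_expand[of R vs "seed vs env" B 0, simplified]]) (use B(1) r in auto)
  have 2: "calls P (off 5) [Node (enc vs) (enc env)] (enc (seed vs env)) B"
    by (rule calls_mono[OF call_sets(2) B(2)])
  have 3: "calls P (off 6) [Node (enc vs) (enc ((grow k p vs ^^ radius t) (seed vs env)))]
      (enc (cands k p vs (radius t) env)) B"
    unfolding cands_def by (rule calls_mono[OF call_sets(3) B(1)[OF r]])
  show "evl P [enc vs, Node tag (Node x (Node t u)), enc env] (cand_expr off)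
    (enc (cands k p vs (radius t) env)) (50 + 2 * B + R * (B + 200))"
    unfolding cand_expr_def by (rule evl_mono, (rule evl_rules evl_Call 1 2 3)+, simp)
qed simp

lemma call_any:
  assumes "\<And>v. v \<in> set cs \<Longrightarrow> calls P 1 [vs, t, enc ((x, v) # env)] (enc (g v)) T"
  shows "calls P 2 [vs, t, enc x, enc env, enc cs] (enc (\<exists>v \<in> set cs. g v)) (10 + length cs * (T + 100))"
  using assms
proof (induction cs)
  case Nil
  show ?case unfolding list.set bex_simps enc_False enc_Nil
    by (rule callsI[OF P_nth(3,8)], unfold any_body_def, (rule evl_If_True evl_rules)+, simp)
next
  case (Cons v cs)
  have 1: "calls P 1 [vs, t, Node (Node (enc x) (enc v)) (enc env)] (enc (g v)) T"
    using Cons.prems[of v] by simp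
  have IH: "calls P 2 [vs, t, enc x, enc env, enc cs] (enc (\<exists>v \<in> set cs. g v)) (10 + length cs * (T + 100))"
    using Cons by simp
  show ?case
  proof (cases "g v")
    case True
    then have e: "enc (\<exists>v \<in> set (v # cs). g v) = Node Leaf Leaf" by simp
    show ?thesis unfolding e unfolding enc_Cons
      by (rule callsI[OF P_nth(3,8)], unfold any_body_def, rule evl_If_Node, rule evl_rules,
        rule evl_If_Node, (rule evl_rules evl_Call 1[unfolded eqTrueI[OF True] enc_True])+, simp)
  next
    case False
    then have e: "enc (\<exists>v \<in> set (v # cs). g v) = enc (\<exists>v \<in> set cs. g v)" and g: "g v = False" by simp_all
    show ?thesis unfolding e unfolding enc_Cons
      by (rule callsI[OF P_nth(3,8)], unfold any_body_def, rule evl_If_Node, rule evl_rules,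
        rule evl_If_True, (rule evl_rules evl_Call 1[unfolded g enc_False] IH)+, simp)
  qed
qed

lemma call_all:
  assumes "\<And>v. v \<in> set cs \<Longrightarrow> calls P 1 [vs, t, enc ((x, v) # env)] (enc (g v)) T"
  shows "calls P 3 [vs, t, enc x, enc env, enc cs] (enc (\<forall>v \<in> set cs. g v)) (10 + length cs * (T + 100))"
  using assms
proof (induction cs)
  case Nil
  show ?case unfolding list.set ball_simps enc_True enc_Nil
    by (rule callsI[OF P_nth(4,9)], unfold all_body_def, (rule evl_If_True evl_rules)+, simp)
next
  case (Cons v cs)
  have 1: "calls P 1 [vs, t, Node (Node (enc x) (enc v)) (enc env)] (enc (g v)) T"
    using Cons.prems[of v] by simp
  have IH: "calls P 3 [vs, t, enc x, enc env, enc cs] (enc (\<forall>v \<in> set cs. g v)) (10 + length cs * (T + 100))"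
    using Cons by simp
  show ?case
  proof (cases "g v")
    case True
    then have e: "enc (\<forall>v \<in> set (v # cs). g v) = enc (\<forall>v \<in> set cs. g v)" by simp
    show ?thesis unfolding e unfolding enc_Cons
      by (rule callsI[OF P_nth(4,9)], unfold all_body_def, rule evl_If_Node, rule evl_rules,
        rule evl_If_Node, (rule evl_rules evl_Call 1[unfolded eqTrueI[OF True] enc_True] IH)+, simp)
  next
    case False
    then have e: "enc (\<forall>v \<in> set (v # cs). g v) = Leaf" and g: "g v = False" by simp_all
    show ?thesis unfolding e unfolding enc_Cons
      by (rule callsI[OF P_nth(4,9)], unfold all_body_def, rule evl_If_Node, rule evl_rules,
        rule evl_If_True, (rule evl_rules evl_Call 1[unfolded g enc_False])+, simp)
  qed
qed

end

lemma enc_fm_Node: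
  "enc_fm (Equal x y) = Node Leaf (Node (enc x) (Node (enc y) Leaf))"
  "enc_fm (Edge x y) = Node (Node Leaf Leaf) (Node (enc x) (Node (enc y) Leaf))"
  "enc_fm (Label i x) = Node (Node Leaf (Node Leaf Leaf)) (Node (enc i) (Node (enc x) Leaf))"
  "enc_fm (Neg \<phi>) = Node (Node Leaf (Node Leaf (Node Leaf Leaf))) (Node (enc_fm \<phi>) Leaf)"
  "enc_fm (Conj \<phi> \<psi>) = Node (Node Leaf (Node Leaf (Node Leaf (Node Leaf Leaf))))
    (Node (enc_fm \<phi>) (Node (enc_fm \<psi>) Leaf))"
  "enc_fm (Disj \<phi> \<psi>) = Node (Node Leaf (Node Leaf (Node Leaf (Node Leaf (Node Leaf Leaf)))))
    (Node (enc_fm \<phi>) (Node (enc_fm \<psi>) Leaf))"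
  "enc_fm (Exists x \<phi>) = Node (Node Leaf (Node Leaf (Node Leaf (Node Leaf (Node Leaf (Node Leaf Leaf))))))
    (Node (enc x) (Node (enc_fm \<phi>) Leaf))"
  "enc_fm (Forall x \<phi>) = Node (Node Leaf (Node Leaf (Node Leaf (Node Leaf (Node Leaf (Node Leaf (Node Leaf Leaf)))))))
    (Node (enc x) (Node (enc_fm \<phi>) Leaf))"
  by (simp_all add: enc_nat_def enc_nat_def' numeral_eq_Suc)

lemma fm_size_pos: "1 \<le> fm_size \<phi>"
  by (cases \<phi>) auto

text \<open>With cost \<open>A\<close> per call and at most \<open>q\<close> candidates, a formula
  of size \<open>n\<close> is evaluated within \<open>A * (q + 3) ^ n\<close>. This and the next
  three lemmas are the cases of zero, one, two and \<open>q\<close> recursive calls; the 3 pays for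
  two subformulas and overhead even if \<open>q = 0\<close>.\<close>

lemma time_step0: "A \<le> A * (q + 3) ^ a" for A q a :: nat
  by simp

lemma time_step1: "A + A * (q + 3) ^ a \<le> A * (q + 3) ^ Suc a" for A q a :: nat
proof -
  have "(1::nat) \<le> (q + 3) ^ a" by simp
  then have "1 + (q + 3) ^ a \<le> (q + 3) ^ Suc a" unfolding power_Suc add_mult_distrib by linarith
  then have "A * (1 + (q + 3) ^ a) \<le> A * (q + 3) ^ Suc a" by (rule mult_left_mono) simp
  then show ?thesis by (simp only: distrib_left mult_1_right)
qed

lemma time_step2: "A + A * (q + 3) ^ a + A * (q + 3) ^ b \<le> A * (q + 3) ^ (1 + a + b)" for A q a b :: nat
proof -
  let ?x = "(q + 3) ^ a" and ?y = "(q + 3) ^ b"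
  have xy: "1 \<le> ?x" "1 \<le> ?y" by simp_all
  then have "?x \<le> ?x * ?y" "?y \<le> ?x * ?y" by simp_all
  moreover have "1 \<le> ?x * ?y" using xy by (metis mult_le_mono mult_1)
  ultimately have "1 + ?x + ?y \<le> (q + 3) * (?x * ?y)" unfolding add_mult_distrib by linarith
  then have "A * (1 + ?x + ?y) \<le> A * ((q + 3) * (?x * ?y))" by (rule mult_left_mono) simp
  then show ?thesis by (simp add: distrib_left power_add)
qed

lemma time_step3:
  fixes A q a :: nat
  assumes "1 \<le> a" shows "A + q * (A * (q + 3) ^ a + A) \<le> A * (q + 3) ^ Suc a"
proof -
  have "(q + 3) ^ 1 \<le> (q + 3) ^ a" by (rule power_increasing) (use assms in auto)
  then have "1 + q * ((q + 3) ^ a + 1) \<le> (q + 3) ^ Suc a"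
    unfolding power_Suc add_mult_distrib distrib_left by simp
  then have "A * (1 + q * ((q + 3) ^ a + 1)) \<le> A * (q + 3) ^ Suc a" by (rule mult_left_mono) simp
  moreover have "A + q * (A * x + A) = A * (1 + q * (x + 1))" for x by (simp add: algebra_simps)
  ultimately show ?thesis by (simp only:)
qed

context fpt_program
begin

text \<open>In \<open>length env + fm_size \<phi> \<le> M\<close> a quantifier moves one unit from
  the formula to the environment, so environments stay short. Variable names are below
  \<open>M\<close> because they count in \<open>fm_size\<close>; label indices do not, hence their
  separate premise. \<open>A\<close> covers the computation of the candidates.\<close>

lemma call_ev:
  fixes vs :: "vx list" and M R B q :: nat
  defines "good env \<equiv> set (map snd env) \<subseteq> set vs \<and> (\<forall>x \<in> set env. fst x \<le> M) \<and> length env \<le> M"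
    and "A \<equiv> 1000 + 2 * B + R * (B + 200)"
  assumes B1: "\<And>env i. good env \<Longrightarrow> i \<le> R \<Longrightarrow> (sz (vs, (grow k p vs ^^ i) (seed vs env)) + 2) ^ d \<le> B"
    and B2: "\<And>env. good env \<Longrightarrow> (sz (vs, env) + 2) ^ d \<le> B"
    and B3: "\<And>env x y. good env \<Longrightarrow> x \<le> M \<Longrightarrow> y \<le> M \<Longrightarrow> (sz (env, x, y) + 2) ^ d \<le> B"
    and q: "\<And>env r. good env \<Longrightarrow> r \<le> R \<Longrightarrow> length (cands k p vs r env) \<le> q"
    and cV: "\<And>env r. good env \<Longrightarrow> set (cands k p vs r env) \<subseteq> set vs"
  shows "good env \<Longrightarrow> length env + fm_size \<phi> \<le> M \<Longrightarrow> radius (enc_fm \<phi>) \<le> R \<Longrightarrow>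
    \<forall>i \<in> label_inds \<phi>. i \<le> M \<Longrightarrow>
    calls P 1 [enc vs, enc_fm \<phi>, enc env] (enc (evf k p vs \<phi> env)) (A * (q + 3) ^ fm_size \<phi>)"
proof (induction \<phi> arbitrary: env)
  case (Equal x y)
  have c: "calls P (off 1) [Node (enc env) (Node (enc x) (enc y))] (enc (evf k p vs (Equal x y) env)) B"
    by (rule calls_mono[OF call_atoms(1) B3]) (use Equal.prems in simp_all)
  have "calls P 1 [enc vs, enc_fm (Equal x y), enc env] (enc (evf k p vs (Equal x y) env)) (200 + B)"
    unfolding enc_fm_Node
    by (rule callsI[OF P_nth(2,7)], unfold ev_body_def, rule evl_If_True, (rule evl_rules)+,
        (rule evl_rules evl_Call c)+, simp)
  then show ?case
    by (rule calls_mono) (rule le_trans[OF _ time_step0], simp add: A_def)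
next
  case (Edge x y)
  have c: "calls P (off 2) [Node (enc env) (Node (enc x) (enc y))] (enc (evf k p vs (Edge x y) env)) B"
    by (rule calls_mono[OF call_atoms(2) B3]) (use Edge.prems in simp_all)
  have "calls P 1 [enc vs, enc_fm (Edge x y), enc env] (enc (evf k p vs (Edge x y) env)) (200 + B)"
    unfolding enc_fm_Node
    by (rule callsI[OF P_nth(2,7)], unfold ev_body_def, rule evl_If_Node, (rule evl_rules)+,
        rule evl_If_True, (rule evl_rules)+, (rule evl_rules evl_Call c)+, simp)
  then show ?case
    by (rule calls_mono) (rule le_trans[OF _ time_step0], simp add: A_def)
next
  case (Label x y)
  have c: "calls P (off 3) [Node (enc env) (Node (enc x) (enc y))] (enc (evf k p vs (Label x y) env)) B"
    by (rule calls_mono[OF call_atoms(3) B3]) (use Label.prems in simp_all)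
  have "calls P 1 [enc vs, enc_fm (Label x y), enc env] (enc (evf k p vs (Label x y) env)) (200 + B)"
    unfolding enc_fm_Node
    by (rule callsI[OF P_nth(2,7)], unfold ev_body_def, 
        rule evl_If_Node, (rule evl_rules)+, rule evl_If_Node, (rule evl_rules)+,
        rule evl_If_True, (rule evl_rules)+, (rule evl_rules evl_Call c)+, simp)
  then show ?case
    by (rule calls_mono) (rule le_trans[OF _ time_step0], simp add: A_def)
next
  case (Neg \<phi>)
  let ?T = "A * (q + 3) ^ fm_size \<phi>"
  have IH: "calls P 1 [enc vs, enc_fm \<phi>, enc env] (enc (evf k p vs \<phi> env)) ?T"
    using Neg by simp
  have "calls P 1 [enc vs, enc_fm (Neg \<phi>), enc env] (enc (evf k p vs (Neg \<phi>) env)) (200 + ?T)"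
  proof (cases "evf k p vs \<phi> env")
    case True
    then have e: "enc (evf k p vs (Neg \<phi>) env) = Leaf" by simp
    show ?thesis unfolding enc_fm_Node e
      by (rule callsI[OF P_nth(2,7)], unfold ev_body_def, 
        rule evl_If_Node, (rule evl_rules)+, rule evl_If_Node, (rule evl_rules)+, rule evl_If_Node, (rule evl_rules)+,
        rule evl_If_True, (rule evl_rules)+,
        rule evl_If_Node, (rule evl_rules evl_Call IH[unfolded eqTrueI[OF True] enc_True])+, simp)
  next
    case False
    then have e: "enc (evf k p vs (Neg \<phi>) env) = Node Leaf Leaf" and f: "evf k p vs \<phi> env = False" by simp_all
    show ?thesis unfolding enc_fm_Node e
      by (rule callsI[OF P_nth(2,7)], unfold ev_body_def, 
        rule evl_If_Node, (rule evl_rules)+, rule evl_If_Node, (rule evl_rules)+, rule evl_If_Node, (rule evl_rules)+,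
        rule evl_If_True, (rule evl_rules)+,
        rule evl_If_True, (rule evl_rules evl_Call IH[unfolded f enc_False])+, simp)
  qed
  then show ?case
    by (rule calls_mono) (use time_step1[of A q "fm_size \<phi>"] in \<open>simp add: A_def\<close>)
next
  case (Conj \<phi> \<psi>)
  let ?T = "A * (q + 3) ^ fm_size \<phi>" and ?T' = "A * (q + 3) ^ fm_size \<psi>"
  have IH: "calls P 1 [enc vs, enc_fm \<phi>, enc env] (enc (evf k p vs \<phi> env)) ?T"
    "calls P 1 [enc vs, enc_fm \<psi>, enc env] (enc (evf k p vs \<psi> env)) ?T'"
    using Conj by simp_all
  have "calls P 1 [enc vs, enc_fm (Conj \<phi> \<psi>), enc env] (enc (evf k p vs (Conj \<phi> \<psi>) env)) (200 + ?T + ?T')"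
  proof (cases "evf k p vs \<phi> env")
    case True
    then have e: "enc (evf k p vs (Conj \<phi> \<psi>) env) = enc (evf k p vs \<psi> env)" by simp
    show ?thesis unfolding enc_fm_Node e
      by (rule callsI[OF P_nth(2,7)], unfold ev_body_def, 
        rule evl_If_Node, (rule evl_rules)+, rule evl_If_Node, (rule evl_rules)+, rule evl_If_Node, (rule evl_rules)+, rule evl_If_Node, (rule evl_rules)+,
        rule evl_If_True, (rule evl_rules)+,
        rule evl_If_Node, (rule evl_rules evl_Call IH(1)[unfolded eqTrueI[OF True] enc_True] IH(2))+, simp)
  next
    case False
    then have e: "enc (evf k p vs (Conj \<phi> \<psi>) env) = Leaf" and f: "evf k p vs \<phi> env = False" by simp_all
    show ?thesis unfolding enc_fm_Node e
      by (rule callsI[OF P_nth(2,7)], unfold ev_body_def, 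
        rule evl_If_Node, (rule evl_rules)+, rule evl_If_Node, (rule evl_rules)+, rule evl_If_Node, (rule evl_rules)+, rule evl_If_Node, (rule evl_rules)+,
        rule evl_If_True, (rule evl_rules)+,
        rule evl_If_True, (rule evl_rules evl_Call IH(1)[unfolded f enc_False])+, simp)
  qed
  then show ?case
    by (rule calls_mono) (use time_step2[of A q "fm_size \<phi>" "fm_size \<psi>"] in \<open>simp add: A_def\<close>)
next
  case (Disj \<phi> \<psi>)
  let ?T = "A * (q + 3) ^ fm_size \<phi>" and ?T' = "A * (q + 3) ^ fm_size \<psi>"
  have IH: "calls P 1 [enc vs, enc_fm \<phi>, enc env] (enc (evf k p vs \<phi> env)) ?T"
    "calls P 1 [enc vs, enc_fm \<psi>, enc env] (enc (evf k p vs \<psi> env)) ?T'"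
    using Disj by simp_all
  have "calls P 1 [enc vs, enc_fm (Disj \<phi> \<psi>), enc env] (enc (evf k p vs (Disj \<phi> \<psi>) env)) (200 + ?T + ?T')"
  proof (cases "evf k p vs \<phi> env")
    case True
    then have e: "enc (evf k p vs (Disj \<phi> \<psi>) env) = Node Leaf Leaf" by simp
    show ?thesis unfolding enc_fm_Node e
      by (rule callsI[OF P_nth(2,7)], unfold ev_body_def, 
        rule evl_If_Node, (rule evl_rules)+, rule evl_If_Node, (rule evl_rules)+, rule evl_If_Node, (rule evl_rules)+, rule evl_If_Node, (rule evl_rules)+, rule evl_If_Node, (rule evl_rules)+,
        rule evl_If_True, (rule evl_rules)+,
        rule evl_If_Node, (rule evl_rules evl_Call IH(1)[unfolded eqTrueI[OF True] enc_True])+, simp)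
  next
    case False
    then have e: "enc (evf k p vs (Disj \<phi> \<psi>) env) = enc (evf k p vs \<psi> env)" and f: "evf k p vs \<phi> env = False" by simp_all
    show ?thesis unfolding enc_fm_Node e
      by (rule callsI[OF P_nth(2,7)], unfold ev_body_def, 
        rule evl_If_Node, (rule evl_rules)+, rule evl_If_Node, (rule evl_rules)+, rule evl_If_Node, (rule evl_rules)+, rule evl_If_Node, (rule evl_rules)+, rule evl_If_Node, (rule evl_rules)+,
        rule evl_If_True, (rule evl_rules)+,
        rule evl_If_True, (rule evl_rules evl_Call IH(1)[unfolded f enc_False] IH(2))+, simp)
  qed
  then show ?case
    by (rule calls_mono) (use time_step2[of A q "fm_size \<phi>" "fm_size \<psi>"] in \<open>simp add: A_def\<close>)
next
  case (Exists x \<phi>)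
  let ?r = "radius (enc_fm \<phi>)" and ?T = "A * (q + 3) ^ fm_size \<phi>"
  let ?cs = "cands k p vs ?r env"
  have r: "?r \<le> R" using Exists.prems(3) by simp
  have IH: "calls P 1 [enc vs, enc_fm \<phi>, enc ((x, v) # env)] (enc (evf k p vs \<phi> ((x, v) # env))) ?T"
    if "v \<in> set ?cs" for v
    using Exists.prems that r cV[OF Exists.prems(1), of ?r] by (intro Exists.IH) (auto simp: good_def)
  have any: "calls P 2 [enc vs, enc_fm \<phi>, enc x, enc env, enc ?cs]
      (enc (\<exists>v \<in> set ?cs. evf k p vs \<phi> ((x, v) # env))) (10 + length ?cs * (?T + 100))"
    by (rule call_any) (rule IH)
  have cs: "evl P [enc vs, Node tag (Node y (Node (enc_fm \<phi>) u)), enc env] (cand_expr off)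
      (enc ?cs) (100 + 2 * B + R * (B + 200))" for tag y u
    by (rule call_cands[OF _ B2[OF Exists.prems(1)] r]) (rule B1[OF Exists.prems(1)])
  have "calls P 1 [enc vs, enc_fm (Exists x \<phi>), enc env] (enc (evf k p vs (Exists x \<phi>) env))
      (500 + (2 * B + R * (B + 200)) + length ?cs * (?T + 100))"
    unfolding enc_fm_Node evf.simps
    by (rule callsI[OF P_nth(2,7)], unfold ev_body_def, 
        rule evl_If_Node, (rule evl_rules)+, rule evl_If_Node, (rule evl_rules)+, rule evl_If_Node, (rule evl_rules)+, rule evl_If_Node, (rule evl_rules)+, rule evl_If_Node, (rule evl_rules)+, rule evl_If_Node, (rule evl_rules)+,
        rule evl_If_True, (rule evl_rules)+, (rule evl_rules evl_Call any cs)+, simp)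
  moreover have "500 + (2 * B + R * (B + 200)) + length ?cs * (?T + 100) \<le> A + q * (?T + A)"
    using q[OF Exists.prems(1) r] by (intro add_mono mult_mono) (auto simp: A_def)
  moreover have "\<dots> \<le> A * (q + 3) ^ Suc (fm_size \<phi>)" by (rule time_step3[OF fm_size_pos])
  moreover have "\<dots> \<le> A * (q + 3) ^ fm_size (Exists x \<phi>)"
    by (intro mult_left_mono power_increasing) simp_all
  ultimately show ?case by (meson calls_mono le_trans)
next
  case (Forall x \<phi>)
  let ?r = "radius (enc_fm \<phi>)" and ?T = "A * (q + 3) ^ fm_size \<phi>"
  let ?cs = "cands k p vs ?r env"
  have r: "?r \<le> R" using Forall.prems(3) by simp
  have IH: "calls P 1 [enc vs, enc_fm \<phi>, enc ((x, v) # env)] (enc (evf k p vs \<phi> ((x, v) # env))) ?T"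
    if "v \<in> set ?cs" for v
    using Forall.prems that r cV[OF Forall.prems(1), of ?r] by (intro Forall.IH) (auto simp: good_def)
  have all: "calls P 3 [enc vs, enc_fm \<phi>, enc x, enc env, enc ?cs]
      (enc (\<forall>v \<in> set ?cs. evf k p vs \<phi> ((x, v) # env))) (10 + length ?cs * (?T + 100))"
    by (rule call_all) (rule IH)
  have cs: "evl P [enc vs, Node tag (Node y (Node (enc_fm \<phi>) u)), enc env] (cand_expr off)
      (enc ?cs) (100 + 2 * B + R * (B + 200))" for tag y u
    by (rule call_cands[OF _ B2[OF Forall.prems(1)] r]) (rule B1[OF Forall.prems(1)])
  have "calls P 1 [enc vs, enc_fm (Forall x \<phi>), enc env] (enc (evf k p vs (Forall x \<phi>) env))
      (500 + (2 * B + R * (B + 200)) + length ?cs * (?T + 100))"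
    unfolding enc_fm_Node evf.simps
    by (rule callsI[OF P_nth(2,7)], unfold ev_body_def, 
        rule evl_If_Node, (rule evl_rules)+, rule evl_If_Node, (rule evl_rules)+, rule evl_If_Node, (rule evl_rules)+, rule evl_If_Node, (rule evl_rules)+, rule evl_If_Node, (rule evl_rules)+, rule evl_If_Node, (rule evl_rules)+, rule evl_If_Node, (rule evl_rules)+,
        (rule evl_rules evl_Call all cs)+, simp)
  moreover have "500 + (2 * B + R * (B + 200)) + length ?cs * (?T + 100) \<le> A + q * (?T + A)"
    using q[OF Forall.prems(1) r] by (intro add_mono mult_mono) (auto simp: A_def)
  moreover have "\<dots> \<le> A * (q + 3) ^ Suc (fm_size \<phi>)" by (rule time_step3[OF fm_size_pos])
  moreover have "\<dots> \<le> A * (q + 3) ^ fm_size (Forall x \<phi>)"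
    by (intro mult_left_mono power_increasing) simp_all
  ultimately show ?case by (meson calls_mono le_trans)
qed

lemma call_main:
  assumes "calls P 1 [enc (enum g), enc_fm \<phi>, Leaf] v T"
  shows "calls P 0 [enc (g :: (bool list \<times> bool list) list), enc_fm \<phi>] v (20 + (sz g + 2) ^ d + T)"
  by (rule callsI[OF P_nth(1,6)], unfold main_body_def, (rule evl_rules evl_Call call_enum assms)+, simp)

end


lemma program_exists: "\<exists>d off Q P. fpt_program k p d off Q P"
proof -
  have ptc: "ptc (\<lambda>z. enum (z :: (bool list \<times> bool list) list))"
    "ptc (\<lambda>z. grow k p (fst z) (snd z))" "ptc (\<lambda>z. seed (fst z) (snd z))" "ptc (\<lambda>z. pick k p (fst z) (snd z))"
    by (intro ptc_enum ptc_grow ptc_seed ptc_pick ptc_fst ptc_snd ptc_id)+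
  have bound: "\<exists>d. \<forall>d' \<ge> d. \<exists>P. realizes P 0 (behav f (\<lambda>z. (sz z + 2) ^ d'))"
    if f: "ptc f" for f :: "'x :: enc \<Rightarrow> 'y :: enc"
  proof -
    obtain P \<tau> where P: "pbd \<tau>" "realizes P 0 (behav f \<tau>)" by (rule ptc_time[OF f])
    then obtain d where d: "\<And>z. \<tau> z \<le> (sz z + 2) ^ d" unfolding pbd_def by blast
    have "realizes P 0 (behav f (\<lambda>z. (sz z + 2) ^ d'))" if "d' \<ge> d" for d'
    proof -
      have "\<tau> z \<le> (sz z + 2) ^ d'" for z
        by (rule le_trans[OF d power_increasing]) (use that in auto)
      then show ?thesis using P(2) unfolding realizes_behav by (blast intro: calls_mono)
    qed
    then show ?thesis by blast
  qed
  obtain d0 where d0: "\<And>d. d \<ge> d0 \<Longrightarrow> \<exists>P. realizes P 0 (behav (\<lambda>z. enum (z :: (bool list \<times> bool list) list)) (\<lambda>z. (sz z + 2) ^ d))"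
    using bound[OF ptc(1)] by blast
  obtain d1 where d1: "\<And>d. d \<ge> d1 \<Longrightarrow> \<exists>P. realizes P 0 (behav eq_atom (\<lambda>z. (sz z + 2) ^ d))"
    using bound[OF ptc_atoms(1)] by blast
  obtain d2 where d2: "\<And>d. d \<ge> d2 \<Longrightarrow> \<exists>P. realizes P 0 (behav edge_atom (\<lambda>z. (sz z + 2) ^ d))"
    using bound[OF ptc_atoms(2)] by blast
  obtain d3 where d3: "\<And>d. d \<ge> d3 \<Longrightarrow> \<exists>P. realizes P 0 (behav label_atom (\<lambda>z. (sz z + 2) ^ d))"
    using bound[OF ptc_atoms(3)] by blast
  obtain d4 where d4: "\<And>d. d \<ge> d4 \<Longrightarrow> \<exists>P. realizes P 0 (behav (\<lambda>z. grow k p (fst z) (snd z)) (\<lambda>z. (sz z + 2) ^ d))"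
    using bound[OF ptc(2)] by blast
  obtain d5 where d5: "\<And>d. d \<ge> d5 \<Longrightarrow> \<exists>P. realizes P 0 (behav (\<lambda>z. seed (fst z) (snd z)) (\<lambda>z. (sz z + 2) ^ d))"
    using bound[OF ptc(3)] by blast
  obtain d6 where d6: "\<And>d. d \<ge> d6 \<Longrightarrow> \<exists>P. realizes P 0 (behav (\<lambda>z. pick k p (fst z) (snd z)) (\<lambda>z. (sz z + 2) ^ d))"
    using bound[OF ptc(4)] by blast
  \<comment> \<open>A common exponent for all helpers; exponents may be raised because the base is
    at least 2.\<close>
  define d where "d = d0 + d1 + d2 + d3 + d4 + d5 + d6"
  let ?T = "\<lambda>z. (sz z + 2) ^ d"
  define Ss where "Ss = [behav (enum :: (bool list \<times> bool list) list \<Rightarrow> _) ?T, behav eq_atom ?T, behav edge_atom ?T, behav label_atom ?T,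
    behav (\<lambda>z. grow k p (fst z) (snd z)) ?T, behav (\<lambda>z. seed (fst z) (snd z)) ?T,
    behav (\<lambda>z. pick k p (fst z) (snd z)) ?T]"
  have "\<forall>S \<in> set Ss. \<exists>P. realizes P 0 S"
  proof -
    have "\<exists>P. realizes P 0 (behav (enum :: (bool list \<times> bool list) list \<Rightarrow> _) ?T)" by (rule d0) (simp add: d_def)
    moreover have "\<exists>P. realizes P 0 (behav eq_atom ?T)" by (rule d1) (simp add: d_def)
    moreover have "\<exists>P. realizes P 0 (behav edge_atom ?T)" by (rule d2) (simp add: d_def)
    moreover have "\<exists>P. realizes P 0 (behav label_atom ?T)" by (rule d3) (simp add: d_def)
    moreover have "\<exists>P. realizes P 0 (behav (\<lambda>z. grow k p (fst z) (snd z)) ?T)" by (rule d4) (simp add: d_def)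
    moreover have "\<exists>P. realizes P 0 (behav (\<lambda>z. seed (fst z) (snd z)) ?T)" by (rule d5) (simp add: d_def)
    moreover have "\<exists>P. realizes P 0 (behav (\<lambda>z. pick k p (fst z) (snd z)) ?T)" by (rule d6) (simp add: d_def)
    ultimately show ?thesis unfolding Ss_def by simp
  qed
  from link[OF this, of 5] obtain Q off where Q: "\<And>B. length B = 5 \<Longrightarrow>
    (\<forall>j < length Ss. realizes (B @ Q) (off j) (Ss ! j))" by blast
  let ?P = "[main_body off, ev_body off, any_body, all_body, expand_body off] @ Q"
  have *: "\<And>j. j < 7 \<Longrightarrow> realizes ?P (off j) (Ss ! j)"
    using Q[of "[main_body off, ev_body off, any_body, all_body, expand_body off]"] by (simp add: Ss_def)
  have "fpt_program k p d off Q ?P"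
  proof
    show "realizes ?P (off 0) (behav (enum :: (bool list \<times> bool list) list \<Rightarrow> _) ?T)" using *[of 0] by (simp add: Ss_def)
    show "realizes ?P (off 1) (behav eq_atom ?T)" using *[of 1] by (simp add: Ss_def)
    show "realizes ?P (off 2) (behav edge_atom ?T)" using *[of 2] by (simp add: Ss_def)
    show "realizes ?P (off 3) (behav label_atom ?T)" using *[of 3] by (simp add: Ss_def)
    show "realizes ?P (off 4) (behav (\<lambda>z. grow k p (fst z) (snd z)) ?T)" using *[of 4] by (simp add: Ss_def)
    show "realizes ?P (off 5) (behav (\<lambda>z. seed (fst z) (snd z)) ?T)" using *[of 5] by (simp add: Ss_def)
    show "realizes ?P (off 6) (behav (\<lambda>z. pick k p (fst z) (snd z)) ?T)" using *[of 6] by (simp add: Ss_def)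
  qed simp
  then show ?thesis by blast
qed

section \<open>Correctness\<close>

text \<open>By \<open>cands_cover\<close> a quantifier over the candidates has the same truth value
  as one over all vertices. Free variables have to be bound, since the default of
  \<open>lookup\<close> need not be a vertex.\<close>

lemma (in coded_graph) evf_fsat:
  "set (map snd env) \<subseteq> V \<Longrightarrow> fv \<phi> \<subseteq> fst ` set env \<Longrightarrow> label_inds \<phi> \<subseteq> {..<l} \<Longrightarrow>
    evf k p vs \<phi> env \<longleftrightarrow> fsat V adj (\<lambda>u. fst (snd u)) (lookup (0, [], []) env) \<phi>"
proof (induction \<phi> arbitrary: env)
  case (Label i x)
  then have "lookup (0, [], []) env x \<in> V" using lookup_mem[of x env] by fastforce
  then have "i < length (fst (snd (lookup (0, [], []) env x)))" using Label length_labels by simp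
  then show ?case by (simp add: hdd_def Cons_nth_drop_Suc[symmetric])
next
  case (Exists x \<phi>)
  let ?s = "lookup (0, [], []) env" and ?cs = "cands k p vs (radius (enc_fm \<phi>)) env"
  have upd: "lookup (0, [], []) ((x, v) # env) = ?s(x := v)" for v by auto
  have IH: "evf k p vs \<phi> ((x, v) # env) \<longleftrightarrow> fsat V adj (\<lambda>u. fst (snd u)) (?s(x := v)) \<phi>" if "v \<in> V" for v
    unfolding upd[symmetric] using Exists.prems that by (intro Exists.IH) auto
  have fv: "?s y \<in> set (map snd env)" if "y \<in> fv \<phi> - {x}" for y
    by (rule lookup_mem) (use Exists.prems(2) that in auto)
  define F where "F v = fsat V adj (\<lambda>u. fst (snd u)) (?s(x := v)) \<phi>" for v
  have cover: "\<exists>w \<in> set ?cs. F v = F w" if "v \<in> V" for v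
    unfolding F_def by (rule cands_cover[OF Exists.prems(1) that fv])
  have sub: "set ?cs \<subseteq> V" by (rule cands_V)
  have "(\<exists>v \<in> set ?cs. evf k p vs \<phi> ((x, v) # env)) \<longleftrightarrow> (\<exists>v \<in> set ?cs. F v)"
    using IH[folded F_def] sub by (intro bex_cong) auto
  also have "\<dots> \<longleftrightarrow> (\<exists>v \<in> V. F v)" using cover sub by (metis subsetD)
  finally show ?case unfolding evf.simps fsat.simps F_def .
next
  case (Forall x \<phi>)
  let ?s = "lookup (0, [], []) env" and ?cs = "cands k p vs (radius (enc_fm \<phi>)) env"
  have upd: "lookup (0, [], []) ((x, v) # env) = ?s(x := v)" for v by auto
  have IH: "evf k p vs \<phi> ((x, v) # env) \<longleftrightarrow> fsat V adj (\<lambda>u. fst (snd u)) (?s(x := v)) \<phi>" if "v \<in> V" for v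
    unfolding upd[symmetric] using Forall.prems that by (intro Forall.IH) auto
  have fv: "?s y \<in> set (map snd env)" if "y \<in> fv \<phi> - {x}" for y
    by (rule lookup_mem) (use Forall.prems(2) that in auto)
  define F where "F v = fsat V adj (\<lambda>u. fst (snd u)) (?s(x := v)) \<phi>" for v
  have cover: "\<exists>w \<in> set ?cs. F v = F w" if "v \<in> V" for v
    unfolding F_def by (rule cands_cover[OF Forall.prems(1) that fv])
  have sub: "set ?cs \<subseteq> V" by (rule cands_V)
  have "(\<forall>v \<in> set ?cs. evf k p vs \<phi> ((x, v) # env)) \<longleftrightarrow> (\<forall>v \<in> set ?cs. F v)"
    using IH[folded F_def] sub by (intro ball_cong) auto
  also have "\<dots> \<longleftrightarrow> (\<forall>v \<in> V. F v)" using cover sub by (metis subsetD)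
  finally show ?case unfolding evf.simps fsat.simps F_def .
qed auto

section \<open>Coding a graph by its rows\<close>

definition rows :: "'a graph \<Rightarrow> 'a list \<Rightarrow> (bool list \<times> bool list) list" where
  "rows G xs = map (\<lambda>v. (map (\<lambda>L. v \<in> L) (labels G), map (\<lambda>w. {v, w} \<in> edges G) xs)) xs"

text \<open>The input tree is already the encoding of a typed list, so the program can hand it to
  \<open>enum\<close> without parsing.\<close>

lemma enc_rows: "enc (rows G xs) = enc_graph G xs"
  by (simp add: enc_list_def' rows_def enc_graph_def comp_def enc_bool_def')

lemma hdd_drop: "i < length xs \<Longrightarrow> hdd d (drop i xs) = xs ! i"
  by (simp add: hdd_def Cons_nth_drop_Suc[symmetric])

text \<open>The index keeps apart vertices with equal labels and equal rows, and tells where to look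
  in the rows of others.\<close>

definition code :: "'a graph \<Rightarrow> 'a list \<Rightarrow> nat \<Rightarrow> vx" where
  "code G xs i = (i, map (\<lambda>L. xs ! i \<in> L) (labels G), map (\<lambda>w. {xs ! i, w} \<in> edges G) xs)"

lemma enum_rows: "enum (rows G xs) = map (code G xs) [0..<length xs]"
  by (rule nth_equalityI) (simp_all add: enum_eq rows_def code_def)

lemma set_enum_rows: "set (enum (rows G xs)) = code G xs ` {..<length xs}"
  by (auto simp: enum_rows)

lemma adj_code: "j < length xs \<Longrightarrow> adj (code G xs i) (code G xs j) \<longleftrightarrow> {xs ! i, xs ! j} \<in> edges G"
  by (simp add: adj_def code_def hdd_drop)

lemma fsat_code:
  assumes xs: "distinct xs" "set xs = verts G"
  shows "label_inds \<phi> \<subseteq> {..<length (labels G)} \<Longrightarrow>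
    (\<And>x. x \<in> fv \<phi> \<Longrightarrow> \<exists>i < length xs. t x = code G xs i \<and> s x = xs ! i) \<Longrightarrow>
    fsat (set (enum (rows G xs))) adj (\<lambda>u. fst (snd u)) t \<phi> \<longleftrightarrow> sat G s \<phi>"
proof (induction \<phi> arbitrary: s t)
  case (Equal x y)
  then obtain i j where "i < length xs" "t x = code G xs i" "s x = xs ! i"
      "j < length xs" "t y = code G xs j" "s y = xs ! j" by (metis fv.simps(1) insertI1 insertI2)
  then show ?case using xs(1) by (auto simp: code_def nth_eq_iff_index_eq)
next
  case (Edge x y)
  then obtain i j where "i < length xs" "t x = code G xs i" "s x = xs ! i"
      "j < length xs" "t y = code G xs j" "s y = xs ! j" by (metis fv.simps(2) insertI1 insertI2)
  then show ?case by (simp add: adj_code)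
next
  case (Label n x)
  then obtain i where "i < length xs" "t x = code G xs i" "s x = xs ! i" by auto
  then show ?case using Label.prems(1) by (simp add: code_def)
next
  case (Neg \<phi>)
  have "fsat (set (enum (rows G xs))) adj (\<lambda>u. fst (snd u)) t \<phi> \<longleftrightarrow> sat G s \<phi>"
    by (rule Neg.IH) (use Neg.prems in auto)
  then show ?case by simp
next
  case (Conj \<phi> \<psi>)
  have "fsat (set (enum (rows G xs))) adj (\<lambda>u. fst (snd u)) t \<phi> \<longleftrightarrow> sat G s \<phi>"
    "fsat (set (enum (rows G xs))) adj (\<lambda>u. fst (snd u)) t \<psi> \<longleftrightarrow> sat G s \<psi>"
    by (rule Conj.IH; use Conj.prems in auto)+
  then show ?case by simp
next
  case (Disj \<phi> \<psi>)
  have "fsat (set (enum (rows G xs))) adj (\<lambda>u. fst (snd u)) t \<phi> \<longleftrightarrow> sat G s \<phi>"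
    "fsat (set (enum (rows G xs))) adj (\<lambda>u. fst (snd u)) t \<psi> \<longleftrightarrow> sat G s \<psi>"
    by (rule Disj.IH; use Disj.prems in auto)+
  then show ?case by simp
next
  case (Exists x \<phi>)
  have IH: "fsat (set (enum (rows G xs))) adj (\<lambda>u. fst (snd u)) (t(x := code G xs i)) \<phi> \<longleftrightarrow>
      sat G (s(x := xs ! i)) \<phi>" if "i < length xs" for i
    by (rule Exists.IH) (use Exists.prems that in auto)
  have "verts G = (\<lambda>i. xs ! i) ` {..<length xs}" using xs(2) by (auto simp: set_conv_nth)
  then show ?case using IH by (simp add: set_enum_rows)
next
  case (Forall x \<phi>)
  have IH: "fsat (set (enum (rows G xs))) adj (\<lambda>u. fst (snd u)) (t(x := code G xs i)) \<phi> \<longleftrightarrow>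
      sat G (s(x := xs ! i)) \<phi>" if "i < length xs" for i
    by (rule Forall.IH) (use Forall.prems that in auto)
  have "verts G = (\<lambda>i. xs ! i) ` {..<length xs}" using xs(2) by (auto simp: set_conv_nth)
  then show ?case using IH by (simp add: set_enum_rows)
qed

text \<open>For \<open>packing\<close>: vertices differing in more than \<open>k\<close> places
  differ in more than \<open>k' \<le> k\<close> places, so they lie in different classes of the
  equivalence \<open>near_twin G k'\<close>, of which there are at most \<open>p\<close>.\<close>

lemma coded_rows:
  assumes wf: "wf_graph l G" and xs: "enumerates xs G" and nu: "near_uniform k p G"
  shows "coded_graph k p l (enum (rows G xs))"
proof
  let ?V = "set (enum (rows G xs))" and ?n = "length xs"
  have xs': "distinct xs" "set xs = verts G" using xs by (auto simp: enumerates_def)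
  have inj: "inj_on (code G xs) {..<?n}" by (auto simp: inj_on_def code_def)
  then show "distinct (enum (rows G xs))"
    unfolding enum_rows distinct_map by (auto simp: atLeast0LessThan)
  show "adj u w = adj w u" if "u \<in> ?V" "w \<in> ?V" for u w
    using that by (auto simp: set_enum_rows adj_code insert_commute)
  show "length (fst (snd u)) = l" if "u \<in> ?V" for u
    using that wf by (auto simp: set_enum_rows code_def wf_graph_def)
  show "card S \<le> p" if S: "S \<subseteq> ?V" and far: "\<And>u w. u \<in> S \<Longrightarrow> w \<in> S \<Longrightarrow> u \<noteq> w \<Longrightarrow>
      card {x \<in> ?V. adj u x \<noteq> adj w x} > k" for S
  proof -
    from nu obtain k' where k': "k' \<le> k" and eqv: "equiv (verts G) (near_twin G k')"
      and cp: "card (verts G // near_twin G k') \<le> p" unfolding near_uniform_def by blast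
    from S obtain I where I: "I \<subseteq> {..<?n}" "S = code G xs ` I" unfolding set_enum_rows by (meson subset_imageE)
    have injI: "inj_on (code G xs) I" using inj I(1) by (rule inj_on_subset)
    let ?cls = "\<lambda>i. near_twin G k' `` {xs ! i}"
    have "inj_on ?cls I"
    proof (rule inj_onI, rule ccontr)
      fix i j assume ij: "i \<in> I" "j \<in> I" "?cls i = ?cls j" "i \<noteq> j"
      have n: "i < ?n" "j < ?n" using I(1) ij(1,2) by auto
      have "xs ! i \<in> verts G" "xs ! j \<in> verts G" using n nth_mem unfolding xs'(2)[symmetric] by blast+
      then have "(xs ! i, xs ! j) \<in> near_twin G k'" using ij(3) eq_equiv_class_iff[OF eqv] by (simp only:)
      then have le: "card (sym_diff (nbh G (xs ! i)) (nbh G (xs ! j))) \<le> k" using k' by (simp add: near_twin_def)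
      have sub: "nbh G v \<subseteq> verts G" for v
        using wf unfolding nbh_def wf_graph_def by (auto simp: doubleton_eq_iff dest!: bspec)
      \<comment> \<open>The count passes from coded vertices to indices by injectivity of
        \<open>code\<close>, and from indices to vertices by distinctness of
        \<open>xs\<close>.\<close>
      have "{x \<in> ?V. adj (code G xs i) x \<noteq> adj (code G xs j) x} =
          code G xs ` {m \<in> {..<?n}. xs ! m \<in> sym_diff (nbh G (xs ! i)) (nbh G (xs ! j))}"
        by (auto simp: set_enum_rows adj_code nbh_def)
      then have "card {x \<in> ?V. adj (code G xs i) x \<noteq> adj (code G xs j) x} =
          card {m \<in> {..<?n}. xs ! m \<in> sym_diff (nbh G (xs ! i)) (nbh G (xs ! j))}"
        using card_image[OF inj_on_subset[OF inj]] by (metis (no_types, lifting) mem_Collect_eq subsetI)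
      also have "\<dots> = card ((\<lambda>m. xs ! m) ` {m \<in> {..<?n}. xs ! m \<in> sym_diff (nbh G (xs ! i)) (nbh G (xs ! j))})"
        by (rule card_image[symmetric]) (use xs'(1) in \<open>auto simp: inj_on_def nth_eq_iff_index_eq\<close>)
      also have "\<dots> \<le> card (sym_diff (nbh G (xs ! i)) (nbh G (xs ! j)))"
      proof (rule card_mono)
        have "finite (nbh G v)" for v using wf finite_subset[OF sub] by (simp add: wf_graph_def)
        then show "finite (sym_diff (nbh G (xs ! i)) (nbh G (xs ! j)))" by simp
      qed auto
      also note le
      finally have "card {x \<in> ?V. adj (code G xs i) x \<noteq> adj (code G xs j) x} \<le> k" .
      moreover have "code G xs i \<noteq> code G xs j" using ij(4) by (simp add: code_def)
      ultimately show False using far[of "code G xs i" "code G xs j"] I(2) ij(1,2) by simp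
    qed
    then have "card I = card (?cls ` I)" by (simp add: card_image)
    also have "\<dots> \<le> card (verts G // near_twin G k')"
    proof (rule card_mono)
      show "finite (verts G // near_twin G k')"
        using wf by (intro finite_quotient) (auto simp: wf_graph_def near_twin_def)
      show "?cls ` I \<subseteq> verts G // near_twin G k'"
        using I(1) nth_mem[of _ xs] unfolding xs'(2)[symmetric] by (auto intro!: quotientI)
    qed
    finally show ?thesis using cp I(2) injI by (simp add: card_image)
  qed
qed

lemma evf_models:
  assumes wf: "wf_graph l G" and xs: "enumerates xs G" and nu: "near_uniform k p G" and \<phi>: "sentence l \<phi>"
  shows "evf k p (enum (rows G xs)) \<phi> [] \<longleftrightarrow> models G \<phi>"
proof -
  interpret coded_graph k p l "enum (rows G xs)" by (rule coded_rows[OF wf xs nu])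
  have *: "fv \<phi> = {}" "label_inds \<phi> \<subseteq> {..<l}" "length (labels G) = l" "distinct xs" "set xs = verts G"
    using \<phi> wf xs by (auto simp: sentence_def wf_graph_def enumerates_def)
  have "evf k p (enum (rows G xs)) \<phi> [] \<longleftrightarrow> fsat V adj (\<lambda>u. fst (snd u)) (lookup (0, [], []) []) \<phi>"
    by (rule evf_fsat) (use * in auto)
  \<comment> \<open>A sentence has no free variables, so \<open>s\<close> is arbitrary here, which
    gives the quantification over assignments in \<open>models\<close>.\<close>
  also have "\<dots> \<longleftrightarrow> sat G s \<phi>" for s
    by (rule fsat_code) (use * in auto)
  finally show ?thesis unfolding models_def by blast
qed

section \<open>The running time\<close>

lemma radius_le: "radius t + 1 \<le> 8 ^ size t"
proof (induction t)
  case (Node a b)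
  have "8 ^ size a \<le> (8::nat) ^ (size a + size b)" "8 ^ size b \<le> (8::nat) ^ (size a + size b)"
    by (intro power_increasing; simp)+
  moreover have "(8::nat) ^ size (Node a b) = 8 * 8 ^ (size a + size b)" by simp
  ultimately show ?case using Node unfolding radius.simps by linarith
qed simp

text \<open>The number of labels enters because \<open>fm_size\<close> does not count label indices.
  A node needs at most 7 cells for its tag and 3 for the list around it.\<close>

lemma size_enc_fm: "label_inds \<phi> \<subseteq> {..<l} \<Longrightarrow> size (enc_fm \<phi>) \<le> (l + 10) * fm_size \<phi>"
proof (induction \<phi>)
  case (Label i x)
  then show ?case unfolding enc_fm_Node by (simp add: sz_nat algebra_simps)
qed (auto simp: enc_fm_Node sz_nat algebra_simps simp del: enc_fm.simps)

lemma sz_bools: "sz (bs :: bool list) \<le> 2 * length bs"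
  using sz_list_le[of bs 1] sz_bool by (simp add: mult.commute)

context fpt_program
begin

context
  fixes l :: nat
begin

text \<open>
  In terms of the formula size \<open>s\<close> and the order \<open>N\<close>, these bound the radius, the length of an
  expanded tuple, the number of types, the size of a vertex, the size of the arguments of a helper
  function and the time of a call of a helper function.
\<close>

definition R_bd :: "nat \<Rightarrow> nat" where "R_bd s = 8 ^ ((l + 10) * s)"
definition m_bd :: "nat \<Rightarrow> nat" where "m_bd s = (s + l + 1) * (5 * k * p + 1) ^ R_bd s"
definition q_bd :: "nat \<Rightarrow> nat" where
  "q_bd s = 2 ^ ((l + 3 * (p + p * (p * (4 * k))) + 2 * m_bd s) * m_bd s)"
definition vx_bd :: "nat \<Rightarrow> nat" where "vx_bd N = 3 * N + 2 * l + 2"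
definition sz_bd :: "nat \<Rightarrow> nat \<Rightarrow> nat" where
  "sz_bd s N = N * (vx_bd N + 1) + (s + l) * (s + l + vx_bd N + 2) +
    N * (vx_bd N + m_bd s * (vx_bd N + 1) + 2) + 2 * (s + l) + 10"
definition B_bd :: "nat \<Rightarrow> nat \<Rightarrow> nat" where "B_bd s N = (sz_bd s N + 2) ^ d"
definition time_bd :: "nat \<Rightarrow> nat \<Rightarrow> nat" where
  "time_bd s N = 20 + (N * (2 * l + 2 * N + 2) + 2) ^ d +
    (1000 + 2 * B_bd s N + R_bd s * (B_bd s N + 200)) * (q_bd s + 3) ^ s"

text \<open>\<open>N\<close> occurs only in bases of powers with the constant exponent
  \<open>d\<close>; every other exponent depends on the formula size alone.\<close>

lemma fpt_time_bd: "fpt_bounded time_bd"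
proof -
  have R: "tower_bounded R_bd" unfolding R_bd_def by (intro tb_rules)
  have m: "tower_bounded m_bd" unfolding m_bd_def by (intro tb_rules R)
  have q: "tower_bounded q_bd" unfolding q_bd_def by (intro tb_rules m)
  have s: "fpt_bounded (\<lambda>s N. s)" "fpt_bounded (\<lambda>s N. c)" for c by (intro fpt_tb tb_rules)+
  have v: "fpt_bounded (\<lambda>s N. vx_bd N)" unfolding vx_bd_def by (intro fpt_rules s)
  have z: "fpt_bounded sz_bd" unfolding sz_bd_def by (intro fpt_rules s v fpt_tb[OF m])
  have B: "fpt_bounded B_bd" unfolding B_bd_def by (intro fpt_rules s z)
  have "tower_bounded (\<lambda>s. (q_bd s + 3) ^ s)" by (intro tb_rules q)
  then show ?thesis unfolding time_bd_def by (intro fpt_rules s B fpt_tb[OF R] fpt_tb)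
qed

lemma call_program:
  assumes wf: "wf_graph l G" and xs: "enumerates xs G" and nu: "near_uniform k p G" and \<phi>: "sentence l \<phi>"
  shows "calls P 0 [enc_graph G xs, enc_fm \<phi>] (enc_bool (models G \<phi>)) (time_bd (fm_size \<phi>) (max 1 (card (verts G))))"
proof -
  let ?g = "rows G xs" and ?vs = "enum (rows G xs)"
  define s where "s = fm_size \<phi>"
  define N where "N = max 1 (card (verts G))"
  interpret coded_graph k p l ?vs by (rule coded_rows[OF wf xs nu])
  have n: "length xs \<le> N" using xs unfolding N_def enumerates_def by (metis distinct_card max.cobounded2)
  have lenG: "length (labels G) = l" using wf by (simp add: wf_graph_def)
  have vx: "sz v \<le> vx_bd N" if "v \<in> V" for v
  proof -
    from that obtain i where i: "i < length xs" "v = code G xs i" by (auto simp: set_enum_rows)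
    have "sz v = Suc (i + Suc (sz (map (\<lambda>L. xs ! i \<in> L) (labels G)) + sz (map (\<lambda>w. {xs ! i, w} \<in> edges G) xs)))"
      unfolding i(2) code_def by (simp add: sz_nat)
    also have "\<dots> \<le> Suc (i + Suc (2 * l + 2 * length xs))"
      using sz_bools[of "map (\<lambda>L. xs ! i \<in> L) (labels G)"] sz_bools[of "map (\<lambda>w. {xs ! i, w} \<in> edges G) xs"] lenG
      by simp
    finally show ?thesis using i(1) n by (simp add: vx_bd_def)
  qed
  have vxs: "sz M \<le> length M * (vx_bd N + 1)" if "set M \<subseteq> V" for M
    by (rule sz_list_le) (use vx that in blast)
  have len_vs: "length ?vs \<le> N" using n by (simp add: enum_rows)
  have szg: "sz ?g \<le> N * (2 * l + 2 * N + 2)"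
  proof -
    have "sz ?g \<le> length ?g * ((2 * l + 2 * N + 1) + 1)"
    proof (rule sz_list_le)
      fix a assume "a \<in> set ?g"
      then obtain v where a: "a = (map (\<lambda>L. v \<in> L) (labels G), map (\<lambda>w. {v, w} \<in> edges G) xs)" by (auto simp: rows_def)
      show "sz a \<le> 2 * l + 2 * N + 1"
        using sz_bools[of "map (\<lambda>L. v \<in> L) (labels G)"] sz_bools[of "map (\<lambda>w. {v, w} \<in> edges G) xs"] lenG n
        unfolding a sz_Pair by simp
    qed
    also have "\<dots> \<le> N * (2 * l + 2 * N + 2)" using n by (intro mult_mono) (simp_all add: rows_def)
    finally show ?thesis .
  qed
  let ?good = "\<lambda>env. set (map snd env) \<subseteq> V \<and> (\<forall>x \<in> set env. fst x \<le> s + l) \<and> length env \<le> s + l"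
  have szvs: "sz ?vs \<le> N * (vx_bd N + 1)"
    using vxs[OF order_refl] mult_right_mono[OF len_vs le0, of "vx_bd N + 1"] by linarith
  have szenv: "sz env \<le> (s + l) * (s + l + vx_bd N + 2)" if g: "?good env" for env
  proof -
    have "sz env \<le> length env * ((s + l + vx_bd N + 1) + 1)"
    proof (rule sz_list_le)
      fix a assume a: "a \<in> set env"
      then have "fst a \<le> s + l" "snd a \<in> V" using g by auto
      then show "sz a \<le> s + l + vx_bd N + 1" using vx[of "snd a"] by (simp add: enc_prod_def[of a] sz_nat)
    qed
    also have "\<dots> \<le> (s + l) * (s + l + vx_bd N + 2)" using g by (intro mult_mono) simp_all
    finally show ?thesis .
  qed
  have szX: "sz ((grow k p ?vs ^^ i) (seed ?vs env)) \<le> N * (vx_bd N + m_bd s * (vx_bd N + 1) + 2)"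
    if g: "?good env" and i: "i \<le> R_bd s" for env i
  proof -
    let ?X = "(grow k p ?vs ^^ i) (seed ?vs env)"
    have "sz ?X \<le> length ?X * ((vx_bd N + m_bd s * (vx_bd N + 1) + 1) + 1)"
    proof (rule sz_list_le)
      fix a assume "a \<in> set ?X"
      then obtain v where v: "v \<in> V" "a = (v, expands i (v # map snd env))"
        by (auto simp: grow_pow seed_def)
      have V: "set (v # map snd env) \<subseteq> V" using v(1) g by simp
      have "length (expands i (v # map snd env)) \<le> m_bd s"
      proof -
        have "(5 * k * p + 1) ^ i \<le> (5 * k * p + 1) ^ R_bd s" using i by (intro power_increasing) auto
        then show ?thesis unfolding length_expands[OF V] m_bd_def using g by (intro mult_mono) simp_all
      qed
      then have "length (expands i (v # map snd env)) * (vx_bd N + 1) \<le> m_bd s * (vx_bd N + 1)"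
        by (rule mult_right_mono) simp
      then show "sz a \<le> vx_bd N + m_bd s * (vx_bd N + 1) + 1"
        using vxs[OF expands_V[OF V, of i]] vx[OF v(1)] unfolding v(2) sz_Pair by linarith
    qed
    also have "\<dots> \<le> N * (vx_bd N + m_bd s * (vx_bd N + 1) + 2)"
      using len_vs by (intro mult_mono) (simp_all add: grow_pow seed_def)
    finally show ?thesis .
  qed
  have "calls P 1 [enc ?vs, enc_fm \<phi>, enc ([] :: (nat \<times> vx) list)] (enc (evf k p ?vs \<phi> []))
      ((1000 + 2 * B_bd s N + R_bd s * (B_bd s N + 200)) * (q_bd s + 3) ^ fm_size \<phi>)"
  \<comment> \<open>\<open>s\<close> bounds variable names and the length of environments,
    \<open>l\<close> the label indices.\<close>
  proof (rule call_ev[where M = "s + l"])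
    fix env assume g: "?good env"
    show "(sz (?vs, (grow k p ?vs ^^ i) (seed ?vs env)) + 2) ^ d \<le> B_bd s N" if "i \<le> R_bd s" for i
      unfolding B_bd_def
    proof (rule power_mono)
      show "sz (?vs, (grow k p ?vs ^^ i) (seed ?vs env)) + 2 \<le> sz_bd s N + 2"
        using szvs szX[OF g that] unfolding sz_Pair sz_bd_def by linarith
    qed simp
    show "(sz (?vs, env) + 2) ^ d \<le> B_bd s N" unfolding B_bd_def
    proof (rule power_mono)
      show "sz (?vs, env) + 2 \<le> sz_bd s N + 2"
        using szvs szenv[OF g] unfolding sz_Pair sz_bd_def by linarith
    qed simp
    show "(sz (env, x, y) + 2) ^ d \<le> B_bd s N" if "x \<le> s + l" "y \<le> s + l" for x y
      unfolding B_bd_def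
    proof (rule power_mono)
      show "sz (env, x, y) + 2 \<le> sz_bd s N + 2"
      proof -
        have "Suc (e + Suc (x + y)) + 2 \<le> a + b + a' + 2 * (s + l) + 10 + 2" if "e \<le> b" for e a b a'
          using that \<open>x \<le> s + l\<close> \<open>y \<le> s + l\<close> by simp
        then show ?thesis using szenv[OF g] unfolding sz_Pair sz_bd_def sz_nat by blast
      qed
    qed simp
    show "length (cands k p ?vs r env) \<le> q_bd s" if r: "r \<le> R_bd s" for r
      unfolding q_bd_def
    proof (rule length_cands)
      have "(5 * k * p + 1) ^ r \<le> (5 * k * p + 1) ^ R_bd s" using r by (intro power_increasing) auto
      then show "(length env + 1) * (5 * k * p + 1) ^ r \<le> m_bd s"
        unfolding m_bd_def using g by (intro mult_mono) simp_all
    qed (use g in simp)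
    show "set (cands k p ?vs r env) \<subseteq> V" for r by (rule cands_V)
  next
    have "label_inds \<phi> \<subseteq> {..<l}" using \<phi> by (simp add: sentence_def)
    from power_increasing[OF size_enc_fm[OF this], of "8::nat"]
    have "8 ^ size (enc_fm \<phi>) \<le> R_bd s" unfolding R_bd_def s_def by linarith
    then show "radius (enc_fm \<phi>) \<le> R_bd s" using radius_le[of "enc_fm \<phi>"] by linarith
    show "\<forall>i \<in> label_inds \<phi>. i \<le> s + l" using \<open>label_inds \<phi> \<subseteq> {..<l}\<close> by auto
  qed (simp_all add: s_def)
  from call_main[OF this[unfolded enc_Nil]]
  have run: "calls P 0 [enc_graph G xs, enc_fm \<phi>] (enc_bool (models G \<phi>))
      (20 + (sz ?g + 2) ^ d + (1000 + 2 * B_bd s N + R_bd s * (B_bd s N + 200)) * (q_bd s + 3) ^ fm_size \<phi>)"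
    unfolding evf_models[OF wf xs nu \<phi>] enc_bool_def' enc_rows .
  have "(sz ?g + 2) ^ d \<le> (N * (2 * l + 2 * N + 2) + 2) ^ d"
    using szg by (intro power_mono) auto
  then have "calls P 0 [enc_graph G xs, enc_fm \<phi>] (enc_bool (models G \<phi>)) (time_bd s N)"
    by (intro calls_mono[OF run]) (simp add: time_bd_def s_def)
  then show ?thesis unfolding s_def N_def .
qed

end

end

theorem theorem7:
  fixes C :: "'a graph set" and k0 p l :: nat
  assumes "\<forall>G \<in> C. wf_graph l G"
    and "near_uniform_class k0 p C"
  shows "\<exists>(P :: program) (f :: nat \<Rightarrow> nat) (c :: nat).
           computable f \<and>
           (\<forall>G xs \<phi>. G \<in> C \<and> enumerates xs G \<and> sentence l \<phi> \<longrightarrow>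
              (\<exists>t. runs_in P [enc_graph G xs, enc_fm \<phi>] (enc_bool (models G \<phi>)) t \<and>
                   t \<le> f (fm_size \<phi>) * (max 1 (card (verts G))) ^ c))"
proof -
  \<comment> \<open>The program depends on \<open>k0\<close> and \<open>p\<close> only and is fixed
    before any graph or formula.\<close>
  obtain d off Q P where "fpt_program k0 p d off Q P" using program_exists by blast
  then interpret fpt_program k0 p d off Q P .
  obtain h c where h: "tower_bounded h" and time: "\<And>s N. 1 \<le> N \<Longrightarrow> time_bd l s N \<le> h s * N ^ c"
    using fpt_time_bd[of l] unfolding fpt_bounded_def by blast
  then obtain e where e: "\<And>s. h s \<le> tow (s + e)" unfolding tower_bounded_def by blast
  have "\<exists>t. runs_in P [enc_graph G xs, enc_fm \<phi>] (enc_bool (models G \<phi>)) t \<and>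
      t \<le> tow (fm_size \<phi> + e) * (max 1 (card (verts G))) ^ c"
    if "G \<in> C" "enumerates xs G" "sentence l \<phi>" for G xs \<phi>
  proof -
    let ?N = "max 1 (card (verts G))"
    have "wf_graph l G" "near_uniform k0 p G"
      using assms that(1) by (simp_all add: near_uniform_class_def)
    from call_program[OF this(1) that(2) this(2) that(3)]
    obtain t where t: "P \<noteq> []" "eval P [enc_graph G xs, enc_fm \<phi>] (P ! 0) (enc_bool (models G \<phi>)) t"
      "t \<le> time_bd l (fm_size \<phi>) ?N" unfolding calls_def evl_def by auto
    have "time_bd l (fm_size \<phi>) ?N \<le> h (fm_size \<phi>) * ?N ^ c" by (rule time) simp
    also have "\<dots> \<le> tow (fm_size \<phi> + e) * ?N ^ c" by (rule mult_right_mono[OF e]) simp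
    finally show ?thesis using t unfolding runs_in_def by (auto simp: hd_conv_nth intro: le_trans)
  qed
  then show ?thesis using computable_tow[of e] by blast
qed

end
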